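(* Let $a,b,c,d$ be positive integers with $b>1$, $d>1$ and $a(b-1)=c(d-1)=:N$, let $\sigma$ be a permutation of $\{1,\dots,N\}$ different from the identity, and let $f$ be the corresponding simple generalization of $P(a,b,c,d)$ defined below. Then for every positive integer $m$, $f$ has only finitely many $m$-cycles, and these $m$-cycles can be computed.
   Context: $\mathbb{N}_0=\{0,1,2,\dots\}$. Let $r_1<\dots<r_N$ be the elements of $\{1,\dots,ab-1\}$ not divisible by $b$, and $s_1<\dots<s_N$ the elements of $\{1,\dots,cd-1\}$ not divisible by $d$. The simple generalization $f:\mathbb{N}_0\to\mathbb{N}_0$ associated with $\sigma$ is defined for $n\in\mathbb{N}_0$ by $f(bn)=dn$ and $f(abn+r_i)=cdn+s_{\sigma(i)}$ for $i=1,\dots,N$; it is a bijection. A cycle of $f$ is a finite sequence of distinct elements $x_0,\dots,x_{p-1}$ with $f(x_i)=x_{i+1}$ (indices mod $p$). An $m$-cycle is a cycle which, read cyclically, has exactly $m$ local minima and $m$ local maxima ($x_i$ is a local minimum if $x_{i-1}>x_i<x_{i+1}$, a local maximum if $x_{i-1}<x_i>x_{i+1}$, indices mod $p$).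
   Formalization: The formal theorem adds b ≠ d: if b = d then a = c and each nontrivial cycle of σ repeats in every block, giving infinitely many m-cycles for some m (e.g. a=c=1, b=d=3, σ=(1 2), m=1), so the claim fails there. *)

theory Defs
  imports "HOL-Combinatorics.Permutations" "HOL-Library.Nat_Bijection"
begin

subsection \<open>Simple generalizations of P(a,b,c,d)\<close>

text \<open>\<open>nondiv k b i\<close>, for \<open>i \<ge> 1\<close>, is the \<open>i\<close>-th smallest element of \<open>{1, ..., k * b - 1}\<close> not
  divisible by \<open>b\<close>; thus \<open>r_i = nondiv a b i\<close> and \<open>s_i = nondiv c d i\<close>.\<close>

definition nondiv :: "nat \<Rightarrow> nat \<Rightarrow> nat \<Rightarrow> nat" where
  "nondiv k b i = sorted_list_of_set {x \<in> {1..k * b - 1}. \<not> b dvd x} ! (i - 1)"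

definition admissible :: "nat \<Rightarrow> nat \<Rightarrow> nat \<Rightarrow> nat \<Rightarrow> (nat \<Rightarrow> nat) \<Rightarrow> bool" where
  "admissible a b c d \<sigma> \<longleftrightarrow>
     a > 0 \<and> b > 1 \<and> c > 0 \<and> d > 1 \<and> a * (b - 1) = c * (d - 1) \<and>
     \<sigma> permutes {1..a * (b - 1)} \<and> \<sigma> \<noteq> id"

text \<open>The defining equations are \<open>simple_gen_dvd\<close> and \<open>simple_gen_nondvd\<close> below.\<close>

definition simple_gen :: "nat \<Rightarrow> nat \<Rightarrow> nat \<Rightarrow> nat \<Rightarrow> (nat \<Rightarrow> nat) \<Rightarrow> nat \<Rightarrow> nat" where
  "simple_gen a b c d \<sigma> n =
     (if b dvd n then d * (n div b)
      else c * d * (n div (a * b)) +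
           nondiv c d (\<sigma> (THE i. i \<in> {1..a * (b - 1)} \<and> nondiv a b i = n mod (a * b))))"

lemma card_nondiv:
  assumes "b > 0"
  shows "card {x \<in> {1..k * b - 1}. \<not> b dvd x} = k * (b - 1)"
proof (cases "k = 0")
  case False
  have eq: "{x \<in> {1..k * b - 1}. \<not> b dvd x} = {..<k * b} - (\<lambda>j. b * j) ` {..<k}"
  proof (intro equalityI subsetI)
    fix x assume "x \<in> {x \<in> {1..k * b - 1}. \<not> b dvd x}"
    then show "x \<in> {..<k * b} - (\<lambda>j. b * j) ` {..<k}" using False assms by auto
  next
    fix x assume x: "x \<in> {..<k * b} - (\<lambda>j. b * j) ` {..<k}"
    have "\<not> b dvd x"
    proof
      assume "b dvd x"
      then obtain j where j: "x = b * j" by auto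
      with x assms have "j < k" by (simp add: mult.commute)
      with x j show False by auto
    qed
    moreover from this have "x \<noteq> 0" by (metis dvd_0_right)
    ultimately show "x \<in> {x \<in> {1..k * b - 1}. \<not> b dvd x}" using x by auto
  qed
  have "(\<lambda>j. b * j) ` {..<k} \<subseteq> {..<k * b}" using assms by (auto simp: mult.commute)
  moreover have "card ((\<lambda>j. b * j) ` {..<k}) = k"
    using assms by (subst card_image) (auto simp: inj_on_def)
  ultimately show ?thesis unfolding eq
    by (subst card_Diff_subset) (auto simp: diff_mult_distrib2)
qed auto

lemma bij_betw_nondiv:
  assumes "b > 0"
  shows "bij_betw (nondiv k b) {1..k * (b - 1)} {x \<in> {1..k * b - 1}. \<not> b dvd x}"
proof -
  let ?S = "{x \<in> {1..k * b - 1}. \<not> b dvd x}"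
  have "bij_betw (\<lambda>i. sorted_list_of_set ?S ! i) {..<k * (b - 1)} ?S"
    by (rule bij_betw_nth) (use card_nondiv[OF assms, of k] in auto)
  moreover have "bij_betw (\<lambda>i. i - 1) {1..k * (b - 1)} {..<k * (b - 1)}"
    by (rule bij_betw_byWitness[where f' = Suc]) auto
  ultimately have "bij_betw ((\<lambda>i. sorted_list_of_set ?S ! i) \<circ> (\<lambda>i. i - 1)) {1..k * (b - 1)} ?S"
    by (rule bij_betw_trans[rotated])
  then show ?thesis by (simp add: nondiv_def[abs_def] comp_def)
qed

lemma nondiv_less:
  assumes "b > 0" "i \<in> {1..k * (b - 1)}" "j \<in> {1..k * (b - 1)}" "i < j"
  shows "nondiv k b i < nondiv k b j"
proof -
  have "i - 1 < j - 1" using assms(2,4) by auto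
  moreover have "j - 1 < length (sorted_list_of_set {x \<in> {1..k * b - 1}. \<not> b dvd x})"
    unfolding length_sorted_list_of_set card_nondiv[OF assms(1)] using assms(3) by force
  ultimately show ?thesis unfolding nondiv_def
    by (rule sorted_wrt_nth_less[OF strict_sorted_list_of_set])
qed

lemma simple_gen_dvd:
  "b > 0 \<Longrightarrow> simple_gen a b c d \<sigma> (b * n) = d * n"
  by (simp add: simple_gen_def)

lemma simple_gen_nondvd:
  assumes "b > 0" "i \<in> {1..a * (b - 1)}"
  shows "simple_gen a b c d \<sigma> (a * b * n + nondiv a b i) = c * d * n + nondiv c d (\<sigma> i)"
proof -
  note bij = bij_betw_nondiv[OF assms(1), of a]
  have r: "nondiv a b i \<in> {x \<in> {1..a * b - 1}. \<not> b dvd x}"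
    using bij assms(2) by (rule bij_betwE[rule_format])
  then have nd: "\<not> b dvd a * b * n + nondiv a b i"
    by (auto simp: dvd_add_right_iff)
  have lt: "nondiv a b i < a * b" using r by auto
  have the: "(THE j. j \<in> {1..a * (b - 1)} \<and> nondiv a b j = nondiv a b i) = i"
    using assms(2) inj_onD[OF bij_betw_imp_inj_on[OF bij]] by (intro the_equality) blast+
  have "(k * n + x) div k = n \<and> (k * n + x) mod k = x" if "x < k" for k x :: nat
    using that by auto
  from this[OF lt] have "(a * b * n + nondiv a b i) div (a * b) = n"
    "(a * b * n + nondiv a b i) mod (a * b) = nondiv a b i" by blast+
  then show ?thesis unfolding simple_gen_def if_not_P[OF nd] by (simp only: the)
qed


subsection \<open>Cycles\<close>

text \<open>A cycle is a sequence with a chosen starting point: rotations of a cycle are different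
  lists.\<close>

definition is_cycle :: "(nat \<Rightarrow> nat) \<Rightarrow> nat list \<Rightarrow> bool" where
  "is_cycle f xs \<longleftrightarrow> xs \<noteq> [] \<and> distinct xs \<and>
     (\<forall>i < length xs. f (xs ! i) = xs ! ((i + 1) mod length xs))"

definition cyc_pred :: "nat list \<Rightarrow> nat \<Rightarrow> nat" where
  "cyc_pred xs i = xs ! ((i + length xs - 1) mod length xs)"

definition cyc_succ :: "nat list \<Rightarrow> nat \<Rightarrow> nat" where
  "cyc_succ xs i = xs ! ((i + 1) mod length xs)"

definition local_minima :: "nat list \<Rightarrow> nat set" where
  "local_minima xs = {i. i < length xs \<and> cyc_pred xs i > xs ! i \<and> xs ! i < cyc_succ xs i}"

definition local_maxima :: "nat list \<Rightarrow> nat set" where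
  "local_maxima xs = {i. i < length xs \<and> cyc_pred xs i < xs ! i \<and> xs ! i > cyc_succ xs i}"

definition m_cycle :: "(nat \<Rightarrow> nat) \<Rightarrow> nat \<Rightarrow> nat list \<Rightarrow> bool" where
  "m_cycle f m xs \<longleftrightarrow> is_cycle f xs \<and> card (local_minima xs) = m \<and> card (local_maxima xs) = m"

text \<open>If \<open>b = d\<close> (hence \<open>a = c\<close>), then \<open>simple_gen a b c d \<sigma>\<close> fixes the multiples of \<open>b\<close> and acts
  in the same way on every block \<open>{a * b * n..<a * b * (n + 1)}\<close>, so each nontrivial cycle of \<open>\<sigma>\<close>
  gives infinitely many cycles with the same number of minima and maxima. For this reason results
  about the finiteness of the set of \<open>m\<close>-cycles have to assume \<open>b \<noteq> d\<close>.\<close>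

lemma infinite_m_cycles_if_eq:
  "admissible 1 3 1 3 (transpose 1 2)"
  "infinite {xs. m_cycle (simple_gen 1 3 1 3 (transpose 1 2)) 1 xs}"
proof -
  show "admissible 1 3 1 3 (transpose 1 2)"
    unfolding admissible_def
    by (auto simp: fun_eq_iff transpose_def intro!: permutes_swap_id exI[of _ "1::nat"])
  let ?f = "simple_gen 1 3 1 3 (transpose 1 2)"
  have "{x \<in> {1..1 * 3 - 1}. \<not> 3 dvd x} = {1, 2 :: nat}" by auto
  then have nd: "nondiv 1 3 1 = 1" "nondiv 1 3 2 = 2" by (simp_all add: nondiv_def)
  have f1: "?f (3 * n + 1) = 3 * n + 2" for n
    using simple_gen_nondvd[of 3 1 1 1 3 "transpose 1 2" n] nd by simp
  have f2: "?f (3 * n + 2) = 3 * n + 1" for n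
    using simple_gen_nondvd[of 3 2 1 1 3 "transpose 1 2" n] nd by simp
  have "m_cycle ?f 1 [3 * n + 1, 3 * n + 2]" for n
  proof -
    have "local_minima [3 * n + 1, 3 * n + 2] = {0}"
      by (auto simp: local_minima_def cyc_pred_def cyc_succ_def less_Suc_eq numeral_2_eq_2)
    moreover have "local_maxima [3 * n + 1, 3 * n + 2] = {1}"
      by (auto simp: local_maxima_def cyc_pred_def cyc_succ_def less_Suc_eq numeral_2_eq_2)
    moreover have "is_cycle ?f [3 * n + 1, 3 * n + 2]"
      using f1[of n] f2[of n] by (auto simp: is_cycle_def less_Suc_eq numeral_2_eq_2)
    ultimately show ?thesis by (simp add: m_cycle_def)
  qed
  then have "range (\<lambda>n. [3 * n + 1, 3 * n + 2]) \<subseteq> {xs. m_cycle ?f 1 xs}" by auto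
  moreover have "infinite (range (\<lambda>n :: nat. [3 * n + 1, 3 * n + 2]))"
    by (subst finite_image_iff) (auto simp: inj_on_def)
  ultimately show "infinite {xs. m_cycle ?f 1 xs}" by (rule infinite_super)
qed


subsection \<open>Computability\<close>

text \<open>Kleene's partial recursive functions. \<open>rec_eval e xs y\<close> says that \<open>e\<close>, applied to the
  arguments \<open>xs\<close>, terminates with value \<open>y\<close>.\<close>

datatype recf =
    Zero
  | Succ
  | Proj nat
  | Comp recf "recf list"
  | PrimRec recf recf
  | Mu recf

inductive rec_eval :: "recf \<Rightarrow> nat list \<Rightarrow> nat \<Rightarrow> bool" where
  zero: "rec_eval Zero xs 0"
| succ: "rec_eval Succ [x] (Suc x)"
| proj: "i < length xs \<Longrightarrow> rec_eval (Proj i) xs (xs ! i)"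
| comp: "list_all2 (\<lambda>g y. rec_eval g xs y) gs ys \<Longrightarrow> rec_eval e ys z \<Longrightarrow>
    rec_eval (Comp e gs) xs z"
| prim_0: "rec_eval e xs y \<Longrightarrow> rec_eval (PrimRec e g) (0 # xs) y"
| prim_Suc: "rec_eval (PrimRec e g) (n # xs) y \<Longrightarrow> rec_eval g (n # y # xs) z \<Longrightarrow>
    rec_eval (PrimRec e g) (Suc n # xs) z"
| mu: "rec_eval e (n # xs) 0 \<Longrightarrow> (\<forall>k. k < n \<longrightarrow> (\<exists>y. rec_eval e (k # xs) (Suc y))) \<Longrightarrow>
    rec_eval (Mu e) xs n"

inductive_cases rec_eval_elims:
  "rec_eval Zero xs y"
  "rec_eval Succ xs y"
  "rec_eval (Proj i) xs y"
  "rec_eval (Comp e gs) xs y"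
  "rec_eval (PrimRec e g) (0 # xs) y"
  "rec_eval (PrimRec e g) (Suc n # xs) y"
  "rec_eval (Mu e) xs y"

lemma rec_eval_unique:
  assumes "rec_eval e xs y" "rec_eval e xs z"
  shows "y = z"
  using assms
proof (induction arbitrary: z rule: rec_eval.induct)
  case (comp xs gs ys e w)
  from comp.prems obtain ys' where
    ys': "list_all2 (\<lambda>g y. rec_eval g xs y) gs ys'" "rec_eval e ys' z"
    by (blast elim: rec_eval_elims)
  have "ys = ys'"
    using comp.IH(1) ys'(1) unfolding list_all2_conv_all_nth by (auto intro!: nth_equalityI)
  with comp.IH(2) ys'(2) show ?case by simp
next
  case (prim_Suc e g n xs y w)
  from prim_Suc.prems obtain y' where
    "rec_eval (PrimRec e g) (n # xs) y'" "rec_eval g (n # y' # xs) z"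
    by (blast elim: rec_eval_elims)
  with prim_Suc.IH show ?case by blast
next
  case (mu e n xs)
  from mu.prems have z: "rec_eval e (z # xs) 0"
      "\<forall>k. k < z \<longrightarrow> (\<exists>y. rec_eval e (k # xs) (Suc y))"
    by (auto elim!: rec_eval_elims(7))
  show ?case
  proof (rule linorder_cases[of n z])
    assume "n < z"
    with z(2) mu.IH(1) show ?thesis by blast
  next
    assume "z < n"
    with mu.IH(2) z(1) show ?thesis by blast
  qed
qed (blast elim: rec_eval_elims)+

text \<open>The list \<open>[\<sigma> 1, ..., \<sigma> N]\<close>, by which a permutation \<open>\<sigma>\<close> of \<open>{1..N}\<close> is presented to an
  algorithm.\<close>

definition perm_code :: "nat \<Rightarrow> (nat \<Rightarrow> nat) \<Rightarrow> nat" where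
  "perm_code N \<sigma> = list_encode (map \<sigma> [1..<N + 1])"

text \<open>The natural number \<open>y\<close> codes a finite list of finite sequences whose members are exactly the
  elements of \<open>A\<close>.\<close>

definition codes_set :: "nat \<Rightarrow> nat list set \<Rightarrow> bool" where
  "codes_set y A \<longleftrightarrow> set (map list_decode (list_decode y)) = A"

end

(* Reversing cycles exchanges (a,b) and (c,d), so let b < d. Then f multiplies multiples of b by
   alpha = d/b > 1 and other large numbers approximately by 1/beta, where
   beta = (d-1)b/((b-1)d) > 1; alpha and beta are multiplicatively independent because b and d
   differ. Let a cycle with m local minima contain k multiples of b and l other elements, K = k + l,
   and let x be its least element. The product of the ratios f(y)/y over the cycle is 1, hence
   |k log alpha - l log beta| is at most a constant times K/x. A lower bound of the form
   exp(-C (log K)^2) for linear forms in two logarithms therefore bounds x by exp(C' (log K)^2).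
   An ascending run of multiples of b starting at y has length at most log_2 y, so passing a
   local minimum at most raises the bound for the elements to the power d + 1. Hence the logarithms
   of all elements, and then the numbers of ascending and descending steps, are
   O((log K)^2) with explicit constants; this bounds K and the whole cycle.

   The lower bound for the linear form is proved by Gelfond's and Schneider's method in the real
   case: the pigeonhole principle gives an integer polynomial P(X,Y) such that P(t, beta^(t/k)) has
   tiny Taylor coefficients. If the linear form is tiny, P is tiny at the points
   (rk + sl, beta^r alpha^s); being rational there with small denominators, it vanishes. A zero
   estimate based on a determinant of translates of P contradicts this.

   The cycles are computed by searching for a code whose members are exactly the codes, below the
   explicit bound, of m-cycles. *)

theory Submission
  imports Defs "Jordan_Normal_Form.Determinant" "HOL-Computational_Algebra.Primes"
begin

section \<open>A zero estimate\<close>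

text \<open>If the linear form k log alpha - l log beta is tiny, then alpha is nearly beta^(l/k), so
  the curve t -> (t, beta^(t/k)) passes very close to all the points (rk + sl, beta^r alpha^s). This
  lets a function of one real variable be compared with rational data at R^2 points. No
  extrapolation step occurs: the exponents that arise on the whole interval containing these points
  are small multiples of R^2, so expansion at 0 up to order R^2 / 2 controls the function there. The
  zero estimate needs distinct abscissae rk + sl. They may coincide if, after division by the gcd,
  both coefficients are below R; in that case a comparison of two integers suffices. The ratio A = R
  / J depends only on d, while J has to exceed a constant plus a multiple of log K; this is the
  source of the exponent (log K)^2. Ascending runs are short because each of their steps multiplies
  by d/b: in lowest terms d'/b', it uses up one factor b' of the current element.\<close>

lemma coeff_mult_degree_bound:
  fixes p q :: "'a :: comm_ring_1 poly"
  assumes "degree p \<le> m" "degree q \<le> n"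
  shows "coeff (p * q) (m + n) = coeff p m * coeff q n"
proof (cases "degree p = m \<and> degree q = n")
  case True
  then show ?thesis using coeff_mult_degree_sum[of p q] by simp
next
  case False
  then have "coeff p m * coeff q n = 0" using assms by (auto simp: coeff_eq_0)
  moreover have "degree (p * q) < m + n" using False assms degree_mult_le[of p q] by linarith
  ultimately show ?thesis by (simp add: coeff_eq_0)
qed

lemma coeff_prod_degree_bound:
  fixes q :: "'i \<Rightarrow> 'a :: comm_ring_1 poly"
  assumes "finite A" "\<And>i. i \<in> A \<Longrightarrow> degree (q i) \<le> n i"
  shows "degree (\<Prod>i\<in>A. q i) \<le> (\<Sum>i\<in>A. n i)"
    and "coeff (\<Prod>i\<in>A. q i) (\<Sum>i\<in>A. n i) = (\<Prod>i\<in>A. coeff (q i) (n i))"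
proof -
  have "degree (\<Prod>i\<in>A. q i) \<le> (\<Sum>i\<in>A. n i) \<and>
        coeff (\<Prod>i\<in>A. q i) (\<Sum>i\<in>A. n i) = (\<Prod>i\<in>A. coeff (q i) (n i))"
    using assms
  proof (induction A rule: finite_induct)
    case (insert x A)
    then have IH: "degree (\<Prod>i\<in>A. q i) \<le> (\<Sum>i\<in>A. n i)"
      "coeff (\<Prod>i\<in>A. q i) (\<Sum>i\<in>A. n i) = (\<Prod>i\<in>A. coeff (q i) (n i))" by auto
    have qx: "degree (q x) \<le> n x" using insert.prems by simp
    show ?case
      using insert.hyps IH coeff_mult_degree_bound[OF qx IH(1)]
        order_trans[OF degree_mult_le add_mono[OF qx IH(1)]] by simp
  qed simp
  then show "degree (\<Prod>i\<in>A. q i) \<le> (\<Sum>i\<in>A. n i)"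
    "coeff (\<Prod>i\<in>A. q i) (\<Sum>i\<in>A. n i) = (\<Prod>i\<in>A. coeff (q i) (n i))" by auto
qed

text \<open>Every product in the Leibniz expansion takes exactly one entry from each column, so the
  sum of the column bounds is a degree bound common to all of them.\<close>

lemma coeff_det_column_degrees:
  fixes A :: "'a :: comm_ring_1 poly mat"
  assumes A: "A \<in> carrier_mat n n"
    and deg: "\<And>i j. i < n \<Longrightarrow> j < n \<Longrightarrow> degree (A $$ (i, j)) \<le> d j"
  shows "degree (det A) \<le> (\<Sum>j<n. d j)"
    and "coeff (det A) (\<Sum>j<n. d j) = det (mat n n (\<lambda>(i, j). coeff (A $$ (i, j)) (d j)))"
proof -
  have reindex: "(\<Sum>i = 0..<n. d (p i)) = (\<Sum>j<n. d j)" if "p permutes {0..<n}" for p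
    using sum.permute[OF that, of d] by (simp add: comp_def atLeast0LessThan)
  have bound: "degree (\<Prod>i = 0..<n. A $$ (i, p i)) \<le> (\<Sum>j<n. d j)"
    and coeff: "coeff (\<Prod>i = 0..<n. A $$ (i, p i)) (\<Sum>j<n. d j) =
      (\<Prod>i = 0..<n. coeff (A $$ (i, p i)) (d (p i)))" if p: "p permutes {0..<n}" for p
  proof -
    have "degree (A $$ (i, p i)) \<le> d (p i)" if "i \<in> {0..<n}" for i
      using that permutes_in_image[OF p, of i] by (intro deg) auto
    from coeff_prod_degree_bound[of "{0..<n}" "\<lambda>i. A $$ (i, p i)" "\<lambda>i. d (p i)", OF _ this]
    show "degree (\<Prod>i = 0..<n. A $$ (i, p i)) \<le> (\<Sum>j<n. d j)"
      "coeff (\<Prod>i = 0..<n. A $$ (i, p i)) (\<Sum>j<n. d j) =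
        (\<Prod>i = 0..<n. coeff (A $$ (i, p i)) (d (p i)))"
      unfolding reindex[OF p] by auto
  qed
  have sign: "signof p = [:signof p:]" for p :: "nat \<Rightarrow> nat"
    by (simp add: sign_def one_pCons)
  show "degree (det A) \<le> (\<Sum>j<n. d j)"
    unfolding det_def'[OF A]
    by (intro degree_sum_le)
      (auto simp: sign intro!: finite_permutations order_trans[OF degree_smult_le bound])
  show "coeff (det A) (\<Sum>j<n. d j) = det (mat n n (\<lambda>(i, j). coeff (A $$ (i, j)) (d j)))"
    unfolding det_def'[OF A] det_def'[of "mat n n _", OF mat_carrier] coeff_sum
  proof (intro sum.cong refl)
    fix p assume "p \<in> {p. p permutes {0..<n}}"
    then have p: "p permutes {0..<n}" by simp
    have "(\<Prod>i = 0..<n. coeff (A $$ (i, p i)) (d (p i))) =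
      (\<Prod>i = 0..<n. mat n n (\<lambda>(i, j). coeff (A $$ (i, j)) (d j)) $$ (i, p i))"
      using permutes_in_image[OF p] by (intro prod.cong) auto
    then show "coeff (signof p * (\<Prod>i = 0..<n. A $$ (i, p i))) (\<Sum>j<n. d j) =
      signof p * (\<Prod>i = 0..<n. mat n n (\<lambda>(i, j). coeff (A $$ (i, j)) (d j)) $$ (i, p i))"
      by (simp add: sign coeff[OF p])
  qed
qed

text \<open>A kernel vector of the transpose holds the coefficients of a nonzero polynomial of
  degree below \<open>n\<close> that vanishes at the \<open>n\<close> distinct points
  \<open>x j\<close>.\<close>

lemma det_vandermonde_scaled_nonzero:
  fixes x w :: "nat \<Rightarrow> real"
  assumes inj: "inj_on x {..<n}" and w: "\<And>j. j < n \<Longrightarrow> w j \<noteq> 0"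
  shows "det (mat n n (\<lambda>(i, j). w j * x j ^ i)) \<noteq> 0"
proof
  let ?M = "mat n n (\<lambda>(i, j). w j * x j ^ i)"
  assume "det ?M = 0"
  then have "det (transpose_mat ?M) = 0" by (simp add: det_transpose[of _ n])
  then obtain v where v: "v \<in> carrier_vec n" "v \<noteq> 0\<^sub>v n" "transpose_mat ?M *\<^sub>v v = 0\<^sub>v n"
    using det_0_iff_vec_prod_zero_field[of "transpose_mat ?M" n] by auto
  define q where "q = (\<Sum>i<n. monom (v $ i) i)"
  have root: "poly q (x j) = 0" if "j < n" for j
  proof -
    have "0 = (transpose_mat ?M *\<^sub>v v) $ j" using v(3) that by simp
    also have "\<dots> = (\<Sum>i<n. w j * x j ^ i * v $ i)"
      using that v(1) by (simp add: scalar_prod_def atLeast0LessThan)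
    also have "\<dots> = w j * poly q (x j)"
      by (simp add: q_def poly_sum poly_monom sum_distrib_left mult_ac)
    finally show ?thesis using w[OF that] by simp
  qed
  have coeff: "coeff q i = v $ i" if "i < n" for i
    using that by (simp add: q_def coeff_sum)
  have "q \<noteq> 0" using v(1,2) coeff by (metis coeff_0 eq_vecI carrier_vecD index_zero_vec)
  have "n \<noteq> 0" using v(1,2) by auto
  have "degree q \<le> n - 1"
    unfolding q_def by (intro degree_sum_le) (auto intro: order_trans[OF degree_monom_le])
  moreover have "n \<le> card {z. poly q z = 0}"
    using card_mono[OF poly_roots_finite[OF \<open>q \<noteq> 0\<close>], of "x ` {..<n}"] root
    by (auto simp: card_image[OF inj])
  moreover have "card {z. poly q z = 0} \<le> degree q"
    by (rule card_poly_roots_bound[OF \<open>q \<noteq> 0\<close>])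
  ultimately show False using \<open>n \<noteq> 0\<close> by linarith
qed

text \<open>For a point of \<open>E\<close> the \<open>n\<close> translates by \<open>(h, \<beta>)\<close> say that the nonzero vector of the
  \<open>y ^ j\<close> is in the kernel of a matrix whose determinant is a polynomial in \<open>t\<close>; its leading
  coefficient is, up to a nonzero factor, a Vandermonde determinant in the powers of \<open>\<beta>\<close>.\<close>

lemma zero_estimate:
  fixes P :: "nat \<Rightarrow> real poly" and E :: "(real \<times> real) set"
  assumes \<beta>: "\<beta> > 1"
    and fin: "finite E" and inj: "inj_on fst E" and y: "\<And>t y. (t, y) \<in> E \<Longrightarrow> y \<noteq> 0"
    and deg: "\<And>j. j < J \<Longrightarrow> degree (P j) \<le> D" and card: "D * J < card E"
    and zero: "\<And>t y \<mu>. (t, y) \<in> E \<Longrightarrow> \<mu> < J \<Longrightarrow>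
      (\<Sum>j<J. poly (P j) (t + real \<mu> * h) * (\<beta> ^ \<mu> * y) ^ j) = 0"
    and j: "j < J"
  shows "P j = 0"
proof (rule ccontr)
  assume "P j \<noteq> 0"
  \<comment> \<open>Zero polynomials are dropped, because the top coefficient of the determinant has
    to be a Vandermonde determinant whose columns are scaled by nonzero leading
    coefficients.\<close>
  define S where "S = {j. j < J \<and> P j \<noteq> 0}"
  define n where "n = card S"
  have finS: "finite S" and "j \<in> S" and SJ: "S \<subseteq> {..<J}"
    using \<open>P j \<noteq> 0\<close> j by (auto simp: S_def)
  then have "n > 0" "n \<le> J"
    using card_gt_0_iff card_mono[OF _ SJ] by (auto simp: n_def)
  obtain e where e: "bij_betw e {..<n} S"
    using ex_bij_betw_nat_finite[OF finS] by (auto simp: n_def atLeast0LessThan)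
  have eS: "e i < J" "P (e i) \<noteq> 0" if "i < n" for i
    using bij_betwE[OF e] that by (auto simp: S_def)
  define A where
    "A = mat n n (\<lambda>(\<mu>, i). smult (\<beta> ^ (\<mu> * e i)) (pcompose (P (e i)) [:real \<mu> * h, 1:]))"
  define d where "d i = degree (P (e i))" for i
  have A: "A \<in> carrier_mat n n" by (simp add: A_def)
  have comp: "degree (pcompose (P (e i)) [:c, 1:]) = d i"
    "coeff (pcompose (P (e i)) [:c, 1:]) (d i) = lead_coeff (P (e i))" for i c
    using lead_coeff_comp[of "[:c, 1:]" "P (e i)"] by (auto simp: d_def degree_pcompose)
  have "degree (A $$ (\<mu>, i)) \<le> d i" if "\<mu> < n" "i < n" for \<mu> i
    using that by (simp add: A_def comp order_trans[OF degree_smult_le])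
  note det = coeff_det_column_degrees[OF A, of d, OF this]
  have "mat n n (\<lambda>(\<mu>, i). coeff (A $$ (\<mu>, i)) (d i)) =
      mat n n (\<lambda>(\<mu>, i). lead_coeff (P (e i)) * (\<beta> ^ e i) ^ \<mu>)"
    by (auto simp: A_def comp power_mult[symmetric] mult.commute)
  moreover have "inj_on (\<lambda>i. \<beta> ^ e i) {..<n}"
    using bij_betw_imp_inj_on[OF e] \<beta> by (auto simp: inj_on_def)
  ultimately have "coeff (det A) (\<Sum>i<n. d i) \<noteq> 0"
    using det_vandermonde_scaled_nonzero[of "\<lambda>i. \<beta> ^ e i" n "\<lambda>i. lead_coeff (P (e i))"] eS(2)
    by (simp add: det(2))
  then have "det A \<noteq> 0" by auto
  have "poly (det A) t = 0" if ty: "(t, y) \<in> E" for t y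
  proof -
    interpret comm_ring_hom "\<lambda>q. poly q t" by unfold_locales auto
    define v where "v = vec n (\<lambda>i. y ^ e i)"
    have "map_mat (\<lambda>q. poly q t) A *\<^sub>v v = 0\<^sub>v n"
    proof (rule eq_vecI)
      fix \<mu> assume "\<mu> < dim_vec (0\<^sub>v n)"
      then have \<mu>: "\<mu> < n" by simp
      have "(map_mat (\<lambda>q. poly q t) A *\<^sub>v v) $ \<mu> =
          (\<Sum>i<n. poly (P (e i)) (t + real \<mu> * h) * (\<beta> ^ \<mu> * y) ^ e i)"
        using \<mu> A by (auto simp: v_def A_def scalar_prod_def atLeast0LessThan poly_pcompose
            power_mult_distrib power_mult add_ac intro!: sum.cong)
      also have "\<dots> = (\<Sum>j\<in>S. poly (P j) (t + real \<mu> * h) * (\<beta> ^ \<mu> * y) ^ j)"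
        by (rule sum.reindex_bij_betw[OF e])
      also have "\<dots> = (\<Sum>j<J. poly (P j) (t + real \<mu> * h) * (\<beta> ^ \<mu> * y) ^ j)"
        using SJ by (intro sum.mono_neutral_left) (auto simp: S_def)
      also have "\<dots> = 0" using zero[OF ty] \<mu> \<open>n \<le> J\<close> by simp
      finally show "(map_mat (\<lambda>q. poly q t) A *\<^sub>v v) $ \<mu> = 0\<^sub>v n $ \<mu>" using \<mu> by simp
    qed (simp add: A_def)
    moreover have "v $ 0 \<noteq> 0" using y[OF ty] \<open>n > 0\<close> by (simp add: v_def)
    then have "v \<noteq> 0\<^sub>v n" using \<open>n > 0\<close> by auto
    moreover have "v \<in> carrier_vec n" by (simp add: v_def)
    ultimately have "det (map_mat (\<lambda>q. poly q t) A) = 0"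
      using det_0_iff_vec_prod_zero_field[of "map_mat (\<lambda>q. poly q t) A" n] A by auto
    then show ?thesis by simp
  qed
  then have "fst ` E \<subseteq> {t. poly (det A) t = 0}" by auto
  then have "card E \<le> card {t. poly (det A) t = 0}"
    using card_mono[OF poly_roots_finite[OF \<open>det A \<noteq> 0\<close>], of "fst ` E"]
    by (simp add: card_image[OF inj])
  also have "\<dots> \<le> degree (det A)" by (rule card_poly_roots_bound[OF \<open>det A \<noteq> 0\<close>])
  also have "\<dots> \<le> (\<Sum>i<n. d i)" by (rule det(1))
  also have "\<dots> \<le> (\<Sum>i<n. D)" using deg eS(1) by (intro sum_mono) (auto simp: d_def)
  also have "\<dots> \<le> D * J" using \<open>n \<le> J\<close> by simp
  finally show False using card by simp
qed


section \<open>Small exponential polynomials\<close>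

text \<open>For an index n of at least \<open>M\<close>, z^n is at most exp(-M) (e z)^n; summation
  gives the exponential of e z.\<close>

lemma exp_Taylor_tail:
  fixes z :: real
  assumes "z \<ge> 0"
  shows "\<bar>exp z - (\<Sum>n<M. z ^ n / fact n)\<bar> \<le> exp (- real M) * exp (exp 1 * z)"
proof -
  have sums: "(\<lambda>n. x ^ n / fact n) sums exp x" for x :: real
    using exp_converges[of x] by (simp add: scaleR_conv_of_real divide_inverse mult.commute)
  have tail: "(\<lambda>n. x ^ (n + M) / fact (n + M)) sums (exp x - (\<Sum>n<M. x ^ n / fact n))" for x :: real
    by (rule sums_split_initial_segment[OF sums])
  have "z ^ (n + M) / fact (n + M) \<le> exp (- real M) * ((exp 1 * z) ^ (n + M) / fact (n + M))" for n
  proof -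
    have "1 \<le> exp (- real M) * exp 1 ^ (n + M)"
      by (simp add: exp_of_nat_mult[symmetric] exp_add[symmetric])
    then have "1 * z ^ (n + M) \<le> (exp (- real M) * exp 1 ^ (n + M)) * z ^ (n + M)"
      using assms by (intro mult_right_mono) auto
    then show ?thesis by (simp add: power_mult_distrib divide_simps mult_ac)
  qed
  then have "exp z - (\<Sum>n<M. z ^ n / fact n) \<le>
      exp (- real M) * (exp (exp 1 * z) - (\<Sum>n<M. (exp 1 * z) ^ n / fact n))"
    by (rule sums_le[OF _ tail sums_mult[OF tail]])
  also have "\<dots> \<le> exp (- real M) * exp (exp 1 * z)"
    using assms by (intro mult_left_mono) (auto intro!: sum_nonneg)
  moreover have "0 \<le> exp z - (\<Sum>n<M. z ^ n / fact n)"
    using assms by (intro sums_le[OF _ sums_zero tail]) auto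
  ultimately show ?thesis by linarith
qed

lemma power_over_fact_le_exp:
  fixes z :: real
  assumes "z \<ge> 0"
  shows "z ^ n / fact n \<le> exp z"
proof -
  have "z ^ n / fact n \<le> (\<Sum>k<Suc n. z ^ k / fact k)"
    using assms by (simp add: sum_nonneg)
  also have "\<dots> \<le> exp z"
  proof -
    have "(\<lambda>k. z ^ k / fact k) sums exp z"
      using exp_converges[of z] by (simp add: scaleR_conv_of_real divide_inverse mult.commute)
    from sum_le_suminf[OF sums_summable[OF this], of "{..<Suc n}"] sums_unique[OF this] assms
    show ?thesis by simp
  qed
  finally show ?thesis .
qed

text \<open>There are (H + 1)^(2T) vectors with entries in {0..H}, because the unknowns are twice as
  many as the forms. Cutting the range of every form into pieces of length
  \<open>card U * M / H\<close> gives only (H^2 + 1)^T boxes. Two vectors in one box have the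
  required difference.\<close>

lemma Siegel_pigeonhole:
  fixes m :: "nat \<Rightarrow> 'u \<Rightarrow> real" and H T :: nat
  assumes fin: "finite U" and card: "card U = 2 * T" and "T > 0" "H > 0" "M > 0"
    and m: "\<And>q u. q < T \<Longrightarrow> u \<in> U \<Longrightarrow> 0 \<le> m q u \<and> m q u \<le> M"
  obtains p :: "'u \<Rightarrow> int" where "\<exists>u\<in>U. p u \<noteq> 0" "\<And>u. \<bar>p u\<bar> \<le> int H"
    "\<And>q. q < T \<Longrightarrow> \<bar>\<Sum>u\<in>U. real_of_int (p u) * m q u\<bar> \<le> real (card U) * M / real H"
proof -
  define F where "F = U \<rightarrow>\<^sub>E {0..H}"
  define val where "val x q = (\<Sum>u\<in>U. real (x u) * m q u)" for x q
  define N where "N = real (card U)"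
  have "N > 0" using card \<open>T > 0\<close> by (simp add: N_def)
  define box where "box x = (\<lambda>q\<in>{..<T}. nat \<lfloor>val x q * H / (N * M)\<rfloor>)" for x
  have val: "0 \<le> val x q" "val x q \<le> N * (H * M)" if "x \<in> F" "q < T" for x q
  proof -
    show "0 \<le> val x q" unfolding val_def using that m by (intro sum_nonneg mult_nonneg_nonneg) auto
    have "val x q \<le> (\<Sum>u\<in>U. H * M)"
      unfolding val_def using that m \<open>M > 0\<close> by (intro sum_mono mult_mono) (auto simp: F_def)
    then show "val x q \<le> N * (H * M)" by (simp add: N_def)
  qed
  have floor_le: "\<lfloor>val x q * H / (N * M)\<rfloor> \<le> (int H)\<^sup>2" if x: "x \<in> F" "q < T" for x q
  proof -
    have "val x q * H / (N * M) \<le> N * (H * M) * H / (N * M)"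
      using val(2)[OF x] \<open>N > 0\<close> \<open>M > 0\<close> by (intro divide_right_mono mult_right_mono) auto
    also have "\<dots> = real (H ^ 2)" using \<open>N > 0\<close> \<open>M > 0\<close> by (simp add: power2_eq_square)
    finally have "\<lfloor>val x q * H / (N * M)\<rfloor> \<le> int (H ^ 2)"
      by (metis floor_mono floor_of_nat)
    then show "\<lfloor>val x q * H / (N * M)\<rfloor> \<le> (int H)\<^sup>2" by simp
  qed
  have "box ` F \<subseteq> {..<T} \<rightarrow>\<^sub>E {0..H ^ 2}"
  proof (intro image_subsetI PiE_I)
    fix x q assume x: "x \<in> F" "q \<in> {..<T}"
    then have "nat \<lfloor>val x q * H / (N * M)\<rfloor> \<le> nat ((int H)\<^sup>2)" using floor_le by (intro nat_mono) auto
    then show "box x q \<in> {0..H ^ 2}" using x by (simp add: box_def nat_power_eq)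
  qed (auto simp: box_def)
  then have "card (box ` F) \<le> card ({..<T} \<rightarrow>\<^sub>E {0..H ^ 2})"
    by (intro card_mono) (auto intro!: finite_PiE)
  also have "\<dots> = (H ^ 2 + 1) ^ T" by (simp add: card_PiE)
  also have "\<dots> < ((H + 1) ^ 2) ^ T"
    using \<open>T > 0\<close> \<open>H > 0\<close> by (intro power_strict_mono) (auto simp: power2_eq_square)
  also have "\<dots> = card F"
    using fin by (simp add: F_def card_PiE card power_mult[symmetric])
  finally obtain x y where xy: "x \<in> F" "y \<in> F" "x \<noteq> y" "box x = box y"
    using pigeonhole[of box F] by (auto simp: inj_on_def)
  \<comment> \<open>The value 0 outside \<open>U\<close> makes the bound by \<open>H\<close> hold
    for every \<open>u\<close>.\<close>
  define p where "p u = (if u \<in> U then int (x u) - int (y u) else 0)" for u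
  show thesis
  proof
    obtain u where "u \<in> U" "x u \<noteq> y u"
      using xy PiE_ext[of x U "\<lambda>_. {0..H}" y] by (auto simp: F_def)
    then show "\<exists>u\<in>U. p u \<noteq> 0" by (auto simp: p_def intro!: bexI[of _ u])
    show "\<bar>p u\<bar> \<le> int H" for u
      using xy(1,2) PiE_mem[of x U "\<lambda>_. {0..H}" u] PiE_mem[of y U "\<lambda>_. {0..H}" u]
      by (auto simp: p_def F_def)
    fix q assume q: "q < T"
    have "nat \<lfloor>val x q * H / (N * M)\<rfloor> = nat \<lfloor>val y q * H / (N * M)\<rfloor>"
      using fun_cong[OF xy(4), of q] q by (simp add: box_def)
    moreover have "0 \<le> val x q * H / (N * M)" "0 \<le> val y q * H / (N * M)"
      using val(1)[OF xy(1) q] val(1)[OF xy(2) q] \<open>N > 0\<close> \<open>M > 0\<close> by auto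
    ultimately have "\<lfloor>val x q * H / (N * M)\<rfloor> = \<lfloor>val y q * H / (N * M)\<rfloor>"
      by (simp add: nat_eq_iff split: if_splits)
    then have "\<bar>val x q * H / (N * M) - val y q * H / (N * M)\<bar> < 1" by linarith
    moreover have "val x q * H / (N * M) - val y q * H / (N * M) = (val x q - val y q) * (H / (N * M))"
      by (simp add: left_diff_distrib diff_divide_distrib)
    moreover have pos: "real H / (N * M) > 0" using \<open>N > 0\<close> \<open>M > 0\<close> \<open>H > 0\<close> by simp
    ultimately have "\<bar>val x q - val y q\<bar> * (H / (N * M)) < 1"
      using \<open>N > 0\<close> \<open>M > 0\<close> by (simp add: abs_mult)
    then have "\<bar>val x q - val y q\<bar> \<le> N * M / H"
      using \<open>N > 0\<close> \<open>M > 0\<close> \<open>H > 0\<close> by (simp add: field_simps)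
    moreover have "(\<Sum>u\<in>U. real_of_int (p u) * m q u) = val x q - val y q"
      by (simp add: p_def val_def sum_subtractf left_diff_distrib)
    ultimately show "\<bar>\<Sum>u\<in>U. real_of_int (p u) * m q u\<bar> \<le> real (card U) * M / real H"
      by (simp add: N_def)
  qed
qed

text \<open>The first summand of the estimate comes from the Taylor coefficients of order below
  \<open>T\<close>, made small by the pigeonhole principle, the second from the Taylor
  tails.\<close>

lemma small_exponential_polynomial:
  fixes \<gamma> \<tau> :: real and I J T H :: nat
  assumes \<gamma>: "\<gamma> \<ge> 0" and \<tau>: "\<tau> \<ge> 1" and IJ: "I * J = 2 * T" and T: "T > 0" "I \<le> T" and H: "H > 0"
  obtains p :: "nat \<Rightarrow> nat \<Rightarrow> int" where "\<exists>i<I. \<exists>j<J. p i j \<noteq> 0" "\<And>i j. \<bar>p i j\<bar> \<le> int H"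
    "\<And>t. 0 \<le> t \<Longrightarrow> t \<le> \<tau> \<Longrightarrow>
      \<bar>\<Sum>i<I. \<Sum>j<J. real_of_int (p i j) * (t ^ i * exp (\<gamma> * real j * t))\<bar> \<le>
      real T * (real (I * J) * (\<tau> ^ I * exp (real J * \<gamma> * \<tau>)) / real H) +
      real (I * J) * (real H * (\<tau> ^ I * exp (real I - real T) * exp (exp 1 * (real J * \<gamma> * \<tau>))))"
proof -
  define U where "U = {..<I} \<times> {..<J}"
  \<comment> \<open>This is the Taylor coefficient of order q of t^i exp(\<gamma> j t) at 0,
    multiplied by \<tau>^q. On [0, \<tau>] it then enters with the factor (t / \<tau>)^q, which is
    at most 1.\<close>
  define m where "m q u = (case u of (i, j) \<Rightarrow>
    if i \<le> q then \<tau> ^ i * ((\<gamma> * real j * \<tau>) ^ (q - i) / fact (q - i)) else 0)" for q :: nat and u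
  define M where "M = \<tau> ^ I * exp (real J * \<gamma> * \<tau>)"
  have "M > 0" using \<tau> by (simp add: M_def)
  have z: "0 \<le> \<gamma> * real j * t" "\<gamma> * real j * t \<le> real J * \<gamma> * \<tau>"
    if "j < J" "0 \<le> t" "t \<le> \<tau>" for j t
  proof -
    show "0 \<le> \<gamma> * real j * t" using \<gamma> that by simp
    have "\<gamma> * real j * t \<le> \<gamma> * real J * \<tau>"
      using that \<gamma> by (intro mult_mono mult_left_mono) auto
    then show "\<gamma> * real j * t \<le> real J * \<gamma> * \<tau>" by (simp add: mult_ac)
  qed
  have m: "0 \<le> m q u \<and> m q u \<le> M" if "q < T" "u \<in> U" for q u
  proof -
    obtain i j where u: "u = (i, j)" "i < I" "j < J" using \<open>u \<in> U\<close> by (auto simp: U_def)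
    note zz = z[of j \<tau>, OF u(3)]
    have "\<tau> ^ i * ((\<gamma> * real j * \<tau>) ^ (q - i) / fact (q - i)) \<le> M"
      unfolding M_def using \<tau> u zz power_over_fact_le_exp[of "\<gamma> * real j * \<tau>" "q - i"]
      by (intro mult_mono power_increasing) (auto intro: order_trans)
    then show ?thesis using \<tau> \<gamma> u(1) \<open>M > 0\<close> by (simp add: m_def)
  qed
  have cardU: "card U = I * J" by (simp add: U_def)
  obtain p where p: "\<exists>u\<in>U. p u \<noteq> 0" "\<And>u. \<bar>p u\<bar> \<le> int H"
    "\<And>q. q < T \<Longrightarrow> \<bar>\<Sum>u\<in>U. real_of_int (p u) * m q u\<bar> \<le> real (card U) * M / real H"
    using Siegel_pigeonhole[of U T H M m] m \<open>M > 0\<close> H T IJ cardU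
    by (auto simp: U_def)
  show thesis
  proof
    show "\<exists>i<I. \<exists>j<J. curry p i j \<noteq> 0" using p(1) by (auto simp: U_def)
    show "\<bar>curry p i j\<bar> \<le> int H" for i j using p(2) by simp
    fix t assume t: "0 \<le> t" "t \<le> \<tau>"
    define f where "f u = (case u of (i, j) \<Rightarrow> t ^ i * exp (\<gamma> * real j * t))" for u :: "nat \<times> nat"
    define g where "g u = (\<Sum>q<T. (t / \<tau>) ^ q * m q u)" for u
    define \<epsilon> where "\<epsilon> = \<tau> ^ I * exp (real I - real T) * exp (exp 1 * (real J * \<gamma> * \<tau>))"
    have diff: "\<bar>f u - g u\<bar> \<le> \<epsilon>" if "u \<in> U" for u
    proof -
      obtain i j where u: "u = (i, j)" "i < I" "j < J" using \<open>u \<in> U\<close> by (auto simp: U_def)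
      define z where "z = \<gamma> * real j * t"
      have "g u = (\<Sum>q\<in>{i..<T}. (t / \<tau>) ^ q * (\<tau> ^ i * ((\<gamma> * real j * \<tau>) ^ (q - i) / fact (q - i))))"
        unfolding g_def u(1) m_def by (rule sum.mono_neutral_cong_right) auto
      also have "\<dots> = (\<Sum>n<T - i. (t / \<tau>) ^ (n + i) * (\<tau> ^ i * ((\<gamma> * real j * \<tau>) ^ n / fact n)))"
        using u(2) T by (intro sum.reindex_bij_witness[of _ "\<lambda>n. n + i" "\<lambda>q. q - i"]) auto
      also have "\<dots> = (\<Sum>n<T - i. t ^ i * (z ^ n / fact n))"
        using \<tau> by (intro sum.cong) (auto simp: power_add power_divide power_mult_distrib z_def field_simps)
      finally have g: "g u = t ^ i * (\<Sum>n<T - i. z ^ n / fact n)" by (simp add: sum_distrib_left)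
      have "\<bar>f u - g u\<bar> = t ^ i * \<bar>exp z - (\<Sum>n<T - i. z ^ n / fact n)\<bar>"
        using t by (simp add: g[unfolded u(1)] f_def u(1) z_def right_diff_distrib[symmetric] abs_mult)
      also have "\<dots> \<le> \<tau> ^ I * (exp (- real (T - i)) * exp (exp 1 * z))"
      proof (rule mult_mono)
        have "t ^ i \<le> \<tau> ^ i" using t by (intro power_mono)
        also have "\<dots> \<le> \<tau> ^ I" using \<tau> u by (intro power_increasing) auto
        finally show "t ^ i \<le> \<tau> ^ I" .
      qed (use \<tau> t \<gamma> exp_Taylor_tail[of z "T - i"] in \<open>auto simp: z_def\<close>)
      also have "\<dots> \<le> \<tau> ^ I * (exp (real I - real T) * exp (exp 1 * (real J * \<gamma> * \<tau>)))"
        using z[OF u(3) t] u T \<tau> by (intro mult_left_mono mult_mono) (auto simp: z_def of_nat_diff)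
      finally show ?thesis by (simp add: \<epsilon>_def mult_ac)
    qed
    have "(\<Sum>i<I. \<Sum>j<J. real_of_int (curry p i j) * (t ^ i * exp (\<gamma> * real j * t))) =
        (\<Sum>u\<in>U. real_of_int (p u) * f u)"
      by (simp add: U_def sum.cartesian_product f_def case_prod_beta)
    also have "\<dots> = (\<Sum>u\<in>U. real_of_int (p u) * g u) + (\<Sum>u\<in>U. real_of_int (p u) * (f u - g u))"
      by (simp add: sum.distrib[symmetric] algebra_simps)
    also have "(\<Sum>u\<in>U. real_of_int (p u) * g u) = (\<Sum>q<T. (t / \<tau>) ^ q * (\<Sum>u\<in>U. real_of_int (p u) * m q u))"
      unfolding g_def sum_distrib_left by (subst sum.swap) (simp add: mult_ac)
    finally have eq: "(\<Sum>i<I. \<Sum>j<J. real_of_int (curry p i j) * (t ^ i * exp (\<gamma> * real j * t))) =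
      (\<Sum>q<T. (t / \<tau>) ^ q * (\<Sum>u\<in>U. real_of_int (p u) * m q u)) +
      (\<Sum>u\<in>U. real_of_int (p u) * (f u - g u))" .
    have "\<bar>\<Sum>q<T. (t / \<tau>) ^ q * (\<Sum>u\<in>U. real_of_int (p u) * m q u)\<bar> \<le>
        (\<Sum>q<T. \<bar>(t / \<tau>) ^ q * (\<Sum>u\<in>U. real_of_int (p u) * m q u)\<bar>)"
      by (rule sum_abs)
    also have "\<dots> \<le> (\<Sum>q<T. 1 * (real (card U) * M / real H))"
      unfolding abs_mult using t \<tau> p(3)
      by (intro sum_mono mult_mono) (auto simp: power_abs power_le_one)
    finally have 1: "\<bar>\<Sum>q<T. (t / \<tau>) ^ q * (\<Sum>u\<in>U. real_of_int (p u) * m q u)\<bar> \<le>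
        real T * (real (I * J) * M / real H)" by (simp add: cardU)
    have pH: "\<bar>real_of_int (p u)\<bar> \<le> real H" for u
      using p(2)[of u] by (metis of_int_abs of_int_le_iff of_int_of_nat_eq)
    have "\<bar>\<Sum>u\<in>U. real_of_int (p u) * (f u - g u)\<bar> \<le> (\<Sum>u\<in>U. \<bar>real_of_int (p u) * (f u - g u)\<bar>)"
      by (rule sum_abs)
    also have "\<dots> \<le> (\<Sum>u\<in>U. real H * \<epsilon>)"
      unfolding abs_mult using diff pH by (intro sum_mono mult_mono) auto
    finally have 2: "\<bar>\<Sum>u\<in>U. real_of_int (p u) * (f u - g u)\<bar> \<le> real (I * J) * (real H * \<epsilon>)"
      by (simp add: cardU)
    show "\<bar>\<Sum>i<I. \<Sum>j<J. real_of_int (curry p i j) * (t ^ i * exp (\<gamma> * real j * t))\<bar> \<le>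
      real T * (real (I * J) * (\<tau> ^ I * exp (real J * \<gamma> * \<tau>)) / real H) +
      real (I * J) * (real H * (\<tau> ^ I * exp (real I - real T) * exp (exp 1 * (real J * \<gamma> * \<tau>))))"
      unfolding eq using 1 2 unfolding M_def \<epsilon>_def by linarith
  qed
qed


section \<open>Linear forms in two logarithms\<close>

text \<open>Distinct integers are at least 1 apart. This Liouville bound disposes of linear forms
  with small coefficients.\<close>

lemma ln_nat_diff_lower_bound:
  fixes x y :: nat
  assumes "x \<noteq> y" "x > 0" "y > 0" "x \<le> B" "y \<le> B"
  shows "1 / real B \<le> \<bar>ln (real x) - ln (real y)\<bar>"
proof -
  have *: "1 / real B \<le> ln (real y) - ln (real x)" if "x < y" "0 < x" "y \<le> B" for x y :: nat
  proof -
    have "ln (real x / real y) \<le> real x / real y - 1"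
      using that by (intro ln_le_minus_one) auto
    also have "real x / real y - 1 \<le> - (1 / real y)"
    proof -
      have "real x + 1 \<le> real y" using that by linarith
      then show ?thesis using that by (simp add: divide_simps)
    qed
    also have "\<dots> \<le> - (1 / real B)" using that by (simp add: frac_le)
    finally show ?thesis using that by (simp add: ln_div)
  qed
  show ?thesis
    using *[of x y] *[of y x] assms by (cases "x < y") (auto simp: abs_if)
qed

text \<open>If R is at most l, equality of two values makes l divide r - r', whose absolute value is
  below l; if R is at most k, the same argument applies to s.\<close>

lemma inj_on_linear_combination:
  fixes k l R :: nat
  assumes "coprime k l" "k > 0" "l > 0" "R \<le> k \<or> R \<le> l"
  shows "inj_on (\<lambda>(r, s). r * k + s * l) ({..<R} \<times> {..<R})"
proof -
  have *: "r = r'" if "coprime k l" "R \<le> l" "r < R" "r' < R"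
    "int r * k + int s * l = int r' * k + int s' * l" for k l r r' s s' :: nat
  proof -
    have "(int r - int r') * int k = (int s' - int s) * int l"
      using that(5) by (simp add: left_diff_distrib)
    then have "int l dvd (int r - int r') * int k" by simp
    moreover have "coprime (int l) (int k)" using that(1) by (simp add: coprime_commute)
    ultimately have "int l dvd int r - int r'" by (simp add: coprime_dvd_mult_left_iff)
    moreover have "\<bar>int r - int r'\<bar> < int l" using that(2,3,4) by linarith
    ultimately show ?thesis using zdvd_not_zless[of "\<bar>int r - int r'\<bar>" "int l"] by auto
  qed
  show ?thesis
  proof (rule inj_onI)
    fix x y :: "nat \<times> nat"
    assume "x \<in> {..<R} \<times> {..<R}" "y \<in> {..<R} \<times> {..<R}"
      and "(\<lambda>(r, s). r * k + s * l) x = (\<lambda>(r, s). r * k + s * l) y"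
    then obtain r s r' s' where xy: "x = (r, s)" "y = (r', s')"
      and lt: "r < R" "r' < R" "s < R" "s' < R" and eq: "r * k + s * l = r' * k + s' * l"
      by auto
    have eq': "int r * k + int s * l = int r' * k + int s' * l"
      using arg_cong[OF eq, of int] by simp
    have "r = r' \<and> s = s'"
    proof (cases "R \<le> l")
      case True
      then have "r = r'" using *[OF assms(1) True lt(1,2) eq'] by simp
      then show ?thesis using eq assms by auto
    next
      case False
      then have "s = s'"
        using *[of l k s s' r r'] assms(1,4) lt eq' by (simp add: coprime_commute add.commute)
      then show ?thesis using eq assms by auto
    qed
    then show "x = y" by (simp add: xy)
  qed
qed

lemma exp_perturbation:
  fixes z w :: real
  assumes "\<bar>w\<bar> \<le> 1"
  shows "\<bar>exp (z + w) - exp z\<bar> \<le> exp z * (2 * \<bar>w\<bar>)"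
proof -
  have "\<bar>exp w - 1\<bar> \<le> 2 * \<bar>w\<bar>"
  proof (cases "w \<ge> 0")
    case True
    then have "exp w \<le> 1 + w + w\<^sup>2" using assms by (intro exp_bound) auto
    moreover have "w\<^sup>2 \<le> w" using True assms by (simp add: power2_eq_square mult_left_le)
    ultimately show ?thesis using True by simp
  next
    case False
    then have "exp w \<le> 1" by simp
    then show ?thesis using False exp_ge_add_one_self[of w] by linarith
  qed
  then have "exp z * \<bar>exp w - 1\<bar> \<le> exp z * (2 * \<bar>w\<bar>)" by (intro mult_left_mono) auto
  moreover have "exp (z + w) - exp z = exp z * (exp w - 1)" by (simp add: exp_add algebra_simps)
  ultimately show ?thesis by (simp add: abs_mult)
qed

text \<open>If the linear form were smaller, the exponential polynomial of the pigeonhole principle would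
  be so close to an integer polynomial in \<open>t = r k + s l\<close> and \<open>\<beta> ^ r \<alpha> ^ s\<close> that the latter vanishes
  at more points than the zero estimate allows. There are \<open>I J = R\<^sup>2\<close> coefficients, half as many Taylor
  coefficients to be made small, and \<open>R\<^sup>2\<close> points; the factor \<open>200\<close> makes the Taylor tail, of size
  \<open>exp (- R\<^sup>2 / 2)\<close>, dominate all other exponents.\<close>

lemma log_form_lower_bound_large:
  fixes A1 A2 B1 B2 W J k l A R :: nat
  assumes \<alpha>: "0 < A2" "A2 < A1" "A1 \<le> W" and \<beta>: "0 < B2" "B2 < B1" "B1 \<le> W"
    and A: "A = 200 * W" and R: "R = A * J" and J: "8 \<le> J"
    and size: "real (2 * (A + 1) * J * max k l) \<le> exp (real J / 16)"
    and cop: "coprime k l" and kl: "k > 0" "l > 0" and large: "R \<le> k \<or> R \<le> l"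
  shows "exp (- ((real R)\<^sup>2)) \<le> \<bar>k * ln (A1 / A2) - l * ln (B1 / B2)\<bar>"
proof (rule ccontr)
  define \<alpha> \<beta> where "\<alpha> = real A1 / real A2" and "\<beta> = real B1 / real B2"
  define \<Lambda> where "\<Lambda> = k * ln \<alpha> - l * ln \<beta>"
  define X where "X = (real R)\<^sup>2"
  \<comment> \<open>With this choice, \<gamma> t = r log \<beta> + s log \<alpha> - s \<Lambda> / k
    at t = r k + s l.\<close>
  define \<gamma> where "\<gamma> = ln \<beta> / k"
  \<comment> \<open>An upper bound for all r k + s l with r < R + J and s < R.\<close>
  define \<tau> where "\<tau> = real (2 * (A + 1) * J * max k l)"
  define T where "T = 20000 * W\<^sup>2 * J\<^sup>2"
  define I where "I = A * R"
  \<comment> \<open>In units of \<open>X\<close>, 1/9 slightly exceeds 1/16 + 1/50 + 1/50, the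
    exponents bounding \<open>\<tau> ^ I\<close>, the exponential and the common denominator, all of
    which the small Taylor coefficients have to beat. It is still small enough for the tail, of
    exponent near -1/2, to beat \<open>H\<close>.\<close>
  define H where "H = nat \<lceil>exp (X / 9)\<rceil>"
  assume "\<not> exp (- ((real R)\<^sup>2)) \<le> \<bar>k * ln (A1 / A2) - l * ln (B1 / B2)\<bar>"
  then have \<Lambda>: "\<bar>\<Lambda>\<bar> < exp (- X)" by (simp add: \<Lambda>_def \<alpha>_def \<beta>_def X_def)
  have W: "W \<ge> 2" using \<alpha> by linarith
  have IJ: "I * J = R * R" "I * J = 2 * T" "I * J = R\<^sup>2"
    by (simp_all add: I_def R T_def A power2_eq_square)
  have XIJ: "X = real (I * J)" "X = real I * real J" by (simp_all add: X_def IJ(3) flip: of_nat_mult)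
  have "3200 \<le> R" using W J mult_le_mono[of 400 A 8 J] by (simp add: A R)
  then have X: "X \<ge> 10240000" using power_mono[of 3200 "real R" 2] by (simp add: X_def)
  have "1 \<le> max k l" using kl by simp
  then have "1 \<le> (2 * (A + 1) * J) * max k l" using J by (simp add: Suc_le_eq)
  then have \<tau>1: "\<tau> \<ge> 1" unfolding \<tau>_def by linarith
  have \<alpha>1: "\<alpha> > 1" "\<alpha> \<le> W" and \<beta>1: "\<beta> > 1" "\<beta> \<le> W"
  proof -
    have "A1 * 1 \<le> W * A2" "B1 * 1 \<le> W * B2" using \<alpha> \<beta> by (intro mult_le_mono; simp)+
    then have "real A1 \<le> real W * real A2" "real B1 \<le> real W * real B2"
      by (metis mult_1_right of_nat_le_iff of_nat_mult)+
    then show "\<alpha> > 1" "\<alpha> \<le> W" "\<beta> > 1" "\<beta> \<le> W"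
      using \<alpha> \<beta> unfolding \<alpha>_def \<beta>_def by (auto simp: divide_simps)
  qed
  have ln\<alpha>: "0 < ln \<alpha>" "ln \<alpha> \<le> real W - 1" and ln\<beta>: "0 < ln \<beta>" "ln \<beta> \<le> real W - 1"
    using \<alpha>1 \<beta>1 ln_le_minus_one[of \<alpha>] ln_le_minus_one[of \<beta>] by auto
  have \<gamma>0: "\<gamma> \<ge> 0" using ln\<beta> kl by (simp add: \<gamma>_def)
  have "\<gamma> * real (max k l) \<le> W"
  proof (cases "l \<le> k")
    case True
    then show ?thesis using kl ln\<beta> by (simp add: \<gamma>_def max_def)
  next
    case False
    \<comment> \<open>The smallness of \<Lambda> is used already here: l log \<beta> is at most k
      log \<alpha> + 1.\<close>
    have "\<bar>\<Lambda>\<bar> < 1" using \<Lambda> X by (meson exp_le_one_iff less_le_trans neg_le_0_iff_le order_trans zero_le_numeral)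
    then have "l * ln \<beta> \<le> k * ln \<alpha> + 1" by (simp add: \<Lambda>_def abs_less_iff)
    also have "\<dots> \<le> k * ln \<alpha> + k" using kl by simp
    also have "\<dots> = k * (ln \<alpha> + 1)" by (simp add: algebra_simps)
    also have "\<dots> \<le> k * real W" using ln\<alpha> by (intro mult_left_mono) auto
    finally show ?thesis using False kl by (simp add: \<gamma>_def max_def divide_simps mult_ac)
  qed
  then have "2 * real (A + 1) * real J * (\<gamma> * real (max k l)) \<le> 2 * real (A + 1) * real J * W"
    by (intro mult_left_mono) auto
  then have \<gamma>\<tau>: "\<gamma> * \<tau> \<le> 2 * real (A + 1) * real J * W" by (simp add: \<tau>_def algebra_simps)
  have A1le: "real A + 1 \<le> 2 * real A" using W by (simp add: A)
  have X50: "X / 50 = 4 * real A * W * (real J)\<^sup>2"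
    by (simp add: X_def R A power2_eq_square)
  have E: "real J * \<gamma> * \<tau> \<le> X / 50"
  proof -
    have "real J * (\<gamma> * \<tau>) \<le> real J * (2 * real (A + 1) * real J * W)"
      using \<gamma>\<tau> by (intro mult_left_mono) auto
    also have "\<dots> = (2 * W * (real J)\<^sup>2) * (real A + 1)" by (simp add: power2_eq_square)
    also have "\<dots> \<le> (2 * W * (real J)\<^sup>2) * (2 * real A)" using A1le by (intro mult_left_mono) auto
    finally show ?thesis by (simp add: X50 mult_ac)
  qed
  \<comment> \<open>Here the assumed size of \<open>J\<close> enters: since I J = X, the power exp(J
    / 16)^I is exp(X / 16).\<close>
  have \<tau>I: "\<tau> ^ I \<le> exp (X / 16)"
  proof -
    have "\<tau> ^ I \<le> exp (real J / 16) ^ I" using size \<tau>1 by (intro power_mono) (auto simp: \<tau>_def)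
    also have "\<dots> = exp (X / 16)" by (simp add: exp_of_nat_mult[symmetric] XIJ(2))
    finally show ?thesis .
  qed
  \<comment> \<open>Absorbs the polynomial factors \<open>T\<close> and \<open>I * J\<close>, both
    at most \<open>X\<close>.\<close>
  have Xexp: "X \<le> exp (X / 1000)"
  proof -
    have "X * 1 \<le> X * (X / 2000000)" using X by (intro mult_left_mono) auto
    also have "\<dots> = (X / 1000)\<^sup>2 / 2" by (simp add: power2_eq_square)
    also have "\<dots> \<le> 1 + X / 1000 + (X / 1000)\<^sup>2 / 2" using X by simp
    also have "\<dots> \<le> exp (X / 1000)" using X by (intro exp_lower_Taylor_quadratic) auto
    finally show ?thesis by simp
  qed
  have H: "exp (X / 9) \<le> real H" "real H \<le> exp (X / 9 + X / 1000)" "H > 0"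
  proof -
    show 1: "exp (X / 9) \<le> real H" unfolding H_def by linarith
    then show "H > 0" using exp_gt_zero[of "X / 9"] by (metis less_le_trans of_nat_0_less_iff)
    have "real H \<le> exp (X / 9) + 1"
      unfolding H_def using exp_gt_zero[of "X / 9"] by linarith
    also have "\<dots> \<le> exp (X / 9) * 2" using X by simp
    also have "\<dots> \<le> exp (X / 9) * exp (X / 1000)" using X Xexp by (intro mult_left_mono) auto
    finally show "real H \<le> exp (X / 9 + X / 1000)" by (simp only: exp_add)
  qed
  have "T > 0" using W J by (simp add: T_def)
  have TX: "real T = X / 2" using IJ(2) XIJ(1) by simp
  have I8: "real I \<le> X / 8" using J by (simp add: XIJ(2) mult_left_mono)
  have "I \<le> T" using I8 TX X by linarith
  obtain p where p: "\<exists>i<I. \<exists>j<J. p i j \<noteq> 0" "\<And>i j. \<bar>p i j\<bar> \<le> int H"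
    "\<And>t. 0 \<le> t \<Longrightarrow> t \<le> \<tau> \<Longrightarrow>
      \<bar>\<Sum>i<I. \<Sum>j<J. real_of_int (p i j) * (t ^ i * exp (\<gamma> * real j * t))\<bar> \<le>
      real T * (real (I * J) * (\<tau> ^ I * exp (real J * \<gamma> * \<tau>)) / real H) +
      real (I * J) * (real H * (\<tau> ^ I * exp (real I - real T) * exp (exp 1 * (real J * \<gamma> * \<tau>))))"
    using small_exponential_polynomial[OF \<gamma>0 \<tau>1 IJ(2) \<open>T > 0\<close> \<open>I \<le> T\<close> \<open>H > 0\<close>] by blast
  have term1: "real T * (real (I * J) * (\<tau> ^ I * exp (real J * \<gamma> * \<tau>)) / real H) \<le>
      exp (X / 1000) * (exp (X / 1000) * (exp (X / 16) * exp (X / 50)) * exp (- X / 9))"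
  proof -
    have "1 / real H \<le> exp (- X / 9)"
      using H by (simp add: exp_minus inverse_eq_divide frac_le)
    then have "real T * (real (I * J) * (\<tau> ^ I * exp (real J * \<gamma> * \<tau>)) * (1 / real H)) \<le>
      exp (X / 1000) * (exp (X / 1000) * (exp (X / 16) * exp (X / 50)) * exp (- X / 9))"
      using Xexp X TX E \<tau>I \<tau>1 \<gamma>0 unfolding XIJ(1)[symmetric]
      by (intro mult_mono) (auto intro!: mult_nonneg_nonneg)
    then show ?thesis by simp
  qed
  have "exp 1 * (real J * \<gamma> * \<tau>) \<le> 3 * (X / 50)"
    using exp_le \<gamma>0 \<tau>1 by (intro mult_mono E) auto
  then have "exp (exp 1 * (real J * \<gamma> * \<tau>)) \<le> exp (3 * (X / 50))" by simp
  then have term2: "real (I * J) * (real H * (\<tau> ^ I * exp (real I - real T) * exp (exp 1 * (real J * \<gamma> * \<tau>)))) \<le>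
      exp (X / 1000) * (exp (X / 9 + X / 1000) * (exp (X / 16) * exp (X / 8 - X / 2) * exp (3 * (X / 50))))"
    using Xexp X TX \<tau>I \<tau>1 I8 H unfolding XIJ(1)[symmetric]
    by (intro mult_mono) (auto intro!: mult_nonneg_nonneg)
  \<comment> \<open>The range of r is longer by \<open>J\<close>, so that it contains the translates
    r + \<mu> with \<mu> < J of the zero estimate.\<close>
  have zero: "(\<Sum>i<I. \<Sum>j<J. real_of_int (p i j) * (real (r * k + s * l) ^ i * (\<beta> ^ r * \<alpha> ^ s) ^ j)) = 0"
    if rs: "r < R + J" "s < R" for r s
  proof -
    define t where "t = r * k + s * l"
    define y where "y = \<beta> ^ r * \<alpha> ^ s"
    define n1 n2 where "n1 = B1 ^ r * A1 ^ s" and "n2 = B2 ^ r * A2 ^ s"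
    define P where "P = (\<Sum>i<I. \<Sum>j<J. real_of_int (p i j) * (real t ^ i * y ^ j))"
    define F where "F = (\<Sum>i<I. \<Sum>j<J. real_of_int (p i j) * (real t ^ i * exp (\<gamma> * real j * real t)))"
    have "n2 > 0" using \<alpha> \<beta> by (simp add: n2_def)
    have t\<tau>: "real t \<le> \<tau>"
    proof -
      have "t \<le> (R + J) * max k l + R * max k l"
        unfolding t_def using rs by (intro add_mono mult_mono) auto
      also have "\<dots> \<le> 2 * (A + 1) * J * max k l" by (simp add: R algebra_simps)
      finally show ?thesis unfolding \<tau>_def by (rule of_nat_mono)
    qed
    have diff: "\<bar>y ^ j - exp (\<gamma> * real j * real t)\<bar> \<le> exp (X / 50) * (exp (X / 1000) * exp (- X))"
      if "j < J" for j
    proof -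
      define w where "w = real j * real s * (\<Lambda> / k)"
      have "y = exp (r * ln \<beta> + s * ln \<alpha>)"
        using \<alpha>1 \<beta>1 by (simp add: y_def exp_add exp_of_nat_mult)
      then have "y ^ j = exp (real j * (r * ln \<beta> + s * ln \<alpha>))" by (simp add: exp_of_nat_mult)
      also have "real j * (r * ln \<beta> + s * ln \<alpha>) = \<gamma> * real j * real t + w"
        using kl by (simp add: w_def \<gamma>_def \<Lambda>_def t_def field_simps)
      finally have y: "y ^ j = exp (\<gamma> * real j * real t + w)" .
      have "\<bar>\<Lambda>\<bar> / k \<le> \<bar>\<Lambda>\<bar>" using kl mult_left_mono[of 1 "real k" "\<bar>\<Lambda>\<bar>"] by (simp add: divide_simps)
      then have "\<bar>w\<bar> \<le> real J * real R * \<bar>\<Lambda>\<bar>"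
        using that rs unfolding w_def abs_mult abs_divide by (intro mult_mono) auto
      moreover have "2 * (J * R) \<le> R * R"
        using W by (simp add: R A)
      then have "2 * (real J * real R) \<le> X"
        unfolding X_def power2_eq_square by (metis of_nat_le_iff of_nat_mult of_nat_numeral)
      then have "2 * (real J * real R) * \<bar>\<Lambda>\<bar> \<le> exp (X / 1000) * exp (- X)"
        using Xexp \<Lambda> by (intro mult_mono) auto
      ultimately have w: "2 * \<bar>w\<bar> \<le> exp (X / 1000) * exp (- X)" by simp
      have "exp (X / 1000) * exp (- X) \<le> 1" using X by (simp add: exp_add[symmetric])
      then have "\<bar>w\<bar> \<le> 1" using w by linarith
      then have "\<bar>y ^ j - exp (\<gamma> * real j * real t)\<bar> \<le> exp (\<gamma> * real j * real t) * (2 * \<bar>w\<bar>)"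
        unfolding y by (rule exp_perturbation)
      also have "\<dots> \<le> exp (X / 50) * (exp (X / 1000) * exp (- X))"
      proof (rule mult_mono[OF _ w])
        have "\<gamma> * real j * real t \<le> \<gamma> * real J * \<tau>"
          using that t\<tau> \<gamma>0 by (intro mult_mono mult_left_mono) auto
        then show "exp (\<gamma> * real j * real t) \<le> exp (X / 50)" using E by (simp add: mult_ac)
      qed auto
      finally show ?thesis .
    qed
    have pH: "\<bar>real_of_int (p i j)\<bar> \<le> real H" for i j
      using p(2)[of i j] by (metis of_int_abs of_int_le_iff of_int_of_nat_eq)
    have "\<bar>P - F\<bar> = \<bar>\<Sum>i<I. \<Sum>j<J. real_of_int (p i j) * (real t ^ i * (y ^ j - exp (\<gamma> * real j * real t)))\<bar>"
      by (simp add: P_def F_def sum_subtractf[symmetric] algebra_simps)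
    also have "\<dots> \<le> (\<Sum>i<I. \<Sum>j<J. \<bar>real_of_int (p i j) * (real t ^ i * (y ^ j - exp (\<gamma> * real j * real t)))\<bar>)"
      by (rule order_trans[OF sum_abs sum_mono[OF sum_abs]])
    also have "\<dots> \<le> (\<Sum>i<I. \<Sum>j<J. exp (X / 9 + X / 1000) * (exp (X / 16) * (exp (X / 50) * (exp (X / 1000) * exp (- X)))))"
    proof (intro sum_mono)
      fix i j assume ij: "i \<in> {..<I}" "j \<in> {..<J}"
      have "real t ^ i \<le> \<tau> ^ i" using t\<tau> by (intro power_mono) auto
      also have "\<dots> \<le> \<tau> ^ I" using \<tau>1 ij by (intro power_increasing) auto
      finally have "real t ^ i \<le> exp (X / 16)" using \<tau>I by simp
      then show "\<bar>real_of_int (p i j) * (real t ^ i * (y ^ j - exp (\<gamma> * real j * real t)))\<bar> \<le>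
          exp (X / 9 + X / 1000) * (exp (X / 16) * (exp (X / 50) * (exp (X / 1000) * exp (- X))))"
        unfolding abs_mult using pH[of i j] H(2) diff[of j] ij
        by (intro mult_mono) (auto intro: order_trans)
    qed
    also have "\<dots> = X * (exp (X / 9 + X / 1000) * (exp (X / 16) * (exp (X / 50) * (exp (X / 1000) * exp (- X)))))"
      by (simp add: XIJ)
    also have "\<dots> \<le> exp (X / 1000) * (exp (X / 9 + X / 1000) * (exp (X / 16) * (exp (X / 50) * (exp (X / 1000) * exp (- X)))))"
      using Xexp by (intro mult_right_mono) auto
    finally have PF: "\<bar>P - F\<bar> \<le> \<dots>" .
    \<comment> \<open>\<open>n2 ^ J\<close> is a common denominator of the powers y^j with j <
      J.\<close>
    have D: "real n2 ^ J \<le> exp (X / 50)"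
    proof -
      have "n2 \<le> W ^ r * W ^ s"
        unfolding n2_def using \<alpha> \<beta> by (intro mult_mono power_mono) auto
      then have "n2 ^ J \<le> (W ^ (r + s)) ^ J" by (intro power_mono) (auto simp: power_add)
      also have "\<dots> = W ^ ((r + s) * J)" by (simp add: power_mult)
      also have "\<dots> \<le> W ^ ((2 * R + J) * J)" using W rs by (intro power_increasing mult_right_mono) auto
      finally have "real n2 ^ J \<le> real W ^ ((2 * R + J) * J)" by (metis of_nat_le_iff of_nat_power)
      also have "\<dots> \<le> exp (real W) ^ ((2 * R + J) * J)"
        using exp_ge_add_one_self[of "real W"] by (intro power_mono) linarith+
      also have "\<dots> = exp (real ((2 * R + J) * J) * real W)" by (rule exp_of_nat_mult[symmetric])
      also have "\<dots> = exp ((2 * real A + 1) * (W * (real J)\<^sup>2))"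
        by (simp add: R power2_eq_square algebra_simps)
      also have "\<dots> \<le> exp ((4 * real A) * (W * (real J)\<^sup>2))"
        using A1le by (intro iffD2[OF exp_le_cancel_iff] mult_right_mono) auto
      finally show ?thesis by (simp add: X50 mult_ac)
    qed
    \<comment> \<open>The factor exp(X / 50) bounds the denominator. The three errors, from
      replacing y^j by an exponential, from the Taylor coefficients and from the tails, each stay
      below 1 / X after multiplication by it, so their sum is below 1.\<close>
    have small: "exp (X / 50) * u \<le> 1 / X" if "u \<le> exp v" "v \<le> - X / 1000 - X / 50" for u v
    proof -
      have "exp (X / 50) * u \<le> exp (X / 50) * exp v" using that by (intro mult_left_mono) auto
      also have "\<dots> \<le> exp (- (X / 1000))" using that by (simp add: exp_add[symmetric])
      also have "\<dots> \<le> 1 / X" using Xexp X by (simp add: exp_minus inverse_eq_divide frac_le)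
      finally show ?thesis .
    qed
    have
      "exp (X / 50) * (exp (X / 1000) * (exp (X / 9 + X / 1000) *
         (exp (X / 16) * (exp (X / 50) * (exp (X / 1000) * exp (- X)))))) \<le> 1 / X"
      by (rule small[of _ "X / 1000 + (X / 9 + X / 1000 + (X / 16 + (X / 50 + (X / 1000 + - X))))"],
        simp only: exp_add order_refl, use X in simp)
    moreover have
      "exp (X / 50) * (exp (X / 1000) *
         (exp (X / 1000) * (exp (X / 16) * exp (X / 50)) * exp (- X / 9))) \<le> 1 / X"
      by (rule small[of _ "X / 1000 + (X / 1000 + (X / 16 + X / 50) + - X / 9)"],
        simp only: exp_add order_refl, use X in simp)
    moreover have
      "exp (X / 50) * (exp (X / 1000) * (exp (X / 9 + X / 1000) *
         (exp (X / 16) * exp (X / 8 - X / 2) * exp (3 * (X / 50))))) \<le> 1 / X"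
      by (rule small[of _ "X / 1000 + (X / 9 + X / 1000 + (X / 16 + (X / 8 - X / 2) + 3 * (X / 50)))"],
        simp only: exp_add order_refl, use X in simp)
    ultimately have exps: "exp (X / 50) *
        (exp (X / 1000) * (exp (X / 9 + X / 1000) * (exp (X / 16) * (exp (X / 50) * (exp (X / 1000) * exp (- X))))) +
         (exp (X / 1000) * (exp (X / 1000) * (exp (X / 16) * exp (X / 50)) * exp (- X / 9)) +
          exp (X / 1000) * (exp (X / 9 + X / 1000) * (exp (X / 16) * exp (X / 8 - X / 2) * exp (3 * (X / 50))))))
        \<le> 1 / X + (1 / X + 1 / X)"
      unfolding distrib_left by (intro add_mono)
    have F: "\<bar>F\<bar> \<le>
      real T * (real (I * J) * (\<tau> ^ I * exp (real J * \<gamma> * \<tau>)) / real H) +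
      real (I * J) * (real H * (\<tau> ^ I * exp (real I - real T) * exp (exp 1 * (real J * \<gamma> * \<tau>))))"
      unfolding F_def by (rule p(3)) (use t\<tau> in auto)
    have "exp (X / 50) * \<bar>P\<bar> \<le> exp (X / 50) * (\<bar>P - F\<bar> + \<bar>F\<bar>)" by (intro mult_left_mono) auto
    also have "\<dots> \<le> exp (X / 50) *
        (exp (X / 1000) * (exp (X / 9 + X / 1000) * (exp (X / 16) * (exp (X / 50) * (exp (X / 1000) * exp (- X))))) +
         (exp (X / 1000) * (exp (X / 1000) * (exp (X / 16) * exp (X / 50)) * exp (- X / 9)) +
          exp (X / 1000) * (exp (X / 9 + X / 1000) * (exp (X / 16) * exp (X / 8 - X / 2) * exp (3 * (X / 50))))))"
      using PF F term1 term2 by (intro mult_left_mono add_mono) auto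
    also have "\<dots> \<le> 1 / X + (1 / X + 1 / X)"
      by (rule exps)
    also have "\<dots> < 1" using X by (simp add: field_simps)
    finally have "exp (X / 50) * \<bar>P\<bar> < 1" .
    then have "real n2 ^ J * \<bar>P\<bar> < 1" using mult_right_mono[OF D, of "\<bar>P\<bar>"] by simp
    define z where "z = (\<Sum>i<I. \<Sum>j<J. p i j * (int t ^ i * (int n1 ^ j * int n2 ^ (J - j))))"
    have "real n2 ^ J * y ^ j = real n1 ^ j * real n2 ^ (J - j)" if "j < J" for j
    proof -
      have "real n2 ^ J = real n2 ^ (J - j) * real n2 ^ j"
        using that by (simp flip: power_add)
      moreover have "real n2 * y = real n1"
        using \<alpha> \<beta> by (simp add: n1_def n2_def y_def \<alpha>_def \<beta>_def power_divide)
      then have "real n2 ^ j * y ^ j = real n1 ^ j" by (metis power_mult_distrib)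
      ultimately show ?thesis by (simp add: mult_ac)
    qed
    note n1n2 = this
    have "real n2 ^ J * P = (\<Sum>i<I. \<Sum>j<J. real_of_int (p i j) * (real t ^ i * (real n2 ^ J * y ^ j)))"
      by (simp add: P_def sum_distrib_left mult_ac)
    also have "\<dots> = (\<Sum>i<I. \<Sum>j<J. real_of_int (p i j) * (real t ^ i * (real n1 ^ j * real n2 ^ (J - j))))"
      by (intro sum.cong refl) (simp add: n1n2)
    also have "\<dots> = real_of_int z" by (simp add: z_def)
    finally have z: "real n2 ^ J * P = real_of_int z" .
    then have "\<bar>real_of_int z\<bar> < 1"
      using \<open>real n2 ^ J * \<bar>P\<bar> < 1\<close> by (metis abs_mult abs_of_nat of_nat_power)
    then have "z = 0" by linarith
    then have "P = 0" using z \<open>n2 > 0\<close> by simp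
    then show ?thesis by (simp add: P_def t_def y_def)
  qed
  define Q where "Q j = (\<Sum>i<I. monom (real_of_int (p i j)) i)" for j
  define E where "E = (\<lambda>(r, s). (real (r * k + s * l), \<beta> ^ r * \<alpha> ^ s)) ` ({..<R} \<times> {..<R})"
  have injE: "inj_on (fst \<circ> (\<lambda>(r, s). (real (r * k + s * l), \<beta> ^ r * \<alpha> ^ s))) ({..<R} \<times> {..<R})"
    using inj_on_linear_combination[OF cop kl large]
    by (simp add: inj_on_def split_beta flip: of_nat_add of_nat_mult)
  have "I > 0" using W J by (simp add: I_def R A)
  have "Q j = 0" if "j < J" for j
  proof (rule zero_estimate[where \<beta> = \<beta> and E = E and J = J and D = "I - 1" and h = k and P = Q])
    show "inj_on fst E" unfolding E_def using injE by (rule inj_on_imageI)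
    have "card E = R * R"
      unfolding E_def by (subst card_image[OF inj_on_imageI2[OF injE]]) simp
    then have "card E = I * J" by (simp only: IJ(1))
    \<comment> \<open>There are exactly I J points, J more than the zero estimate tolerates for
      polynomials of degree at most I - 1.\<close>
    then show "(I - 1) * J < card E" using \<open>I > 0\<close> J by simp
    show "degree (Q j) \<le> I - 1" for j
      unfolding Q_def by (intro degree_sum_le) (auto intro!: order_trans[OF degree_monom_le])
    show "y \<noteq> 0" if "(t, y) \<in> E" for t y using that \<alpha>1 \<beta>1 by (auto simp: E_def)
    fix t y \<mu> assume "(t, y) \<in> E" and \<mu>: "\<mu> < J"
    then obtain r s where rs: "r < R" "s < R" "t = real (r * k + s * l)" "y = \<beta> ^ r * \<alpha> ^ s"
      by (auto simp: E_def)
    have "t + real \<mu> * real k = real ((r + \<mu>) * k + s * l)" "\<beta> ^ \<mu> * y = \<beta> ^ (r + \<mu>) * \<alpha> ^ s"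
      by (simp_all add: rs algebra_simps power_add)
    then have "(\<Sum>j<J. poly (Q j) (t + real \<mu> * real k) * (\<beta> ^ \<mu> * y) ^ j) =
        (\<Sum>j<J. \<Sum>i<I. real_of_int (p i j) *
          (real ((r + \<mu>) * k + s * l) ^ i * (\<beta> ^ (r + \<mu>) * \<alpha> ^ s) ^ j))"
      by (simp only: Q_def poly_sum poly_monom sum_distrib_right mult.assoc)
    also have "\<dots> = 0" by (subst sum.swap, rule zero) (use rs \<mu> in auto)
    finally show "(\<Sum>j<J. poly (Q j) (t + real \<mu> * real k) * (\<beta> ^ \<mu> * y) ^ j) = 0" .
  qed (use \<beta>1 that in \<open>auto simp: E_def\<close>)
  then have "p i j = 0" if "i < I" "j < J" for i j
  proof -
    have "coeff (Q j) i = real_of_int (p i j)" using that(1) by (simp add: Q_def coeff_sum)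
    then show ?thesis using \<open>j < J \<Longrightarrow> Q j = 0\<close> that(2) by simp
  qed
  then show False using p(1) by blast
qed

text \<open>Division by the gcd only decreases the form, so coprime coefficients suffice. If both
  are below R, the form is the difference of the logarithms of two distinct integers of size at most
  W^(2R), and 2 W <= R makes exp(-R^2) small enough.\<close>

theorem log_form_lower_bound:
  fixes A1 A2 B1 B2 W J k l A R :: nat
  assumes \<alpha>: "0 < A2" "A2 < A1" "A1 \<le> W" and \<beta>: "0 < B2" "B2 < B1" "B1 \<le> W"
    and indep: "\<And>k l. k + l > 0 \<Longrightarrow> A1 ^ k * B2 ^ l \<noteq> A2 ^ k * B1 ^ l"
    and A: "A = 200 * W" and R: "R = A * J" and J: "8 \<le> J"
    and size: "real (2 * (A + 1) * J * max k l) \<le> exp (real J / 16)" and kl: "k + l > 0"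
  shows "exp (- ((real R)\<^sup>2)) \<le> \<bar>k * ln (A1 / A2) - l * ln (B1 / B2)\<bar>"
proof -
  define g where "g = gcd k l"
  define k' l' where "k' = k div g" and "l' = l div g"
  have g: "g > 0" using kl by (auto simp: g_def)
  have kl': "k = g * k'" "l = g * l'" by (simp_all add: k'_def l'_def g_def)
  have cop: "coprime k' l'" unfolding k'_def l'_def g_def using kl by (intro div_gcd_coprime) auto
  define \<Lambda> where "\<Lambda> = k' * ln (A1 / A2) - l' * ln (B1 / B2)"
  have W: "W \<ge> 2" using \<alpha> by linarith
  have "R \<ge> 3200" using W J mult_le_mono[of 400 A 8 J] by (simp add: A R)
  have "exp (- ((real R)\<^sup>2)) \<le> \<bar>\<Lambda>\<bar>"
  proof (cases "R \<le> k' \<or> R \<le> l'")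
    case True
    have "k' \<le> k" "l' \<le> l" using kl' g by auto
    then have "2 * (A + 1) * J * max k' l' \<le> 2 * (A + 1) * J * max k l" by (intro mult_left_mono) auto
    then have "real (2 * (A + 1) * J * max k' l') \<le> exp (real J / 16)"
      using size of_nat_mono order_trans by blast
    \<comment> \<open>If one coefficient were 0, coprimality would make the other 1, far below
      R.\<close>
    moreover have "k' > 0" "l' > 0" using cop True \<open>R \<ge> 3200\<close> by (auto intro!: Nat.gr0I)
    ultimately show ?thesis
      unfolding \<Lambda>_def using log_form_lower_bound_large[OF \<alpha> \<beta> A R J _ cop] True by blast
  next
    case False
    define x y where "x = A1 ^ k' * B2 ^ l'" and "y = A2 ^ k' * B1 ^ l'"
    have pos: "x > 0" "y > 0" using \<alpha> \<beta> by (auto simp: x_def y_def)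
    have "x \<le> W ^ k' * W ^ l'" "y \<le> W ^ k' * W ^ l'"
      unfolding x_def y_def using \<alpha> \<beta> by (auto intro!: mult_mono power_mono)
    moreover have "W ^ k' * W ^ l' \<le> W ^ (2 * R)"
      unfolding power_add[symmetric] using False W by (intro power_increasing) auto
    moreover have "k' + l' > 0" using kl kl' by auto
    ultimately have "1 / real (W ^ (2 * R)) \<le> \<bar>ln (real x) - ln (real y)\<bar>"
      using pos indep by (intro ln_nat_diff_lower_bound) (auto simp: x_def y_def)
    also have "ln (real x) - ln (real y) = \<Lambda>"
      using \<alpha> \<beta> by (simp add: x_def y_def \<Lambda>_def ln_mult ln_div ln_realpow algebra_simps)
    finally have "1 / real (W ^ (2 * R)) \<le> \<bar>\<Lambda>\<bar>" .
    moreover have "real (W ^ (2 * R)) \<le> exp ((real R)\<^sup>2)"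
    proof -
      have "real (W ^ (2 * R)) \<le> exp (real W) ^ (2 * R)"
        unfolding of_nat_power using exp_ge_add_one_self[of "real W"] by (intro power_mono) linarith+
      also have "\<dots> = exp (real R * (2 * real W))" by (simp add: exp_of_nat_mult[symmetric])
      also have "\<dots> \<le> exp (real R * real R)"
      proof -
        have "2 * W \<le> R" using J by (simp add: R A)
        then have "2 * real W \<le> real R" by linarith
        then show ?thesis by (intro iffD2[OF exp_le_cancel_iff] mult_left_mono) auto
      qed
      finally show ?thesis by (simp add: power2_eq_square)
    qed
    then have "exp (- ((real R)\<^sup>2)) \<le> 1 / real (W ^ (2 * R))"
      using W by (simp add: exp_minus inverse_eq_divide frac_le)
    ultimately show ?thesis by linarith
  qed
  also have "1 * \<bar>\<Lambda>\<bar> \<le> real g * \<bar>\<Lambda>\<bar>" using g by (intro mult_right_mono) auto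
  then have "\<bar>\<Lambda>\<bar> \<le> \<bar>real g * \<Lambda>\<bar>" by (simp add: abs_mult)
  also have "real g * \<Lambda> = k * ln (A1 / A2) - l * ln (B1 / B2)"
    by (simp add: \<Lambda>_def kl' algebra_simps)
  finally show ?thesis .
qed


section \<open>Cycles as orbits\<close>

text \<open>What is used of \<open>f x = y\<close>, in a form invariant under reversing the cycle and exchanging
  \<open>(a, b)\<close> with \<open>(c, d)\<close>. This reduces the case \<open>b > d\<close> to \<open>b < d\<close>.\<close>

definition gen_step :: "nat \<Rightarrow> nat \<Rightarrow> nat \<Rightarrow> nat \<Rightarrow> nat \<Rightarrow> nat \<Rightarrow> bool" where
  "gen_step a b c d x y \<longleftrightarrow>
     (b dvd x \<and> d dvd y \<and> b * y = d * x) \<or>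
     (\<not> b dvd x \<and> \<not> d dvd y \<and> \<bar>int (a * b * y) - int (c * d * x)\<bar> < int (a * b * c * d))"

lemma gen_step_swap: "gen_step a b c d x y \<longleftrightarrow> gen_step c d a b y x"
  by (auto simp: gen_step_def abs_minus_commute mult_ac)

text \<open>Equality would mean d^(k+l) (b-1)^l = b^(k+l) (d-1)^l. As d is coprime to d - 1, this
  makes d^(k+l) divide b^(k+l), so d divides b; by symmetry b divides d.\<close>

lemma ratio_independent:
  fixes b d :: nat
  assumes "b > 1" "d > 1" "b \<noteq> d" "k + l > 0"
  shows "d ^ k * ((b - 1) * d) ^ l \<noteq> b ^ k * ((d - 1) * b) ^ l"
proof
  assume "d ^ k * ((b - 1) * d) ^ l = b ^ k * ((d - 1) * b) ^ l"
  then have eq: "d ^ (k + l) * (b - 1) ^ l = b ^ (k + l) * (d - 1) ^ l"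
    by (simp add: power_add power_mult_distrib mult_ac)
  have *: "y dvd x" if "x > 1" "y > 1" "y ^ (k + l) * (x - 1) ^ l = x ^ (k + l) * (y - 1) ^ l" for x y :: nat
  proof -
    have "y ^ (k + l) dvd x ^ (k + l) * (y - 1) ^ l" using that(3) by (metis dvd_triv_left)
    moreover have "coprime (y ^ (k + l)) ((y - 1) ^ l)"
      using that(2) coprime_diff_one_right_nat[of y] by simp
    ultimately have "y ^ (k + l) dvd x ^ (k + l)" by (simp add: coprime_dvd_mult_left_iff)
    then show ?thesis using assms(4) by (simp add: pow_divides_pow_iff)
  qed
  have "d dvd b" by (rule *[OF _ _ eq]) (use assms in auto)
  moreover have "b dvd d" by (rule *[OF _ _ eq[symmetric]]) (use assms in auto)
  ultimately show False using assms(3) by (simp add: dvd_antisym)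
qed

text \<open>The inverse \<open>g\<close> is a parameter on a par with \<open>f\<close>: a cycle with
  b > d is treated by exchanging \<open>f\<close> with \<open>g\<close> and the two pairs, which
  leaves the local minima unchanged.\<close>

locale orbit =
  fixes a b c d m :: nat and C :: "nat set" and f g :: "nat \<Rightarrow> nat"
  assumes ab: "a > 0" "b > 1" "c > 0" "b < d" and N: "a * (b - 1) = c * (d - 1)"
    and C: "finite C" "C \<noteq> {}" "0 \<notin> C"
    and f: "\<And>x. x \<in> C \<Longrightarrow> f x \<in> C" and g: "\<And>x. x \<in> C \<Longrightarrow> g x \<in> C"
    and gf: "\<And>x. x \<in> C \<Longrightarrow> g (f x) = x" and fg: "\<And>x. x \<in> C \<Longrightarrow> f (g x) = x"
    and trans: "\<And>x y. x \<in> C \<Longrightarrow> y \<in> C \<Longrightarrow> \<exists>n. (f ^^ n) x = y"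
    and step: "\<And>x. x \<in> C \<Longrightarrow> gen_step a b c d x (f x)"
    and minima: "card {x \<in> C. x < f x \<and> x < g x} \<le> m"
begin

text \<open>From \<open>S\<close> on nonmultiples of \<open>b\<close> step downwards;
  \<open>G\<close> bounds the growth at a step from any nonmultiple. The fraction d'/b' is d/b in
  lowest terms, and the powers of \<open>b'\<close> dividing an element limit the length of an
  ascending run.\<close>

definition "S = 2 * (a * b * c * d)"
definition "G = c * d + 1"
definition "K = card C"
definition "mults = {x \<in> C. b dvd x}"
definition "nonmults = {x \<in> C. \<not> b dvd x}"
definition "minims = {x \<in> C. x < f x \<and> x < g x}"
definition "b' = b div gcd b d"
definition "d' = d div gcd b d"

section \<open>Single steps of the orbit\<close>

lemma bij: "bij_betw f C C"
  by (rule bij_betw_byWitness[where f' = g]) (use f g fg gf in auto)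

lemma pos: "x \<in> C \<Longrightarrow> x > 0" using C(3) by (cases "x = 0") auto

text \<open>With N the common value of a (b - 1) and c (d - 1), a b = N + a and c d = N + c, and b <
  d forces c < a.\<close>

lemma cd_less_ab: "c * d < a * b"
proof -
  have "c * (b - 1) < c * (d - 1)" using ab by auto
  then have "c * (b - 1) < a * (b - 1)" using N by simp
  then have "c < a" by simp
  moreover have "a * b = a * (b - 1) + a" using ab by (cases b) auto
  moreover have "c * d = c * (d - 1) + c" using ab by (cases d) auto
  ultimately show ?thesis using N by linarith
qed

lemma b'd': "b = gcd b d * b'" "d = gcd b d * d'" "coprime b' d'" "b' > 0" "b' < d'" "d' \<le> d"
proof -
  show 1: "b = gcd b d * b'" "d = gcd b d * d'" by (simp_all add: b'_def d'_def)
  show "coprime b' d'" unfolding b'_def d'_def using ab by (intro div_gcd_coprime) auto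
  show "b' > 0" using 1(1) ab by (auto intro!: Nat.gr0I)
  show "b' < d'" using ab(4) by (subst (asm) 1(1), subst (asm) 1(2)) simp
  show "d' \<le> d" by (simp add: d'_def)
qed

lemma mult_step:
  assumes "x \<in> C" "b dvd x"
  shows "b * f x = d * x" "b' * f x = d' * x" "x < f x"
proof -
  show 1: "b * f x = d * x" using step[OF assms(1)] assms(2) by (auto simp: gen_step_def)
  have "gcd b d * (b' * f x) = gcd b d * (d' * x)"
    using 1 b'd'(1,2) by (metis mult.assoc)
  then show "b' * f x = d' * x" using ab by simp
  have "b * x < b * f x" using 1 ab pos[OF assms(1)] by simp
  then show "x < f x" by simp
qed

lemma nonmult_step:
  assumes "x \<in> C" "\<not> b dvd x"
  shows "\<bar>real (a * b) * real (f x) - real (c * d) * real x\<bar> < real (a * b) * real (c * d)"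
proof -
  have "\<bar>int (a * b * f x) - int (c * d * x)\<bar> < int (a * b * c * d)"
    using step[OF assms(1)] assms(2) by (auto simp: gen_step_def)
  then have "real_of_int \<bar>int (a * b * f x) - int (c * d * x)\<bar> < real_of_int (int (a * b * c * d))"
    by (simp only: of_int_less_iff)
  then show ?thesis by (simp add: mult.assoc)
qed

lemma small_step:
  assumes "x \<in> C" "\<not> b dvd x"
  shows "f x \<le> G * x"
proof -
  have "real (a * b) * f x < real (c * d) * real x + real (a * b) * real (c * d)"
    using nonmult_step[OF assms] by linarith
  also have "real (c * d) * real x \<le> real (a * b) * real x"
    by (intro mult_right_mono of_nat_mono less_imp_le[OF cd_less_ab]) auto
  finally have "real (a * b) * f x < real (a * b) * (real x + real (c * d))"
    by (simp add: algebra_simps)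
  then have "real (f x) < real (x + c * d)" using ab by simp
  then have "f x < x + c * d" by linarith
  also have "c * d \<le> c * d * x" using pos[OF assms(1)] by simp
  finally show ?thesis by (simp add: G_def)
qed

text \<open>Up to an error below c d, a nonmultiple is multiplied by c d / (a b), at most 1 - 1 / (a
  b). From \<open>S\<close> on the error is at most x / (2 a b), which leaves the factor 1 - 1 / (2
  a b).\<close>

lemma large_step:
  assumes "x \<in> C" "\<not> b dvd x" "S \<le> x"
  shows "ln (f x) - ln x \<le> - 1 / (2 * real (a * b))" "f x < x"
proof -
  define P where "P = real (a * b)"
  have P: "P > 0" "real (c * d) \<le> P - 1" using cd_less_ab ab by (auto simp: P_def simp flip: of_nat_mult)
  have x: "real x > 0" "real (f x) > 0" using pos[of x] pos[of "f x"] f assms(1) by auto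
  have "2 * P * real (c * d) \<le> real x"
    using assms(3) of_nat_mono[of S x] by (simp add: S_def P_def mult.assoc)
  then have "P * real (c * d) \<le> real x / 2" by simp
  then have "P * f x < (P - 1) * real x + real x / 2"
    using nonmult_step[OF assms(1,2)] P(2) mult_right_mono[OF P(2), of "real x"] unfolding P_def[symmetric]
    by linarith
  also have "\<dots> = (P - 1 / 2) * real x" by (simp add: algebra_simps)
  finally have *: "P * f x < (P - 1 / 2) * real x" .
  have "(P - 1 / 2) * real x = P * ((1 - 1 / (2 * P)) * x)" using P(1) by (simp add: field_simps)
  then have "real (f x) \<le> (1 - 1 / (2 * P)) * x" using * P(1)
    by (simp only: mult_less_cancel_left_pos less_imp_le)
  then have quot: "f x / x \<le> 1 - 1 / (2 * P)" using x by (simp only: pos_divide_le_eq)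
  have "ln (f x) - ln x = ln (f x / x)" using x by (simp add: ln_div)
  also have "\<dots> \<le> f x / x - 1" using x by (intro ln_le_minus_one) auto
  also have "\<dots> \<le> - 1 / (2 * P)" using quot by simp
  finally show "ln (f x) - ln x \<le> - 1 / (2 * real (a * b))" by (simp add: P_def)
  have "(P - 1 / 2) * real x < P * real x" using x by simp
  then have "P * real (f x) < P * real x" using * by linarith
  then show "f x < x" using P by simp
qed

text \<open>By a (b - 1) = c (d - 1) the fraction equals a b / (c d). Its product with f x / x is 1
  + \<epsilon> with \<epsilon> at most a b / x in absolute value, and the lower bound for x keeps
  this below 1/2.\<close>

lemma log_step:
  assumes "x \<in> C" "\<not> b dvd x" "2 * (a * b) \<le> x"
  shows "\<bar>ln (f x) - ln x + ln (real ((d - 1) * b) / real ((b - 1) * d))\<bar> \<le> 2 * real (a * b) / real x"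
proof -
  define P Q where "P = real (a * b)" and "Q = real (c * d)"
  have P: "P > 0" "Q > 0" using ab by (auto simp: P_def Q_def)
  have x: "real x > 0" "real (f x) > 0" using pos[of x] pos[of "f x"] f assms(1) by auto
  have "(c * d) * ((d - 1) * b) = (a * b) * ((b - 1) * d)"
    using N by (metis (no_types, lifting) mult.assoc mult.commute)
  then have "Q * real ((d - 1) * b) = P * real ((b - 1) * d)"
    unfolding P_def Q_def by (metis of_nat_mult)
  then have \<beta>: "real ((d - 1) * b) / real ((b - 1) * d) = P / Q"
    using P ab by (simp add: field_simps)
  define \<epsilon> where "\<epsilon> = (P * f x - Q * x) / (Q * x)"
  have "\<bar>\<epsilon>\<bar> = \<bar>P * f x - Q * x\<bar> / (Q * x)" using P x by (simp add: \<epsilon>_def)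
  also have "\<dots> \<le> P * Q / (Q * x)"
    using nonmult_step[OF assms(1,2)] P x by (intro divide_right_mono) (auto simp: P_def Q_def)
  finally have \<epsilon>: "\<bar>\<epsilon>\<bar> \<le> P / x" using P by simp
  have "2 * P \<le> x" using of_nat_mono[OF assms(3)] by (simp add: P_def)
  then have "P / x \<le> 1 / 2" using x by (simp add: field_simps)
  then have \<epsilon>2: "\<bar>\<epsilon>\<bar> \<le> 1 / 2" using \<epsilon> by linarith
  have "ln (f x) - ln x + ln (P / Q) = ln (1 + \<epsilon>)"
  proof -
    have "1 + \<epsilon> = (f x / x) * (P / Q)" using P x by (simp add: \<epsilon>_def field_simps)
    then show ?thesis using P x by (simp add: ln_mult ln_div)
  qed
  moreover have "\<bar>ln (1 + \<epsilon>)\<bar> \<le> 2 * \<bar>\<epsilon>\<bar>"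
  proof -
    have "ln (1 + \<epsilon>) \<le> \<epsilon>" using \<epsilon>2 by (intro ln_add_one_self_le_self2) auto
    moreover have "- ln (1 + \<epsilon>) \<le> 1 / (1 + \<epsilon>) - 1"
      using \<epsilon>2 ln_le_minus_one[of "1 / (1 + \<epsilon>)"] by (simp add: ln_div)
    moreover have "1 / (1 + \<epsilon>) - 1 \<le> 2 * \<bar>\<epsilon>\<bar>"
    proof -
      have "1 / (1 + \<epsilon>) - 1 = - \<epsilon> / (1 + \<epsilon>)" using \<epsilon>2 by (simp add: field_simps abs_le_iff)
      also have "\<dots> \<le> \<bar>\<epsilon>\<bar> / (1 / 2)" using \<epsilon>2 by (intro frac_le) auto
      finally show ?thesis by simp
    qed
    ultimately show ?thesis by linarith
  qed
  ultimately show ?thesis using \<epsilon> unfolding \<beta> by (simp add: P_def)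
qed

section \<open>Powers of \<open>b'\<close> along ascending runs\<close>

text \<open>If b divides d, the image of a multiple of b is a larger multiple of b, which is
  impossible for the largest one in the cycle.\<close>

lemma no_mult: "b' = 1 \<Longrightarrow> mults = {}"
proof (rule ccontr)
  assume b': "b' = 1" and ne: "mults \<noteq> {}"
  have fin: "finite mults" using C by (simp add: mults_def)
  define x where "x = Max mults"
  have x: "x \<in> C" "b dvd x" using Max_in[OF fin ne] by (auto simp: x_def mults_def)
  then have "f x = d' * x" using mult_step b' by simp
  then have "b dvd f x" using x(2) by simp
  then have "f x \<in> mults" using f[OF x(1)] by (simp add: mults_def)
  then show False using Max_ge[OF fin] mult_step(3)[OF x] by (force simp: x_def)
qed

lemma b'_ge_2: "x \<in> C \<Longrightarrow> b dvd x \<Longrightarrow> b' \<ge> 2"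
  using no_mult b'd'(4) by (cases "b' = 1") (auto simp: mults_def)

text \<open>In b' f(x) = d' x the factors b' and d' are coprime, so a run consumes a factor b' at
  every step.\<close>

lemma b'_power_dvd_step:
  assumes "x \<in> C" "b dvd x" "b' ^ e dvd f x"
  shows "b' ^ Suc e dvd x"
proof -
  have "b' ^ Suc e dvd d' * x" using assms(3) mult_step(2)[OF assms(1,2)] by (metis mult_dvd_mono dvd_refl power_Suc)
  moreover have "coprime (b' ^ Suc e) d'" using b'd'(3) by simp
  ultimately show ?thesis by (simp add: coprime_dvd_mult_right_iff)
qed

section \<open>The linear form attached to the cycle\<close>

lemma sum_f: "(\<Sum>x\<in>C. h (f x)) = (\<Sum>x\<in>C. h x)"
  by (rule sum.reindex_bij_betw[OF bij])

lemma sum_split: "(\<Sum>x\<in>C. h x) = (\<Sum>x\<in>mults. h x) + (\<Sum>x\<in>nonmults. h x)"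
proof -
  have "C = mults \<union> nonmults" "mults \<inter> nonmults = {}" by (auto simp: mults_def nonmults_def)
  moreover have "finite mults" "finite nonmults" using C by (auto simp: mults_def nonmults_def)
  ultimately show ?thesis by (metis sum.union_disjoint)
qed

lemma K_split: "K = card mults + card nonmults"
  using sum_split[of "\<lambda>_. 1 :: nat"] by (simp add: K_def)

lemma sum_log: "card mults * ln (d / b) + (\<Sum>x\<in>nonmults. ln (f x) - ln x) = 0"
proof -
  have "ln (f x) - ln x = ln (d / b)" if "x \<in> mults" for x
  proof -
    have x: "x \<in> C" "b dvd x" using that by (auto simp: mults_def)
    have "real b * f x = real d * x" using mult_step(1)[OF x] by (metis of_nat_mult)
    then have "real (f x) = (d / b) * x" using ab by (simp add: field_simps)
    then show ?thesis using pos[OF x(1)] ab ln_mult[of "d / b" x] by simp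
  qed
  then have "(\<Sum>x\<in>mults. ln (f x) - ln x) = card mults * ln (d / b)" by simp
  moreover have "(\<Sum>x\<in>C. ln (real (f x)) - ln (real x)) = 0"
    using sum_f[of "\<lambda>x. ln (real x)"] by (simp add: sum_subtractf)
  ultimately show ?thesis using sum_split[of "\<lambda>x. ln (f x) - ln x"] by simp
qed

text \<open>Multiples of b contribute log(d / b) without error; each nonmultiple x contributes an
  error of at most 2 a b / x.\<close>

lemma linear_form_upper_bound:
  assumes "2 * (a * b) \<le> Min C"
  shows "\<bar>card mults * ln (d / b) - card nonmults * ln (real ((d - 1) * b) / real ((b - 1) * d))\<bar> \<le>
    2 * real (a * b) * K / Min C"
proof -
  have le: "Min C \<le> x" if "x \<in> C" for x using C that by simp
  have MinC: "Min C \<in> C" using C by simp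
  define \<beta> where "\<beta> = real ((d - 1) * b) / real ((b - 1) * d)"
  have "card mults * ln (d / b) - card nonmults * ln \<beta> = - (\<Sum>x\<in>nonmults. ln (f x) - ln x + ln \<beta>)"
    using sum_log by (simp add: sum.distrib)
  then have "\<bar>card mults * ln (d / b) - card nonmults * ln \<beta>\<bar> = \<bar>\<Sum>x\<in>nonmults. ln (f x) - ln x + ln \<beta>\<bar>"
    by simp
  also have "\<dots> \<le> (\<Sum>x\<in>nonmults. \<bar>ln (f x) - ln x + ln \<beta>\<bar>)" by (rule sum_abs)
  also have "\<dots> \<le> (\<Sum>x\<in>nonmults. 2 * real (a * b) / Min C)"
  proof (rule sum_mono)
    fix x assume "x \<in> nonmults"
    then have x: "x \<in> C" "\<not> b dvd x" by (auto simp: nonmults_def)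
    have "\<bar>ln (f x) - ln x + ln \<beta>\<bar> \<le> 2 * real (a * b) / real x"
      unfolding \<beta>_def using le[OF x(1)] assms by (intro log_step x) auto
    also have "\<dots> \<le> 2 * real (a * b) / Min C"
      using le[OF x(1)] pos[OF MinC] by (intro divide_left_mono) auto
    finally show "\<bar>ln (f x) - ln x + ln \<beta>\<bar> \<le> 2 * real (a * b) / Min C" .
  qed
  also have "\<dots> = card nonmults * (2 * real (a * b) / Min C)" by simp
  also have "\<dots> \<le> K * (2 * real (a * b) / Min C)"
    using K_split by (intro mult_right_mono) auto
  also have "\<dots> = 2 * real (a * b) * K / Min C" by simp
  finally show ?thesis by (simp add: \<beta>_def)
qed

text \<open>\<open>Top x Y\<close> says that the ascending run of multiples of \<open>b\<close> starting at \<open>x\<close> stays below \<open>Y\<close>; it is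
  preserved along the run.\<close>

lemma element_bound:
  assumes Z: "Min C \<le> Z" "G * S \<le> Z" and x: "x \<in> C"
  shows "x \<le> Z ^ ((d + 1) ^ (m + 1))"
proof -
  define X where "X n = (f ^^ n) (Min C)" for n
  define Top where "Top x Y \<longleftrightarrow> (\<forall>e. b' ^ e dvd x \<longrightarrow> x * d' ^ e \<le> Y * b' ^ e)" for x Y
  \<comment> \<open>Indices start at 1: the run that may begin at the least element is paid for by
    the exponent k + 1 in \<open>Y k\<close>.\<close>
  define \<mu> where "\<mu> n = card (minims \<inter> X ` {1..n})" for n
  define Y where "Y k = Z ^ ((d + 1) ^ (k + 1))" for k
  have MinC: "Min C \<in> C" using C by simp
  have Z0: "Z > 0" using Z(1) pos[OF MinC] by simp
  have XC: "X n \<in> C" for n unfolding X_def by (induction n) (use MinC f in auto)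
  have X_Suc: "X (Suc n) = f (X n)" for n by (simp add: X_def)
  have Y_mono: "Y i \<le> Y j" if "i \<le> j" for i j
    unfolding Y_def using that Z0 by (intro power_increasing) auto
  have ZY: "Z ^ (d + 1) \<le> Y i" for i
    using Y_mono[of 0 i] by (simp add: Y_def)
  have Z_le: "Z \<le> Y i" for i
    using order_trans[OF self_le_power ZY] Z0 by simp
  have Y_Suc: "Y (Suc i) = Y i ^ (d + 1)" for i
  proof -
    have "(d + 1) ^ (Suc i + 1) = (d + 1) ^ (i + 1) * (d + 1)" by (metis add_Suc power_Suc2)
    then show ?thesis by (simp only: Y_def power_mult)
  qed
  \<comment> \<open>A power b'^e dividing x is at most B, so 2^e <= B, and d' < 2^d gives d'^e <=
    B^d. Hence the exponent d + 1.\<close>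
  have top: "Top x (B ^ (d + 1))" if x: "x \<in> C" "b dvd x" "x \<le> B" for x B
    unfolding Top_def
  proof (intro allI impI)
    fix e assume e: "b' ^ e dvd x"
    have "2 ^ e \<le> b' ^ e" using b'_ge_2[OF x(1,2)] by (intro power_mono) auto
    also have "\<dots> \<le> x" using e pos[OF x(1)] by (intro dvd_imp_le)
    finally have "2 ^ e \<le> B" using x by simp
    have "d' ^ e \<le> (2 ^ d) ^ e" using b'd'(6) less_exp[of d] by (intro power_mono) linarith+
    also have "\<dots> = (2 ^ e) ^ d" by (simp add: power_mult[symmetric] mult.commute)
    also have "\<dots> \<le> B ^ d" using \<open>2 ^ e \<le> B\<close> by (intro power_mono) auto
    finally have "x * d' ^ e \<le> B * B ^ d" using x by (intro mult_mono) auto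
    also have "\<dots> * 1 \<le> B * B ^ d * b' ^ e" using b'd'(4) by (intro mult_left_mono) (auto simp: Suc_le_eq)
    finally show "x * d' ^ e \<le> B ^ (d + 1) * b' ^ e" by simp
  qed
  have Top_mono: "Top x B'" if "Top x B" "B \<le> B'" for x B B'
    using that unfolding Top_def by (meson mult_le_mono1 order_trans)
  \<comment> \<open>Multiples stay within the bound of their run, small nonmultiples restart from
    \<open>Z\<close>, and large nonmultiples descend. A descent to a multiple reaches a local
    minimum, which injectivity shows to be new.\<close>
  have main: "inj_on X {..n} \<Longrightarrow> X n \<le> Y (\<mu> n) \<and> (b dvd X n \<longrightarrow> Top (X n) (Y (\<mu> n)))" for n
  proof (induction n)
    case 0
    have X0: "X 0 = Min C" by (simp add: X_def)
    show ?case
      unfolding X0 using order_trans[OF Z(1) Z_le] Top_mono[OF top[OF MinC _ Z(1)] ZY] by simp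
  next
    case (Suc n)
    have "inj_on X {..n}" using Suc.prems by (rule inj_on_subset) auto
    from Suc.IH[OF this] have IH: "X n \<le> Y (\<mu> n)" "b dvd X n \<Longrightarrow> Top (X n) (Y (\<mu> n))" by auto
    have "\<mu> n \<le> \<mu> (Suc n)" unfolding \<mu>_def by (intro card_mono) auto
    note Y\<mu> = Y_mono[OF this]
    consider "b dvd X n" | "\<not> b dvd X n" "X n < S" | "\<not> b dvd X n" "S \<le> X n" by linarith
    then show ?case
    proof cases
      case 1
      have "Top (X (Suc n)) (Y (\<mu> n))"
        unfolding Top_def X_Suc
      proof (intro allI impI)
        fix e assume "b' ^ e dvd f (X n)"
        then have "b' ^ Suc e dvd X n" by (rule b'_power_dvd_step[OF XC 1])
        then have "X n * d' ^ Suc e \<le> Y (\<mu> n) * b' ^ Suc e" using IH(2)[OF 1] unfolding Top_def by blast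
        then have "(d' * X n) * d' ^ e \<le> b' * (Y (\<mu> n) * b' ^ e)" by (simp add: mult_ac)
        then have "b' * (f (X n) * d' ^ e) \<le> b' * (Y (\<mu> n) * b' ^ e)"
          unfolding mult_step(2)[OF XC 1, symmetric] by (simp add: mult_ac)
        then show "f (X n) * d' ^ e \<le> Y (\<mu> n) * b' ^ e" using b'd'(4) by simp
      qed
      then have T: "Top (X (Suc n)) (Y (\<mu> (Suc n)))" using Top_mono Y\<mu> by blast
      moreover have "X (Suc n) \<le> Y (\<mu> (Suc n))"
        using T[unfolded Top_def, rule_format, of 0] by simp
      ultimately show ?thesis by blast
    next
      case 2
      have "X (Suc n) \<le> G * X n" unfolding X_Suc by (rule small_step[OF XC 2(1)])
      also have "\<dots> \<le> G * S" using 2 by (intro mult_left_mono) auto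
      finally have le: "X (Suc n) \<le> Z" using Z by simp
      then show ?thesis using order_trans[OF le Z_le] Top_mono[OF top[OF XC _ le] ZY] by simp
    next
      case 3
      have less: "X (Suc n) < X n" unfolding X_Suc by (rule large_step(2)[OF XC 3])
      show ?thesis
      proof (cases "b dvd X (Suc n)")
        case False
        then show ?thesis using less IH(1) Y\<mu> by simp
      next
        case True
        have "X (Suc n) \<in> minims"
          using less mult_step(3)[OF XC True] XC[of "Suc n"] gf[OF XC, of n] by (simp add: minims_def X_Suc)
        moreover have "X (Suc n) \<notin> X ` {1..n}"
        proof
          assume "X (Suc n) \<in> X ` {1..n}"
          then obtain i where "X (Suc n) = X i" "i \<le> n" by auto
          then show False using inj_onD[OF Suc.prems, of "Suc n" i] by simp
        qed
        moreover have "{1..Suc n} = insert (Suc n) {1..n}" by auto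
        ultimately have "\<mu> (Suc n) = Suc (\<mu> n)" by (simp add: \<mu>_def Int_insert_right)
        then have T: "Top (X (Suc n)) (Y (\<mu> (Suc n)))"
          using top[OF XC True, of "Y (\<mu> n)"] less IH(1) by (simp add: Y_Suc)
        moreover have "X (Suc n) \<le> Y (\<mu> (Suc n))" using less IH(1) Y\<mu> by simp
        ultimately show ?thesis by blast
      qed
    qed
  qed
  \<comment> \<open>For the least such n no element is visited twice before x.\<close>
  define n where "n = (LEAST n. X n = x)"
  have ex: "\<exists>n. X n = x" unfolding X_def by (rule trans[OF MinC x])
  have n: "X n = x" unfolding n_def using LeastI_ex[OF ex] .
  have neq: "X i \<noteq> X j" if "i < j" "j \<le> n" for i j
  proof
    assume eq: "X i = X j"
    have "X (i + k) = X (j + k)" for k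
      by (induction k) (use eq in \<open>auto simp: X_Suc\<close>)
    from this[of "n - j"] have "X (i + (n - j)) = x" using n that by simp
    then have "n \<le> i + (n - j)" unfolding n_def by (rule Least_le)
    then show False using that by linarith
  qed
  have "inj_on X {..n}"
  proof (rule inj_onI)
    fix i j assume "i \<in> {..n}" "j \<in> {..n}" "X i = X j"
    then show "i = j" using neq[of i j] neq[of j i] by (cases i j rule: linorder_cases) auto
  qed
  then have "x \<le> Y (\<mu> n)" using main[of n] n by simp
  have "\<mu> n \<le> card minims"
    unfolding \<mu>_def using C by (intro card_mono) (auto simp: minims_def)
  then have "\<mu> n \<le> m" using minima by (simp add: minims_def)
  then have "Y (\<mu> n) \<le> Y m" by (rule Y_mono)
  with \<open>x \<le> Y (\<mu> n)\<close> have "x \<le> Y m" by simp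
  then show ?thesis by (simp add: Y_def)
qed

section \<open>Numbers of ascending and descending steps\<close>

lemma card_small: "card {x \<in> C. x < S} \<le> S"
proof -
  have "{x \<in> C. x < S} \<subseteq> {..<S}" by auto
  from card_mono[OF _ this] show ?thesis by simp
qed

text \<open>The multiplicity of \<open>b'\<close> drops by one at every step from a multiple of \<open>b\<close>. It can be replenished
  only where a multiple follows a nonmultiple, that is, at a local minimum or after a small element.\<close>

lemma card_mult_bound:
  fixes V :: real
  assumes V: "\<And>x. x \<in> C \<Longrightarrow> log 2 x \<le> V"
  shows "card mults \<le> V * (S + m)"
proof (cases "mults = {}")
  case True
  obtain x where "x \<in> C" using C by auto
  then have "0 \<le> log 2 x" using pos[of x] by (auto simp: zero_le_log_cancel_iff)
  then show ?thesis using True V[OF \<open>x \<in> C\<close>] by simp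
next
  case False
  then obtain x0 where x0: "x0 \<in> C" "b dvd x0" by (auto simp: mults_def)
  have b'2: "b' \<ge> 2" by (rule b'_ge_2[OF x0])
  define v where "v x = (if b dvd x then multiplicity b' x else 0)" for x
  have mult_le: "real (multiplicity b' x) \<le> V" if "x \<in> C" for x
  proof -
    have "2 ^ multiplicity b' x \<le> b' ^ multiplicity b' x" using b'2 by (intro power_mono) auto
    also have "\<dots> \<le> x" using pos[OF that] by (intro dvd_imp_le multiplicity_dvd) auto
    finally have "(2::real) ^ multiplicity b' x \<le> real x" by (metis of_nat_le_iff of_nat_numeral of_nat_power)
    then have "real (multiplicity b' x) \<le> log 2 x"
      using pos[OF that] by (simp add: le_log_iff powr_realpow)
    then show ?thesis using V[OF that] by simp
  qed
  have V0: "V \<ge> 0" using mult_le[OF x0(1)] by linarith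
  define St where "St = {x \<in> nonmults. b dvd f x}"
  have fin: "finite nonmults" "finite mults" "finite St" using C by (auto simp: nonmults_def mults_def St_def)
  have less: "v (f x) + 1 \<le> v x" if "x \<in> mults" for x
  proof -
    have x: "x \<in> C" "b dvd x" using that by (auto simp: mults_def)
    have "b' ^ Suc (v (f x)) dvd x"
      by (rule b'_power_dvd_step[OF x]) (simp add: v_def multiplicity_dvd)
    then have "Suc (v (f x)) \<le> multiplicity b' x"
      using pos[OF x(1)] b'2 by (intro multiplicity_geI) auto
    then show ?thesis using x by (simp add: v_def)
  qed
  \<comment> \<open>\<open>f\<close> permutes \<open>C\<close>, so the total of \<open>v\<close> is
    preserved. Every multiple loses at least 1, hence their number is at most the gain at the
    elements of \<open>St\<close>.\<close>
  have "(\<Sum>x\<in>mults. real (v x)) + (\<Sum>x\<in>nonmults. real (v x)) =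
      (\<Sum>x\<in>mults. real (v (f x))) + (\<Sum>x\<in>nonmults. real (v (f x)))"
    using sum_f[of "\<lambda>x. real (v x)"] sum_split[of "\<lambda>x. real (v x)"] sum_split[of "\<lambda>x. real (v (f x))"]
    by simp
  moreover have "(\<Sum>x\<in>nonmults. real (v x)) = 0" by (simp add: v_def nonmults_def)
  moreover have "(\<Sum>x\<in>mults. real (v (f x))) \<le> (\<Sum>x\<in>mults. real (v x) - 1)"
  proof (rule sum_mono)
    fix x assume "x \<in> mults"
    then show "real (v (f x)) \<le> real (v x) - 1" using less[of x] by linarith
  qed
  moreover have "(\<Sum>x\<in>nonmults. real (v (f x))) \<le> card St * V"
  proof -
    have "(\<Sum>x\<in>nonmults. real (v (f x))) = (\<Sum>x\<in>St. real (v (f x)))"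
      using fin by (intro sum.mono_neutral_right) (auto simp: St_def v_def)
    also have "\<dots> \<le> (\<Sum>x\<in>St. V)"
      using f mult_le V0 by (intro sum_mono) (auto simp: St_def nonmults_def v_def)
    finally show ?thesis by simp
  qed
  ultimately have "card mults \<le> card St * V" by (simp add: sum_subtractf)
  also have "card St \<le> S + m"
  proof -
    have "St \<subseteq> {x \<in> C. x < S} \<union> g ` minims"
    proof
      fix x assume "x \<in> St"
      then have x: "x \<in> C" "\<not> b dvd x" "b dvd f x" by (auto simp: St_def nonmults_def)
      show "x \<in> {x \<in> C. x < S} \<union> g ` minims"
      proof (cases "x < S")
        case True
        then show ?thesis using x(1) by simp
      next
        case False
        then have "f x < x" using large_step(2)[OF x(1,2)] by simp
        then have "f x \<in> minims"
          using mult_step(3)[OF f[OF x(1)] x(3)] f[OF x(1)] gf[OF x(1)] by (simp add: minims_def)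
        then show ?thesis using gf[OF x(1)] by (metis UnI2 image_eqI)
      qed
    qed
    then have "card St \<le> card ({x \<in> C. x < S} \<union> g ` minims)"
      using C by (intro card_mono) (auto simp: minims_def)
    also have "\<dots> \<le> card {x \<in> C. x < S} + card (g ` minims)" by (rule card_Un_le)
    also have "card (g ` minims) \<le> card minims" using C by (intro card_image_le) (auto simp: minims_def)
    also have "card minims \<le> m" using minima by (simp add: minims_def)
    finally show ?thesis using card_small by linarith
  qed
  then have "card St * V \<le> real (S + m) * V" using V0 by (intro mult_right_mono) auto
  finally show ?thesis by (simp add: mult.commute)
qed

text \<open>The logarithms balance over the cycle: a multiple of b raises the logarithm by log(d /
  b), at most d, a nonmultiple below \<open>S\<close> by at most log G, and every other nonmultiple
  lowers it by at least 1 / (2 a b).\<close>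

lemma card_nonmult_bound: "real (card nonmults) \<le> S + 2 * real (a * b) * (real (card mults) * d + S * real G)"
proof -
  define P where "P = real (a * b)"
  have P: "P > 0" using ab by (simp add: P_def)
  define small where "small = {x \<in> nonmults. x < S}"
  have fin: "finite nonmults" "finite small" and sub: "small \<subseteq> nonmults"
    using C by (auto simp: nonmults_def small_def)
  have cs: "card small \<le> S"
  proof -
    have "small \<subseteq> {x \<in> C. x < S}" by (auto simp: small_def nonmults_def)
    from card_mono[OF _ this] card_small show ?thesis using C(1) by simp
  qed
  have G1: "G \<ge> 1" by (simp add: G_def)
  have lnle: "ln (real n) \<le> real n" if "n \<ge> 1" for n
    using ln_le_minus_one[of "real n"] that by simp
  have "(\<Sum>x\<in>nonmults. ln (f x) - ln x) =
      (\<Sum>x\<in>nonmults - small. ln (f x) - ln x) + (\<Sum>x\<in>small. ln (f x) - ln x)"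
    by (rule sum.subset_diff[OF sub fin(1)])
  also have "\<dots> \<le> (\<Sum>x\<in>nonmults - small. - 1 / (2 * P)) + (\<Sum>x\<in>small. real G)"
  proof (intro add_mono sum_mono)
    fix x assume "x \<in> nonmults - small"
    then show "ln (f x) - ln x \<le> - 1 / (2 * P)"
      unfolding P_def by (intro large_step(1)) (auto simp: nonmults_def small_def)
  next
    fix x assume "x \<in> small"
    then have x: "x \<in> C" "\<not> b dvd x" by (auto simp: small_def nonmults_def)
    have "real (f x) \<le> real G * real x" using small_step[OF x] by (metis of_nat_le_iff of_nat_mult)
    then have "ln (f x) \<le> ln (real G * real x)" using pos[OF f[OF x(1)]] by simp
    also have "\<dots> = ln (real G) + ln x" using pos[OF x(1)] G1 by (simp add: ln_mult)
    finally show "ln (f x) - ln x \<le> G" using lnle[OF G1] by simp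
  qed
  also have "\<dots> = - (real (card nonmults) - card small) / (2 * P) + card small * real G"
    using card_Diff_subset[OF fin(2) sub] card_mono[OF fin(1) sub] by (simp add: of_nat_diff diff_divide_distrib)
  finally have "(real (card nonmults) - card small) / (2 * P) \<le> card mults * ln (d / b) + card small * real G"
    using sum_log minus_divide_left[of "real (card nonmults) - card small" "2 * P"] by linarith
  also have "\<dots> \<le> real (card mults) * d + S * real G"
  proof (intro add_mono mult_left_mono mult_right_mono)
    have "ln (real d / real b) \<le> real d / real b" using ln_le_minus_one[of "d / b"] ab by simp
    also have "\<dots> \<le> d" using ab by (simp add: divide_simps)
    finally show "ln (real d / real b) \<le> d" .
  qed (use cs in auto)
  finally have "real (card nonmults) - card small \<le> 2 * P * (real (card mults) * d + S * real G)"
    using P by (simp add: field_simps)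
  then show ?thesis using cs by (simp add: P_def)
qed

end


section \<open>An explicit bound for the elements of a cycle\<close>

definition log_scale :: "nat \<Rightarrow> nat" where
  "log_scale d = 200 * (d * d)"

definition small_size :: "nat \<Rightarrow> nat \<Rightarrow> nat \<Rightarrow> nat \<Rightarrow> nat" where
  "small_size a b c d = 2 * (a * b * c * d)"

text \<open>Let \<open>A = log_scale d\<close> and let \<open>K\<close> be the length of the cycle. If \<open>K\<close> is at most \<open>exp (J / 16)\<close> up
  to a factor polynomial in \<open>J\<close>, then the lower bound \<open>exp (- (A J)\<^sup>2)\<close> for the linear form in
  logarithms yields \<open>K \<le> J\<^sup>2 length_factor\<close>; applied with \<open>J\<close> the integer part of the cube root of \<open>K\<close>
  this gives \<open>K \<le> length_root\<^sup>3\<close>. The base of the power in \<open>cycle_bound\<close> bounds the least element, and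
  each local minimum raises the bound to the power \<open>d + 1\<close>.\<close>

definition length_factor :: "nat \<Rightarrow> nat \<Rightarrow> nat \<Rightarrow> nat \<Rightarrow> nat \<Rightarrow> nat" where
  "length_factor a b c d m =
     (d + 1) ^ (m + 1) * (2 * a * b * (c * d + 1) * small_size a b c d + 1 + 2 * log_scale d ^ 2) *
       (small_size a b c d + m) * (1 + 2 * a * b * d) +
     small_size a b c d + 2 * a * b * small_size a b c d * (c * d + 1)"

definition length_root :: "nat \<Rightarrow> nat \<Rightarrow> nat \<Rightarrow> nat \<Rightarrow> nat \<Rightarrow> nat" where
  "length_root a b c d m = length_factor a b c d m + 2 ^ 38 * (log_scale d + 1) + 1"

definition cycle_bound :: "nat \<Rightarrow> nat \<Rightarrow> nat \<Rightarrow> nat \<Rightarrow> nat \<Rightarrow> nat" where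
  "cycle_bound a b c d m =
     (2 * a * b * length_root a b c d m ^ 3 * 3 ^ ((log_scale d * length_root a b c d m) ^ 2) *
       ((c * d + 1) * small_size a b c d)) ^ ((d + 1) ^ (m + 1))"

text \<open>The Taylor term of order 6 is enough: 16 * 720 * 16^6 is below 2^38, and a factor J^2 of
  J^6 absorbs this constant and A + 1.\<close>

lemma polynomial_le_exp:
  fixes A J :: nat
  assumes "2 ^ 38 * (A + 1) \<le> J"
  shows "real (16 * (A + 1) * J ^ 4) \<le> exp (real J / 16)"
proof -
  have "J \<ge> 1" using assms by (simp add: Suc_le_eq)
  then have "J * 1 \<le> J * J" by (intro mult_le_mono2) auto
  then have "2 ^ 38 * (A + 1) \<le> J * J" using assms by linarith
  then have "real (2 ^ 38 * (A + 1)) \<le> real (J * J)" by (rule of_nat_mono)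
  then have *: "16 * 720 * 16 ^ 6 * (real A + 1) \<le> (real J)\<^sup>2" by (simp add: power2_eq_square)
  have "real (16 * (A + 1) * J ^ 4) = (16 * 720 * 16 ^ 6 * (real A + 1)) * (real J ^ 4 / (720 * 16 ^ 6))"
    by simp
  also have "\<dots> \<le> (real J)\<^sup>2 * (real J ^ 4 / (720 * 16 ^ 6))" using * by (intro mult_right_mono) auto
  also have "\<dots> = (real J / 16) ^ 6 / fact 6"
    by (simp add: fact_numeral power_divide power_add[symmetric])
  also have "\<dots> \<le> exp (real J / 16)" by (rule power_over_fact_le_exp) simp
  finally show ?thesis .
qed

context orbit
begin

definition "A = log_scale d"

lemma K_pos: "K > 0"
  using C by (simp add: K_def card_gt_0_iff)

lemma Min_bound:
  assumes J: "J \<ge> 8" "real (2 * (A + 1) * J * K) \<le> exp (real J / 16)"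
  shows "Min C \<le> 2 * a * b * K * 3 ^ ((A * J) ^ 2)"
proof (cases "2 * (a * b) \<le> Min C")
  case False
  have "1 \<le> K * 3 ^ ((A * J) ^ 2)" using K_pos by (simp add: Suc_le_eq)
  then have "2 * (a * b) * 1 \<le> 2 * (a * b) * (K * 3 ^ ((A * J) ^ 2))" by (intro mult_le_mono2)
  also have "\<dots> = 2 * a * b * K * 3 ^ ((A * J) ^ 2)" by (simp only: mult.assoc)
  finally show ?thesis using False by linarith
next
  case True
  define k l where "k = card mults" and "l = card nonmults"
  have kl: "K = k + l" by (simp add: K_split k_def l_def)
  have Min: "real (Min C) > 0" using pos[of "Min C"] C by simp
  have "exp (- ((real (A * J))\<^sup>2)) \<le> \<bar>k * ln (d / b) - l * ln (real ((d - 1) * b) / real ((b - 1) * d))\<bar>"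
  \<comment> \<open>The value d * d bounds both numerators, d and (d - 1) b.\<close>
  proof (rule log_form_lower_bound[where W = "d * d" and J = J and A = A and R = "A * J"])
    show "0 < b" "b < d" "d \<le> d * d" "0 < (b - 1) * d" "8 \<le> J" using ab J by auto
    have "(b - 1) * d = b * d - d" "(d - 1) * b = b * d - b" by (simp_all add: algebra_simps)
    moreover have "b * d \<ge> d" "b * d \<ge> b" using ab by auto
    ultimately show "(b - 1) * d < (d - 1) * b" using ab by linarith
    show "(d - 1) * b \<le> d * d" using ab by (intro mult_mono) auto
    show "d ^ k * ((b - 1) * d) ^ l \<noteq> b ^ k * ((d - 1) * b) ^ l" if "k + l > 0" for k l
      using ratio_independent[of b d k l] that ab by simp
    show "A = 200 * (d * d)" by (simp add: A_def log_scale_def)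
    show "k + l > 0" using kl K_pos by simp
    have "2 * (A + 1) * J * max k l \<le> 2 * (A + 1) * J * K" using kl by (intro mult_le_mono2) auto
    then show "real (2 * (A + 1) * J * max k l) \<le> exp (real J / 16)"
      using J(2) of_nat_mono order_trans by blast
  qed simp
  also have "\<dots> \<le> 2 * real (a * b) * K / Min C"
    unfolding k_def l_def by (rule linear_form_upper_bound[OF True])
  finally have "Min C * exp (- ((real (A * J))\<^sup>2)) \<le> 2 * real (a * b) * K"
    using Min by (simp add: field_simps)
  then have "real (Min C) \<le> 2 * real (a * b) * K * exp ((real (A * J))\<^sup>2)"
    by (simp add: exp_minus divide_simps)
  also have "exp ((real (A * J))\<^sup>2) = exp 1 ^ ((A * J) ^ 2)"
    by (simp add: exp_of_nat_mult[symmetric])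
  \<comment> \<open>Replacing e by 3 yields a natural number, which a program can compute.\<close>
  also have "2 * real (a * b) * K * exp 1 ^ ((A * J) ^ 2) \<le> 2 * real (a * b) * K * 3 ^ ((A * J) ^ 2)"
    using exp_le by (intro mult_left_mono power_mono) auto
  also have "\<dots> = real (2 * a * b * K * 3 ^ ((A * J) ^ 2))" by simp
  finally show ?thesis by (simp only: of_nat_le_iff)
qed

lemma log2_le: "n > 0 \<Longrightarrow> log 2 (real n) \<le> real n"
  using less_exp[of n] by (simp add: log_le_iff powr_realpow less_imp_le flip: of_nat_less_iff)

lemma G_S_pos: "G * S > 0"
  using ab by (simp add: G_def S_def)

text \<open>The bounds for the numbers of multiples and of nonmultiples are linear in log_2 Z. The
  dominant factor of Z is 3^((A J)^2), so log_2 Z is at most a constant times J^2.\<close>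

lemma orbit_length_bound:
  assumes J: "J \<ge> 8" "real (2 * (A + 1) * J * K) \<le> exp (real J / 16)"
  shows "K \<le> J ^ 2 * length_factor a b c d m"
proof -
  define M where "M = 2 * a * b * (G * S)"
  define B where "B = (A * J) ^ 2"
  define Z where "Z = M * (K * 3 ^ B)"
  define L where "L = M + 1 + 2 * A ^ 2"
  have M: "M > 0" using ab G_S_pos by (simp add: M_def)
  have Z1: "2 * a * b * K * 3 ^ B \<le> Z"
    using mult_le_mono2[of 1 "G * S" "2 * a * b * K * 3 ^ B"] G_S_pos
    by (simp add: Z_def M_def mult_ac Suc_le_eq)
  have "1 \<le> 2 * a * b * K * 3 ^ B" using ab K_pos by (simp add: Suc_le_eq)
  then have Z2: "G * S \<le> Z"
    using mult_le_mono2[of 1 "2 * a * b * K * 3 ^ B" "G * S"] by (simp add: Z_def M_def mult_ac)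
  have "Min C \<le> Z" using order_trans[OF Min_bound[OF J] Z1[unfolded B_def]] .
  note bound = element_bound[OF this Z2]
  define V where "V = real ((d + 1) ^ (m + 1)) * log 2 Z"
  have "log 2 x \<le> V" if "x \<in> C" for x
  proof -
    have "real x \<le> real Z ^ ((d + 1) ^ (m + 1))"
      using bound[OF that] by (metis of_nat_le_iff of_nat_power)
    then have "log 2 x \<le> log 2 (real Z ^ ((d + 1) ^ (m + 1)))"
      using pos[OF that] M K_pos by (intro iffD2[OF log_le_cancel_iff]) (auto simp: Z_def)
    then show ?thesis using M K_pos by (simp add: V_def Z_def log_nat_power)
  qed
  then have mults: "card mults \<le> V * (S + m)" by (rule card_mult_bound)
  have logK: "log 2 K \<le> J"
  proof -
    have "1 \<le> 2 * (A + 1) * J" using J(1) by (simp add: Suc_le_eq)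
    then have "1 * K \<le> 2 * (A + 1) * J * K" by (rule mult_le_mono1)
    then have "real K \<le> real (2 * (A + 1) * J * K)" by (simp only: of_nat_le_iff mult_1)
    then have "real K \<le> exp (real J / 16)" using J(2) by linarith
    then have "ln K \<le> real J / 16" using K_pos by (simp add: ln_ge_iff[symmetric] ln_le_cancel_iff[of K "exp (J / 16)", symmetric] del: ln_le_cancel_iff)
    moreover have "ln (1 / 2) \<le> (1 / 2 :: real) - 1" by (rule ln_le_minus_one) simp
    then have "1 / 2 \<le> ln (2 :: real)" by (simp add: ln_div)
    then have "real J * (1 / 2) \<le> real J * ln 2" by (intro mult_left_mono) auto
    ultimately have "ln K \<le> J * ln 2" by simp
    then show ?thesis by (simp add: log_def divide_le_eq)
  qed
  have "log 2 (3 :: real) \<le> log 2 4" by simp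
  also have "log 2 (4 :: real) = 2" using log_pow_cancel[of "2 :: real" 2] by simp
  finally have log3: "log 2 (3 :: real) \<le> 2" .
  have "log 2 Z = log 2 M + (log 2 K + B * log 2 3)"
    using M K_pos by (simp add: Z_def log_mult log_nat_power)
  also have "\<dots> \<le> real M + (real J + real B * 2)"
    using log2_le[OF M] logK log3 by (intro add_mono mult_left_mono) auto
  also have "\<dots> \<le> real (J ^ 2 * L)"
  proof -
    have "1 \<le> J ^ 2" "J \<le> J ^ 2" using J(1) by (auto simp: power2_eq_square Suc_le_eq)
    then have "M * 1 + (J + B * 2) \<le> M * J ^ 2 + (J ^ 2 + B * 2)"
      by (intro add_mono mult_le_mono2) auto
    also have "\<dots> = J ^ 2 * L" by (simp add: L_def B_def power_mult_distrib algebra_simps)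
    finally have "real (M * 1 + (J + B * 2)) \<le> real (J ^ 2 * L)" by (rule of_nat_mono)
    then show ?thesis by simp
  qed
  finally have logZ: "log 2 Z \<le> real (J ^ 2 * L)" .
  define D where "D = (d + 1) ^ (m + 1)"
  have "card mults \<le> V * real (S + m)" by (rule mults)
  also have "\<dots> \<le> (real D * real (J ^ 2 * L)) * real (S + m)"
    unfolding V_def D_def by (intro mult_right_mono mult_left_mono logZ) auto
  also have "\<dots> = real (J ^ 2 * (D * L * (S + m)))" by simp
  finally have k: "card mults \<le> J ^ 2 * (D * L * (S + m))" by (simp only: of_nat_le_iff)
  have "real (card nonmults) \<le> real (S + 2 * (a * b) * (card mults * d + S * G))"
    using card_nonmult_bound by simp
  then have "card nonmults \<le> S + 2 * (a * b) * (card mults * d + S * G)" by (simp only: of_nat_le_iff)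
  then have "K \<le> card mults * (1 + 2 * a * b * d) + (S + 2 * a * b * S * G)"
    unfolding K_split by (simp add: algebra_simps)
  also have "\<dots> \<le> J ^ 2 * (D * L * (S + m)) * (1 + 2 * a * b * d) + J ^ 2 * (S + 2 * a * b * S * G)"
    using J(1) by (intro add_mono mult_le_mono1 k) (auto simp: Suc_le_eq)
  also have "\<dots> = J ^ 2 * length_factor a b c d m"
    by (simp add: length_factor_def D_def L_def M_def G_def S_def small_size_def A_def algebra_simps)
  finally show ?thesis .
qed

theorem orbit_element_bound:
  assumes x: "x \<in> C"
  shows "x \<le> cycle_bound a b c d m"
proof -
  define J where "J = length_root a b c d m"
  have J: "J > length_factor a b c d m" "J \<ge> 2 ^ 38 * (A + 1)"
    by (simp_all add: J_def length_root_def A_def)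
  have size: "real (2 * (A + 1) * J * K) \<le> exp (real J / 16)"
    if "J \<ge> 2 ^ 38 * (A + 1)" "K \<le> 8 * J ^ 3" for J
  proof -
    have "2 * (A + 1) * J * K \<le> 2 * (A + 1) * J * (8 * J ^ 3)" using that(2) by (rule mult_le_mono2)
    also have "\<dots> = 16 * (A + 1) * J ^ 4" by (simp add: power3_eq_cube power4_eq_xxxx algebra_simps)
    finally have "real (2 * (A + 1) * J * K) \<le> real (16 * (A + 1) * J ^ 4)" by (rule of_nat_mono)
    then show ?thesis using polynomial_le_exp[OF that(1)] by linarith
  qed
  have K: "K \<le> J ^ 3"
  proof (rule ccontr)
    assume "\<not> K \<le> J ^ 3"
    define n where "n = (LEAST n. K < (n + 1) ^ 3)"
    have ex: "K < (K + 1) ^ 3" by (rule less_le_trans[OF _ self_le_power]) auto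
    have n: "K < (n + 1) ^ 3" unfolding n_def by (rule LeastI[of _ K]) (rule ex)
    have "J < n + 1"
    proof (rule ccontr)
      assume "\<not> J < n + 1"
      then have "(n + 1) ^ 3 \<le> J ^ 3" by (intro power_mono) auto
      then show False using n \<open>\<not> K \<le> J ^ 3\<close> by linarith
    qed
    then have nJ: "n \<ge> J" "n > 0" using J(2) by auto
    have "n ^ 3 \<le> K"
    proof (rule ccontr)
      assume "\<not> n ^ 3 \<le> K"
      then have "K < (n - 1 + 1) ^ 3" using nJ by simp
      then have "n \<le> n - 1" unfolding n_def by (rule Least_le)
      then show False using nJ by simp
    qed
    have "(n + 1) ^ 3 \<le> (2 * n) ^ 3" using nJ by (intro power_mono) auto
    then have "K \<le> 8 * n ^ 3" using n by (simp add: power_mult_distrib)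
    moreover have "n \<ge> 2 ^ 38 * (A + 1)" using J(2) nJ by linarith
    ultimately have "real (2 * (A + 1) * n * K) \<le> exp (real n / 16)" by (intro size)
    moreover have "n \<ge> 8" using \<open>n \<ge> 2 ^ 38 * (A + 1)\<close> by simp
    ultimately have "K \<le> n ^ 2 * length_factor a b c d m" by (intro orbit_length_bound)
    \<comment> \<open>The contradiction comes from n >= \<open>length_root\<close> >
      \<open>length_factor\<close>.\<close>
    also have "\<dots> < n ^ 2 * n" using J(1) nJ by (intro mult_strict_left_mono) auto
    also have "\<dots> = n ^ 3" by (simp add: power2_eq_square power3_eq_cube)
    finally show False using \<open>n ^ 3 \<le> K\<close> by simp
  qed
  define Z where "Z = 2 * a * b * J ^ 3 * 3 ^ ((A * J) ^ 2) * (G * S)"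
  have "J \<ge> 8" using J(2) by simp
  have "Min C \<le> 2 * a * b * K * 3 ^ ((A * J) ^ 2)"
    using J(2) K by (intro Min_bound size) auto
  also have "\<dots> \<le> 2 * a * b * J ^ 3 * 3 ^ ((A * J) ^ 2)"
    using K by (intro mult_le_mono1 mult_le_mono2)
  also have "\<dots> * 1 \<le> Z" unfolding Z_def using G_S_pos by (intro mult_le_mono2) (simp add: Suc_le_eq)
  finally have 1: "Min C \<le> Z" by simp
  have "1 \<le> 2 * a * b * J ^ 3 * 3 ^ ((A * J) ^ 2)" using ab \<open>J \<ge> 8\<close> by (simp add: Suc_le_eq)
  then have "1 * (G * S) \<le> Z" unfolding Z_def by (rule mult_le_mono1)
  then have "G * S \<le> Z" by simp
  from element_bound[OF 1 this x] show ?thesis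
    by (simp add: cycle_bound_def Z_def J_def A_def G_def S_def small_size_def mult_ac)
qed

end


section \<open>Computable functions\<close>

text \<open>Functions of \<open>n\<close> arguments are functions of an environment \<open>\<rho>\<close>, of which only
  \<open>\<rho> 0, \<dots>, \<rho> (n - 1)\<close> matter; a bound variable is de Bruijn index 0.\<close>

definition computable :: "nat \<Rightarrow> ((nat \<Rightarrow> nat) \<Rightarrow> nat) \<Rightarrow> bool" where
  "computable n F \<longleftrightarrow> (\<exists>e. \<forall>\<rho>. rec_eval e (map \<rho> [0..<n]) (F \<rho>))"

definition decidable :: "nat \<Rightarrow> ((nat \<Rightarrow> nat) \<Rightarrow> bool) \<Rightarrow> bool" where
  "decidable n P \<longleftrightarrow> computable n (\<lambda>\<rho>. of_bool (P \<rho>))"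

section \<open>Closure under composition, recursion and arithmetic\<close>

named_theorems comp_intros

lemma computable_var [comp_intros]:
  assumes "i < n"
  shows "computable n (\<lambda>\<rho>. \<rho> i)"
  unfolding computable_def using rec_eval.proj[of i "map _ [0..<n]"] assms
  by (intro exI[of _ "Proj i"]) auto

lemma computable_comp:
  assumes "computable k F" "\<And>i. i < k \<Longrightarrow> computable n (G i)"
  shows "computable n (\<lambda>\<rho>. F (\<lambda>i. G i \<rho>))"
proof -
  obtain e where e: "\<And>\<rho>. rec_eval e (map \<rho> [0..<k]) (F \<rho>)"
    using assms(1) by (auto simp: computable_def)
  have "\<forall>i. \<exists>e. i < k \<longrightarrow> (\<forall>\<rho>. rec_eval e (map \<rho> [0..<n]) (G i \<rho>))"
    using assms(2) by (auto simp: computable_def)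
  then obtain h where h: "\<And>i \<rho>. i < k \<Longrightarrow> rec_eval (h i) (map \<rho> [0..<n]) (G i \<rho>)"
    by metis
  have "rec_eval (Comp e (map h [0..<k])) (map \<rho> [0..<n]) (F (\<lambda>i. G i \<rho>))" for \<rho>
    by (rule rec_eval.comp[OF _ e]) (simp add: list_all2_conv_all_nth h)
  then show ?thesis by (auto simp: computable_def)
qed

lemma computable_comp1:
  assumes "computable 1 (\<lambda>\<rho>. F (\<rho> 0))" "computable n f"
  shows "computable n (\<lambda>\<rho>. F (f \<rho>))"
  using computable_comp[OF assms(1), of n "\<lambda>_. f"] assms(2) by simp

lemma computable_shift:
  assumes "computable n F"
  shows "computable (Suc n) (\<lambda>\<rho>. F (\<lambda>i. \<rho> (Suc i)))"
  by (rule computable_comp[OF assms]) (simp add: computable_var)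

lemma computable_Suc [comp_intros]:
  assumes "computable n f"
  shows "computable n (\<lambda>\<rho>. Suc (f \<rho>))"
proof (rule computable_comp1[OF _ assms])
  show "computable 1 (\<lambda>\<rho>. Suc (\<rho> 0))"
    unfolding computable_def by (intro exI[of _ Succ]) (auto intro: rec_eval.succ)
qed

lemma computable_const [comp_intros]: "computable n (\<lambda>\<rho>. k)"
proof (induction k)
  case 0
  show ?case unfolding computable_def by (intro exI[of _ Zero]) (auto intro: rec_eval.zero)
next
  case (Suc k)
  then show ?case by (rule computable_Suc)
qed

lemma map_upt_Suc_shift: "map \<rho> [0..<Suc n] = \<rho> 0 # map (\<lambda>i. \<rho> (Suc i)) [0..<n]"
  by (simp add: upt_conv_Cons map_Suc_upt[symmetric] del: upt_Suc)

text \<open>In the step function index 0 is the counter, index 1 the previous value, and the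
  parameters are shifted by 2. The number of steps may itself depend on the parameters: composition
  substitutes it for the recursion variable.\<close>

lemma computable_rec [comp_intros]:
  assumes b: "computable n b" and g: "computable n g"
    and h: "computable (Suc (Suc n)) (\<lambda>\<rho>. h (\<rho> 0) (\<rho> 1) (\<lambda>i. \<rho> (Suc (Suc i))))"
  shows "computable n (\<lambda>\<rho>. rec_nat (g \<rho>) (\<lambda>k y. h k y \<rho>) (b \<rho>))"
proof -
  obtain eg where eg: "\<And>\<rho>. rec_eval eg (map \<rho> [0..<n]) (g \<rho>)"
    using g by (auto simp: computable_def)
  obtain eh where eh: "\<And>\<rho>. rec_eval eh (map \<rho> [0..<Suc (Suc n)]) (h (\<rho> 0) (\<rho> 1) (\<lambda>i. \<rho> (Suc (Suc i))))"
    using h by (auto simp: computable_def)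
  have h_step: "rec_eval eh (k # y # map \<rho> [0..<n]) (h k y \<rho>)" for k y \<rho>
    using eh[of "case_nat k (case_nat y \<rho>)"] by (simp add: map_upt_Suc_shift del: upt_Suc)
  have "rec_eval (PrimRec eg eh) (k # map \<rho> [0..<n]) (rec_nat (g \<rho>) (\<lambda>k y. h k y \<rho>) k)" for k \<rho>
    by (induction k) (auto intro: rec_eval.prim_0 eg rec_eval.prim_Suc h_step)
  then have "computable (Suc n) (\<lambda>\<rho>. rec_nat (g (\<lambda>i. \<rho> (Suc i))) (\<lambda>k y. h k y (\<lambda>i. \<rho> (Suc i))) (\<rho> 0))"
    unfolding computable_def map_upt_Suc_shift by (intro exI[of _ "PrimRec eg eh"]) auto
  from computable_comp[OF this, of n "case_nat b (\<lambda>i \<rho>. \<rho> i)"] show ?thesis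
    using b by (auto simp: computable_var split: nat.split)
qed

lemma computable_add [comp_intros]:
  assumes "computable n f" "computable n g"
  shows "computable n (\<lambda>\<rho>. f \<rho> + g \<rho>)"
proof -
  have eq: "x + y = rec_nat x (\<lambda>k y. Suc y) y" for x y :: nat by (induction y) auto
  show ?thesis unfolding eq by (intro comp_intros assms) simp
qed

lemma computable_mult [comp_intros]:
  assumes "computable n f" "computable n g"
  shows "computable n (\<lambda>\<rho>. f \<rho> * g \<rho>)"
proof -
  have eq: "x * y = rec_nat 0 (\<lambda>k z. z + x) y" for x y :: nat by (induction y) auto
  show ?thesis unfolding eq
    by (intro comp_intros assms computable_shift[OF computable_shift[OF assms(1)]]) simp
qed

lemma computable_power [comp_intros]:
  assumes "computable n f" "computable n g"
  shows "computable n (\<lambda>\<rho>. f \<rho> ^ g \<rho>)"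
proof -
  have eq: "x ^ y = rec_nat 1 (\<lambda>k z. z * x) y" for x y :: nat by (induction y) auto
  show ?thesis unfolding eq
    by (intro comp_intros assms computable_shift[OF computable_shift[OF assms(1)]]) simp
qed

lemma computable_diff [comp_intros]:
  assumes "computable n f" "computable n g"
  shows "computable n (\<lambda>\<rho>. f \<rho> - g \<rho>)"
proof -
  have pred: "y - 1 = rec_nat 0 (\<lambda>k z. k) y" for y :: nat by (cases y) auto
  have eq: "x - y = rec_nat x (\<lambda>k z. rec_nat 0 (\<lambda>k z. k) z) y" for x y :: nat
    by (induction y) (auto simp flip: pred)
  show ?thesis unfolding eq by (intro comp_intros assms) simp_all
qed

text \<open>Bounded sums later express bounded quantifiers, counting, and the search for a unique
  value.\<close>

lemma computable_sum [comp_intros]: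
  assumes b: "computable n b" and F: "computable (Suc n) (\<lambda>\<rho>. F (\<rho> 0) (\<lambda>i. \<rho> (Suc i)))"
  shows "computable n (\<lambda>\<rho>. \<Sum>y<b \<rho>. F y \<rho>)"
proof -
  have eq: "(\<Sum>y<k. F y \<rho>) = rec_nat 0 (\<lambda>k z. z + F k \<rho>) k" for k \<rho> by (induction k) auto
  have "computable (Suc (Suc n)) (\<lambda>\<rho>. F (\<rho> 0) (\<lambda>i. \<rho> (Suc (Suc i))))"
    using computable_comp[OF F, of "Suc (Suc n)" "case_nat (\<lambda>\<rho>. \<rho> 0) (\<lambda>i \<rho>. \<rho> (Suc (Suc i)))"]
    by (auto simp: computable_var split: nat.split)
  then show ?thesis unfolding eq by (intro comp_intros b) simp_all
qed

section \<open>Decidable relations and bounded quantifiers\<close>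

lemma decidable_le [comp_intros]:
  assumes "computable n f" "computable n g"
  shows "decidable n (\<lambda>\<rho>. f \<rho> \<le> g \<rho>)"
proof -
  have eq: "of_bool (x \<le> y) = 1 - (x - y)" for x y :: nat by auto
  show ?thesis unfolding decidable_def eq by (intro comp_intros assms)
qed

lemma decidable_not [comp_intros]:
  assumes "decidable n P"
  shows "decidable n (\<lambda>\<rho>. \<not> P \<rho>)"
proof -
  have eq: "of_bool (\<not> P \<rho>) = 1 - (of_bool (P \<rho>) :: nat)" for \<rho> by auto
  show ?thesis unfolding decidable_def eq by (intro comp_intros assms[unfolded decidable_def])
qed

lemma decidable_conj [comp_intros]:
  assumes "decidable n P" "decidable n Q"
  shows "decidable n (\<lambda>\<rho>. P \<rho> \<and> Q \<rho>)"
proof -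
  have eq: "of_bool (P \<rho> \<and> Q \<rho>) = of_bool (P \<rho>) * (of_bool (Q \<rho>) :: nat)" for \<rho> by auto
  show ?thesis unfolding decidable_def eq by (intro comp_intros assms[unfolded decidable_def])
qed

lemma decidable_imp [comp_intros]:
  assumes "decidable n P" "decidable n Q"
  shows "decidable n (\<lambda>\<rho>. P \<rho> \<longrightarrow> Q \<rho>)"
proof -
  have eq: "(P \<rho> \<longrightarrow> Q \<rho>) \<longleftrightarrow> \<not> (P \<rho> \<and> \<not> Q \<rho>)" for \<rho> by auto
  show ?thesis unfolding eq by (intro comp_intros assms)
qed

lemma decidable_iff [comp_intros]:
  assumes "decidable n P" "decidable n Q"
  shows "decidable n (\<lambda>\<rho>. P \<rho> \<longleftrightarrow> Q \<rho>)"
  unfolding iff_conv_conj_imp by (intro comp_intros assms)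

lemma decidable_less [comp_intros]:
  assumes "computable n f" "computable n g"
  shows "decidable n (\<lambda>\<rho>. f \<rho> < g \<rho>)"
  unfolding less_eq_Suc_le by (intro comp_intros assms)

lemma decidable_eq [comp_intros]:
  assumes "computable n f" "computable n g"
  shows "decidable n (\<lambda>\<rho>. f \<rho> = g \<rho>)"
  unfolding eq_iff by (intro comp_intros assms)

lemma decidable_bex [comp_intros]:
  assumes "computable n b" "decidable (Suc n) (\<lambda>\<rho>. R (\<rho> 0) (\<lambda>i. \<rho> (Suc i)))"
  shows "decidable n (\<lambda>\<rho>. \<exists>y<b \<rho>. R y \<rho>)"
proof -
  have eq: "(\<exists>y<b \<rho>. R y \<rho>) \<longleftrightarrow> \<not> (\<Sum>y<b \<rho>. of_bool (R y \<rho>) :: nat) \<le> 0" for \<rho>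
    unfolding le_zero_eq by (subst sum_eq_0_iff) auto
  show ?thesis unfolding eq by (intro comp_intros assms assms(2)[unfolded decidable_def])
qed

lemma decidable_ball [comp_intros]:
  assumes "computable n b" "decidable (Suc n) (\<lambda>\<rho>. R (\<rho> 0) (\<lambda>i. \<rho> (Suc i)))"
  shows "decidable n (\<lambda>\<rho>. \<forall>y<b \<rho>. R y \<rho>)"
proof -
  have eq: "(\<forall>y<b \<rho>. R y \<rho>) \<longleftrightarrow> \<not> (\<exists>y<b \<rho>. \<not> R y \<rho>)" for \<rho> by auto
  show ?thesis unfolding eq by (intro comp_intros assms)
qed

lemma computable_of_bool [comp_intros]:
  "decidable n P \<Longrightarrow> computable n (\<lambda>\<rho>. of_bool (P \<rho>))"
  by (simp add: decidable_def)

lemma computable_if [comp_intros]: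
  assumes "decidable n P" "computable n f" "computable n g"
  shows "computable n (\<lambda>\<rho>. if P \<rho> then f \<rho> else g \<rho>)"
proof -
  have eq: "(if P \<rho> then f \<rho> else g \<rho>) = of_bool (P \<rho>) * f \<rho> + of_bool (\<not> P \<rho>) * g \<rho>" for \<rho>
    by auto
  show ?thesis unfolding eq by (intro comp_intros assms)
qed

text \<open>The quotient counts the positive multiples of the divisor that do not exceed the
  dividend.\<close>

lemma computable_div [comp_intros]:
  assumes "computable n f" "computable n g"
  shows "computable n (\<lambda>\<rho>. f \<rho> div g \<rho>)"
proof -
  have eq: "x div y = (if y = 0 then 0 else \<Sum>i<x. of_bool ((i + 1) * y \<le> x))" for x y :: nat
  proof (cases "y = 0")
    case False
    then have *: "(i + 1) * y \<le> x \<longleftrightarrow> i + 1 \<le> x div y" for i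
      by (intro less_eq_div_iff_mult_less_eq[symmetric]) simp
    have "{..<x} \<inter> {i. i + 1 \<le> x div y} = {..<x div y}"
      by (auto intro: less_le_trans[OF _ div_le_dividend])
    then show ?thesis using False unfolding * by simp
  qed simp
  show ?thesis unfolding eq by (intro comp_intros assms computable_shift) simp
qed

lemma computable_mod [comp_intros]:
  assumes "computable n f" "computable n g"
  shows "computable n (\<lambda>\<rho>. f \<rho> mod g \<rho>)"
  unfolding modulo_nat_def by (intro comp_intros assms)

lemma decidable_dvd [comp_intros]:
  assumes "computable n f" "computable n g"
  shows "decidable n (\<lambda>\<rho>. f \<rho> dvd g \<rho>)"
  unfolding dvd_eq_mod_eq_0 by (intro comp_intros assms)

section \<open>Codes of pairs and lists\<close>

lemma computable_prod_encode [comp_intros]: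
  assumes "computable n f" "computable n g"
  shows "computable n (\<lambda>\<rho>. prod_encode (f \<rho>, g \<rho>))"
  unfolding prod_encode_def triangle_def split by (intro comp_intros assms)

text \<open>Components are at most the code, and only one i has a matching j, so the sum over all
  such i is the first component.\<close>

lemma computable_fst_prod_decode [comp_intros]:
  assumes "computable n f"
  shows "computable n (\<lambda>\<rho>. fst (prod_decode (f \<rho>)))"
proof -
  have eq: "fst (prod_decode x) = (\<Sum>i<Suc x. if \<exists>j<Suc x. prod_encode (i, j) = x then i else 0)" for x
  proof -
    obtain u v where uv: "x = prod_encode (u, v)" by (metis prod_decode_inverse surj_pair)
    have "(\<exists>j<Suc x. prod_encode (i, j) = x) \<longleftrightarrow> i = u" for i
      using le_prod_encode_2[of v u] by (auto simp: uv less_Suc_eq_le)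
    moreover have "u < Suc x" using le_prod_encode_1[of u v] by (simp add: uv less_Suc_eq_le)
    ultimately show ?thesis by (simp add: sum.delta uv)
  qed
  show ?thesis unfolding eq
    by (intro comp_intros assms computable_shift computable_shift[OF computable_shift[OF assms]]) simp_all
qed

lemma computable_snd_prod_decode [comp_intros]:
  assumes "computable n f"
  shows "computable n (\<lambda>\<rho>. snd (prod_decode (f \<rho>)))"
proof -
  have eq: "snd (prod_decode x) = (\<Sum>i<Suc x. if prod_encode (fst (prod_decode x), i) = x then i else 0)" for x
  proof -
    obtain u v where uv: "x = prod_encode (u, v)" by (metis prod_decode_inverse surj_pair)
    have "prod_encode (fst (prod_decode x), i) = x \<longleftrightarrow> i = v" for i by (auto simp: uv)
    moreover have "v < Suc x" using le_prod_encode_2[of v u] by (simp add: uv less_Suc_eq_le)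
    ultimately show ?thesis by (simp add: sum.delta uv)
  qed
  show ?thesis unfolding eq
    by (intro comp_intros assms computable_shift) simp_all
qed

text \<open>The code 0 is the empty list, and x + 1 is the list whose head and tail code form the
  pair x. The value at 0 agrees with \<open>tl [] = []\<close>.\<close>

definition tail_code :: "nat \<Rightarrow> nat" where
  "tail_code x = (if x = 0 then 0 else snd (prod_decode (x - 1)))"

definition drop_code :: "nat \<Rightarrow> nat \<Rightarrow> nat" where
  "drop_code x i = rec_nat x (\<lambda>k y. tail_code y) i"

lemma list_decode_tail_code: "list_decode (tail_code x) = tl (list_decode x)"
  by (cases x) (auto simp: tail_code_def split: prod.split)

lemma list_decode_drop_code: "list_decode (drop_code x i) = drop i (list_decode x)"
  by (induction i) (auto simp: drop_code_def list_decode_tail_code tl_drop drop_Suc)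

lemma list_decode_eq_Nil_iff: "list_decode x = [] \<longleftrightarrow> x = 0"
  by (cases x) (auto split: prod.split)

lemma computable_drop_code [comp_intros]:
  assumes "computable n f" "computable n g"
  shows "computable n (\<lambda>\<rho>. drop_code (f \<rho>) (g \<rho>))"
  unfolding drop_code_def tail_code_def by (intro comp_intros assms) simp_all

lemma length_le_list_encode: "length xs \<le> list_encode xs"
proof (induction xs)
  case (Cons x xs)
  then show ?case using le_prod_encode_2[of "list_encode xs" x] by simp
qed simp

text \<open>Consequently an inspection of all numbers below a list code sees every member of the
  list.\<close>

lemma member_le_list_encode: "x \<in> set xs \<Longrightarrow> x < list_encode xs"
proof (induction xs)
  case (Cons y xs)
  then show ?case
    using le_prod_encode_2[of "list_encode xs" y] le_prod_encode_1[of y "list_encode xs"]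
    by (auto simp: less_Suc_eq_le)
qed simp

text \<open>Beyond the end the value is 0, which makes indexing total.\<close>

definition code_nth :: "nat \<Rightarrow> nat \<Rightarrow> nat" where
  "code_nth x i = (if i < length (list_decode x) then list_decode x ! i else 0)"

text \<open>The length is the number of i for which dropping i elements leaves a nonzero code, that
  is, a nonempty list.\<close>

lemma computable_length [comp_intros]:
  assumes "computable n f"
  shows "computable n (\<lambda>\<rho>. length (list_decode (f \<rho>)))"
proof -
  have eq: "length (list_decode x) = (\<Sum>i<x. of_bool (drop_code x i \<noteq> 0))" for x
  proof -
    have "drop_code x i \<noteq> 0 \<longleftrightarrow> i < length (list_decode x)" for i
      by (auto simp: list_decode_drop_code not_le simp flip: list_decode_eq_Nil_iff)
    moreover have "length (list_decode x) \<le> x"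
      using length_le_list_encode[of "list_decode x"] by simp
    then have "{..<x} \<inter> {i. i < length (list_decode x)} = {..<length (list_decode x)}" by auto
    ultimately show ?thesis by simp
  qed
  show ?thesis unfolding eq by (intro comp_intros assms computable_shift) simp
qed

lemma computable_code_nth [comp_intros]:
  assumes "computable n f" "computable n g"
  shows "computable n (\<lambda>\<rho>. code_nth (f \<rho>) (g \<rho>))"
proof -
  have eq: "code_nth x i = (if i < length (list_decode x) then fst (prod_decode (drop_code x i - 1)) else 0)" for x i
  proof (cases "i < length (list_decode x)")
    case True
    then have "list_decode x ! i = hd (list_decode (drop_code x i))" "list_decode (drop_code x i) \<noteq> []"
      by (simp_all add: list_decode_drop_code hd_drop_conv_nth)
    then show ?thesis
      using True by (cases "drop_code x i") (auto simp: code_nth_def split: prod.split)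
  qed (simp add: code_nth_def)
  show ?thesis unfolding eq by (intro comp_intros assms)
qed

text \<open>Minimization looks for the value 0, hence the negated predicate. Termination is asserted
  only for parameters that admit a solution.\<close>

lemma rec_eval_search:
  assumes "decidable (Suc n) P"
  obtains e where "\<And>\<rho> y. P (case_nat y \<rho>) \<Longrightarrow>
    \<exists>z. rec_eval e (map \<rho> [0..<n]) z \<and> P (case_nat z \<rho>)"
proof -
  have "computable (Suc n) (\<lambda>\<rho>. of_bool (\<not> P \<rho>))"
    by (intro comp_intros assms)
  then obtain e where e: "\<And>\<rho>. rec_eval e (map \<rho> [0..<Suc n]) (of_bool (\<not> P \<rho>))"
    by (auto simp: computable_def simp del: upt_Suc)
  have e': "rec_eval e (y # map \<rho> [0..<n]) (of_bool (\<not> P (case_nat y \<rho>)))" for y \<rho>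
    using e[of "case_nat y \<rho>"] by (simp add: map_upt_Suc_shift del: upt_Suc)
  show thesis
  proof
    fix \<rho> y assume y: "P (case_nat y \<rho>)"
    define z where "z = (LEAST z. P (case_nat z \<rho>))"
    have z: "P (case_nat z \<rho>)" unfolding z_def using y by (rule LeastI)
    have "rec_eval (Mu e) (map \<rho> [0..<n]) z"
    proof (rule rec_eval.mu)
      show "rec_eval e (z # map \<rho> [0..<n]) 0" using e'[of z \<rho>] z by simp
      show "\<forall>k<z. \<exists>y. rec_eval e (k # map \<rho> [0..<n]) (Suc y)"
      proof (intro allI impI)
        fix k assume "k < z"
        then have "\<not> P (case_nat k \<rho>)" unfolding z_def by (rule not_less_Least)
        then show "\<exists>y. rec_eval e (k # map \<rho> [0..<n]) (Suc y)"
          using e'[of k \<rho>] by (intro exI[of _ 0]) simp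
      qed
    qed
    with z show "\<exists>z. rec_eval (Mu e) (map \<rho> [0..<n]) z \<and> P (case_nat z \<rho>)" by blast
  qed
qed


section \<open>Computing the cycles\<close>

lemma nondiv_digits:
  fixes b i k :: nat
  assumes b: "b > 1" and i: "i \<in> {1..k * (b - 1)}"
  obtains q r where "i = q * (b - 1) + r + 1" "r + 1 < b" "q < k" "i + (i - 1) div (b - 1) = q * b + (r + 1)"
proof
  define q r where "q = (i - 1) div (b - 1)" and "r = (i - 1) mod (b - 1)"
  have "i - 1 = q * (b - 1) + r" unfolding q_def r_def by (rule div_mult_mod_eq[symmetric])
  then have "i = q * (b - 1) + r + 1" using i by auto
  then show 1: "i = (i - 1) div (b - 1) * (b - 1) + (i - 1) mod (b - 1) + 1" by (simp only: q_def r_def)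
  have "r < b - 1" using b by (simp add: r_def)
  then show "(i - 1) mod (b - 1) + 1 < b" by (simp add: r_def)
  have "i - 1 < k * (b - 1)" using i by auto
  then show "(i - 1) div (b - 1) < k" using b by (simp add: div_less_iff_less_mult)
  have "q * b = q * (b - 1) + q" using b by (cases b) auto
  then show "i + (i - 1) div (b - 1) = (i - 1) div (b - 1) * b + ((i - 1) mod (b - 1) + 1)"
    using 1 by (simp add: q_def)
qed

text \<open>After each block of b - 1 nonmultiples one multiple of b is skipped. The formula is
  strictly increasing and its k (b - 1) values lie in a set of that cardinality, so it lists this
  set in order.\<close>

lemma nondiv_eq:
  assumes b: "b > 1" and i: "i \<in> {1..k * (b - 1)}"
  shows "nondiv k b i = i + (i - 1) div (b - 1)"
proof -
  define S where "S = {x \<in> {1..k * b - 1}. \<not> b dvd x}"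
  define h where "h i = i + (i - 1) div (b - 1)" for i
  define N where "N = k * (b - 1)"
  have card: "card S = N" unfolding S_def N_def using b by (intro card_nondiv) auto
  have mono: "h i < h j" if "i < j" for i j
    unfolding h_def using that by (intro add_less_le_mono div_le_mono) auto
  have "h ` {1..N} \<subseteq> S"
  proof (rule image_subsetI)
    fix i assume "i \<in> {1..N}"
    then obtain q r where qr: "r + 1 < b" "q < k" "h i = q * b + (r + 1)"
      unfolding h_def N_def using nondiv_digits[OF b, of i k] by metis
    have "h i mod b = r + 1" using qr by simp
    then have "\<not> b dvd h i" by (simp add: dvd_eq_mod_eq_0)
    moreover have "Suc q * b \<le> k * b" using qr(2) by (intro mult_le_mono1) simp
    then have "h i \<le> k * b - 1" using qr by simp
    ultimately show "h i \<in> S" using qr by (simp add: S_def)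
  qed
  moreover have "inj_on h {1..N}"
    using mono by (intro linorder_inj_onI) (auto simp: less_le)
  then have "card (h ` {1..N}) = card S" by (simp add: card_image card)
  ultimately have "h ` {1..N} = S" by (intro card_subset_eq) (auto simp: S_def)
  then have "set (map h [1..<N + 1]) = S" by (simp add: atLeastLessThanSuc_atLeastAtMost del: upt_Suc)
  moreover have "sorted_wrt (<) (map h [1..<N + 1])"
    unfolding sorted_wrt_map using mono by (intro sorted_wrt_mono_rel[OF _ sorted_wrt_upt]) auto
  ultimately have "sorted_list_of_set S = map h [1..<N + 1]"
    using sorted_list_of_set_unique[of S "map h [1..<N + 1]"] card by (auto simp: S_def simp del: upt_Suc)
  then have "nondiv k b i = map h [1..<N + 1] ! (i - 1)" by (simp only: nondiv_def S_def)
  also have "\<dots> = h i" using i by (subst nth_map_upt) (auto simp: N_def)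
  finally show ?thesis by (simp only: h_def)
qed

text \<open>Below a nonmultiple r there are r div b positive multiples of b; subtracting them
  recovers the index without a search.\<close>

lemma nondiv_index:
  assumes b: "b > 1" and i: "i \<in> {1..k * (b - 1)}"
  shows "nondiv k b i - nondiv k b i div b = i"
proof -
  obtain q r where qr: "i = q * (b - 1) + r + 1" "r + 1 < b" "i + (i - 1) div (b - 1) = q * b + (r + 1)"
    using nondiv_digits[OF b i] by metis
  have "q * b = q * (b - 1) + q" using b by (cases b) auto
  moreover have "(q * b + (r + 1)) div b = q"
    by (rule div_nat_eqI) (use qr(2) in \<open>auto simp: mult.commute\<close>)
  ultimately show ?thesis unfolding nondiv_eq[OF b i] qr(3) using qr(1) by linarith
qed

lemma simple_gen_cases:
  assumes "admissible a b c d \<sigma>" "\<not> b dvd n"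
  obtains i where "i \<in> {1..a * (b - 1)}" "n mod (a * b) = nondiv a b i"
    "\<sigma> i \<in> {1..c * (d - 1)}"
    "simple_gen a b c d \<sigma> n = c * d * (n div (a * b)) + nondiv c d (\<sigma> i)"
proof -
  have adm: "a > 0" "b > 1" "a * (b - 1) = c * (d - 1)" "\<sigma> permutes {1..a * (b - 1)}"
    using assms(1) by (auto simp: admissible_def)
  define r where "r = n mod (a * b)"
  have "\<not> b dvd r" using assms(2) by (simp add: r_def dvd_mod_iff)
  then have "r \<noteq> 0" by (metis dvd_0_right)
  moreover have "r < a * b" using adm by (simp add: r_def)
  ultimately have "r \<in> {x \<in> {1..a * b - 1}. \<not> b dvd x}" using \<open>\<not> b dvd r\<close> by auto
  then have "r \<in> nondiv a b ` {1..a * (b - 1)}"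
    using bij_betw_imp_surj_on[OF bij_betw_nondiv[of b a]] adm by simp
  then obtain i where i: "i \<in> {1..a * (b - 1)}" "r = nondiv a b i" by blast
  show thesis
  proof (rule that[OF i(1)])
    show "n mod (a * b) = nondiv a b i" using i by (simp add: r_def)
    show "\<sigma> i \<in> {1..c * (d - 1)}" using i(1) permutes_in_image[OF adm(4)] adm(3) by metis
    have "n = a * b * (n div (a * b)) + nondiv a b i" by (simp add: i(2)[symmetric] r_def)
    then show "simple_gen a b c d \<sigma> n = c * d * (n div (a * b)) + nondiv c d (\<sigma> i)"
      using simple_gen_nondvd[of b i a c d \<sigma> "n div (a * b)"] i(1) adm by simp
  qed
qed

text \<open>If n = a b q + r and its image is c d q + s, the terms with q cancel, and a b s - c d r
  is a difference of two numbers strictly between 0 and a b c d.\<close>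

lemma gen_step_simple_gen:
  assumes adm: "admissible a b c d \<sigma>"
  shows "gen_step a b c d n (simple_gen a b c d \<sigma> n)"
proof (cases "b dvd n")
  case True
  then show ?thesis using adm by (auto simp: gen_step_def simple_gen_dvd admissible_def)
next
  case False
  have pos: "b > 0" "d > 0" "a > 0" "c > 0" using adm by (auto simp: admissible_def)
  obtain i where i: "i \<in> {1..a * (b - 1)}" "n mod (a * b) = nondiv a b i" "\<sigma> i \<in> {1..c * (d - 1)}"
    and f: "simple_gen a b c d \<sigma> n = c * d * (n div (a * b)) + nondiv c d (\<sigma> i)"
    using simple_gen_cases[OF adm False] by blast
  define r s q where "r = nondiv a b i" and "s = nondiv c d (\<sigma> i)" and "q = n div (a * b)"
  have r: "0 < r" "r < a * b"
    using bij_betwE[OF bij_betw_nondiv[OF pos(1), of a]] i(1) by (fastforce simp: r_def)+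
  have s: "0 < s" "s < c * d" "\<not> d dvd s"
    using bij_betwE[OF bij_betw_nondiv[OF pos(2), of c]] i(3) by (fastforce simp: s_def)+
  have n: "n = a * b * q + r" using i(2) by (simp add: q_def r_def flip: i(2))
  have "int (a * b * (c * d * q + s)) - int (c * d * n) = int (a * b * s) - int (c * d * r)"
    by (subst n) (simp add: algebra_simps)
  moreover have "a * b * s < a * b * (c * d)" "c * d * r < c * d * (a * b)" using r s pos by simp_all
  then have "a * b * s < a * b * c * d" "c * d * r < a * b * c * d" by (simp_all only: mult_ac)
  then have "\<bar>int (a * b * s) - int (c * d * r)\<bar> < int (a * b * c * d)" by linarith
  moreover have "\<not> d dvd c * d * q + s" using s(3) by (simp add: dvd_add_right_iff)
  ultimately show ?thesis
    using False unfolding gen_step_def f q_def[symmetric] s_def[symmetric] by simp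
qed

text \<open>The sum of the two bounds covers both orientations of the cycle, so one formula serves
  for b < d and b > d.\<close>

lemma orbit_of_cycle:
  assumes cyc: "is_cycle f xs" and step: "\<And>x. gen_step a b c d x (f x)"
    and pos: "a > 0" "b > 1" "c > 0" "d > 1" and N: "a * (b - 1) = c * (d - 1)" and "b \<noteq> d"
    and min: "card (local_minima xs) = m" "m > 0" and x: "x \<in> set xs"
  shows "x \<le> cycle_bound a b c d m + cycle_bound c d a b m"
proof -
  define C where "C = set xs"
  define L where "L = length xs"
  define g where "g = inv_into C f"
  have L: "L > 0" and dist: "distinct xs"
    and f_nth: "\<And>i. i < L \<Longrightarrow> f (xs ! i) = xs ! ((i + 1) mod L)"
    using cyc by (auto simp: is_cycle_def L_def)
  have C: "C = (!) xs ` {..<L}" by (auto simp: C_def L_def in_set_conv_nth)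
  have fC: "f x \<in> C" if "x \<in> C" for x
    using that L f_nth by (auto simp: C)
  have pred: "f (xs ! ((i + L - 1) mod L)) = xs ! i" if "i < L" for i
  proof -
    have "((i + L - 1) mod L + 1) mod L = (i + L - 1 + 1) mod L" by (rule mod_add_left_eq)
    also have "\<dots> = i" using that by simp
    finally show ?thesis using f_nth[of "(i + L - 1) mod L"] L by simp
  qed
  have "C \<subseteq> f ` C"
  proof
    fix y assume "y \<in> C"
    then obtain i where "i < L" "y = xs ! i" by (auto simp: C)
    then show "y \<in> f ` C" using pred[of i] L by (auto simp: C intro!: image_eqI[of _ f "xs ! ((i + L - 1) mod L)"])
  qed
  then have surj: "f ` C = C" using fC by auto
  have finC: "finite C" by (simp add: C_def)
  have inj: "inj_on f C" using surj finC by (simp add: eq_card_imp_inj_on)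
  have gC: "g x \<in> C" and fg: "f (g x) = x" and gf: "g (f x) = x" if "x \<in> C" for x
    using that inj surj by (auto simp: g_def inv_into_into f_inv_into_f inv_into_f_f)
  have funpow: "(f ^^ n) (xs ! i) = xs ! ((i + n) mod L)" if "i < L" for i n
  proof (induction n)
    case (Suc n)
    then show ?case using f_nth[of "(i + n) mod L"] L by (simp add: mod_Suc_eq)
  qed (use that in simp)
  have trans: "\<exists>n. (f ^^ n) x = y" if xy: "x \<in> C" "y \<in> C" for x y
  proof -
    obtain i j where ij: "i < L" "j < L" "x = xs ! i" "y = xs ! j" using xy by (auto simp: C)
    then have "(f ^^ (j + L - i)) x = y" using funpow[of i "j + L - i"] by simp
    then show ?thesis by blast
  qed
  have gpow: "(g ^^ n) ((f ^^ n) x) = x" if "x \<in> C" for n x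
    using that
  proof (induction n arbitrary: x)
    case (Suc n)
    then show ?case using fC gf by (simp add: funpow_swap1)
  qed simp
  have trans': "\<exists>n. (g ^^ n) x = y" if "x \<in> C" "y \<in> C" for x y
    using trans[OF that(2,1)] gpow[OF that(2)] by metis
  have step': "gen_step c d a b x (g x)" if "x \<in> C" for x
    using step[of "g x"] fg[OF that] gen_step_swap[of a b c d "g x" x] by simp
  have "{x \<in> C. x < f x \<and> x < g x} \<subseteq> (!) xs ` local_minima xs"
  proof
    fix x assume x: "x \<in> {x \<in> C. x < f x \<and> x < g x}"
    then obtain i where i: "i < L" "x = xs ! i" by (auto simp: C)
    have "xs ! ((i + L - 1) mod L) \<in> C" using L by (simp add: C_def L_def)
    then have "g x = cyc_pred xs i"
      using gf[of "xs ! ((i + L - 1) mod L)"] pred[OF i(1)] i(2) by (simp add: cyc_pred_def L_def)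
    moreover have "f x = cyc_succ xs i" using f_nth[OF i(1)] i(2) by (simp add: cyc_succ_def L_def)
    ultimately show "x \<in> (!) xs ` local_minima xs" using x i by (simp add: local_minima_def L_def)
  qed
  then have "card {x \<in> C. x < f x \<and> x < g x} \<le> card ((!) xs ` local_minima xs)"
    by (intro card_mono) (auto simp: local_minima_def)
  also have "\<dots> \<le> m" using card_image_le[of "local_minima xs" "(!) xs"] min by (simp add: local_minima_def)
  finally have minima: "card {x \<in> C. x < f x \<and> x < g x} \<le> m" .
  \<comment> \<open>0 is a fixed point, so a cycle through it has no local minimum, contrary to m >
    0.\<close>
  have "0 \<notin> C"
  proof
    assume 0: "0 \<in> C"
    have "f 0 = 0" using step[of 0] pos by (auto simp: gen_step_def)
    then have "(f ^^ n) 0 = 0" for n by (induction n) auto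
    then have "y = 0" if "y \<in> C" for y using trans[OF 0 that] by auto
    then have "cyc_pred xs i = 0" for i using L by (simp add: cyc_pred_def C_def L_def)
    then have "local_minima xs = {}" by (simp add: local_minima_def)
    then show False using min by simp
  qed
  have "C \<noteq> {}" using x by (auto simp: C_def)
  show ?thesis
  proof (cases "b < d")
    case True
    interpret orbit a b c d m C f g
      by unfold_locales (use pos True N finC \<open>C \<noteq> {}\<close> \<open>0 \<notin> C\<close> fC gC gf fg trans step minima in auto)
    show ?thesis using orbit_element_bound[of x] x by (simp add: C_def)
  next
    case False
    have "{x \<in> C. x < g x \<and> x < f x} = {x \<in> C. x < f x \<and> x < g x}" by auto
    then have minima': "card {x \<in> C. x < g x \<and> x < f x} \<le> m" using minima by simp
    interpret orbit c d a b m C g f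
      by unfold_locales (use pos False \<open>b \<noteq> d\<close> N finC \<open>C \<noteq> {}\<close> \<open>0 \<notin> C\<close> fC gC gf fg trans' step' minima' in auto)
    show ?thesis using orbit_element_bound[of x] x by (simp add: C_def)
  qed
qed

section \<open>Codes of cycles\<close>

definition code_bound :: "nat \<Rightarrow> nat \<Rightarrow> nat" where
  "code_bound B n = rec_nat 0 (\<lambda>k y. Suc (prod_encode (B, y))) n"

lemma prod_encode_mono:
  assumes "x \<le> x'" "y \<le> y'"
  shows "prod_encode (x, y) \<le> prod_encode (x', y')"
  using assms unfolding prod_encode_def triangle_def split
  by (intro add_mono div_le_mono mult_le_mono) auto

text \<open>\<open>code_bound B n\<close> is the code of the list of \<open>n\<close> copies of
  \<open>B\<close>, and pairing is monotone in both arguments.\<close>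

lemma list_encode_le_code_bound:
  "(\<And>x. x \<in> set xs \<Longrightarrow> x \<le> B) \<Longrightarrow> length xs \<le> n \<Longrightarrow> list_encode xs \<le> code_bound B n"
proof (induction n arbitrary: xs)
  case (Suc n)
  then show ?case by (cases xs) (auto simp: code_bound_def prod_encode_mono)
qed simp

definition m_cycle_code_bound :: "nat \<Rightarrow> nat \<Rightarrow> nat \<Rightarrow> nat \<Rightarrow> nat \<Rightarrow> nat" where
  "m_cycle_code_bound a b c d m =
     code_bound (cycle_bound a b c d m + cycle_bound c d a b m)
       (cycle_bound a b c d m + cycle_bound c d a b m + 1)"

lemma m_cycle_list_encode_le:
  assumes adm: "admissible a b c d \<sigma>" and "b \<noteq> d" "m > 0"
    and cyc: "m_cycle (simple_gen a b c d \<sigma>) m xs"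
  shows "list_encode xs \<le> m_cycle_code_bound a b c d m"
proof -
  define B where "B = cycle_bound a b c d m + cycle_bound c d a b m"
  have B: "x \<le> B" if "x \<in> set xs" for x
    unfolding B_def using adm cyc \<open>b \<noteq> d\<close> \<open>m > 0\<close> that
    by (intro orbit_of_cycle[OF _ gen_step_simple_gen[OF adm]]) (auto simp: admissible_def m_cycle_def)
  have "distinct xs" using cyc by (simp add: m_cycle_def is_cycle_def)
  \<comment> \<open>At most B + 1 distinct numbers are bounded by B; hence the second argument B + 1
    of \<open>code_bound\<close>.\<close>
  then have "length xs = card (set xs)" by (simp add: distinct_card)
  also have "\<dots> \<le> card {..B}" using B by (intro card_mono) auto
  finally show ?thesis
    unfolding m_cycle_code_bound_def B_def[symmetric] using B by (intro list_encode_le_code_bound) auto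
qed

text \<open>The remainder r = n mod (a b) has index r - r div b among the nonmultiples of b; the
  list coded by \<open>s\<close> starts at position 0, so the value of the permutation there is
  found one position earlier. Adding its predecessor divided by d - 1 gives the corresponding
  nonmultiple of d.\<close>

definition gen_code :: "nat \<Rightarrow> nat \<Rightarrow> nat \<Rightarrow> nat \<Rightarrow> nat \<Rightarrow> nat \<Rightarrow> nat" where
  "gen_code a b c d s n =
     (if b dvd n then d * (n div b)
      else c * d * (n div (a * b)) +
        (code_nth s (n mod (a * b) - n mod (a * b) div b - 1) +
         (code_nth s (n mod (a * b) - n mod (a * b) div b - 1) - 1) div (d - 1)))"

lemma gen_code_perm_code:
  assumes adm: "admissible a b c d \<sigma>"
  shows "gen_code a b c d (perm_code (a * (b - 1)) \<sigma>) n = simple_gen a b c d \<sigma> n"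
proof (cases "b dvd n")
  case True
  then show ?thesis by (simp add: gen_code_def simple_gen_def)
next
  case False
  obtain i where i: "i \<in> {1..a * (b - 1)}" "n mod (a * b) = nondiv a b i" "\<sigma> i \<in> {1..c * (d - 1)}"
    and f: "simple_gen a b c d \<sigma> n = c * d * (n div (a * b)) + nondiv c d (\<sigma> i)"
    using simple_gen_cases[OF adm False] by blast
  have bd: "b > 1" "d > 1" using adm by (auto simp: admissible_def)
  have "n mod (a * b) - n mod (a * b) div b = i"
    unfolding i(2) by (rule nondiv_index[OF bd(1) i(1)])
  moreover have "code_nth (perm_code (a * (b - 1)) \<sigma>) (i - 1) = \<sigma> i"
    using i(1) by (auto simp: code_nth_def perm_code_def simp del: upt_Suc)
  ultimately show ?thesis
    using False by (simp add: gen_code_def f nondiv_eq[OF bd(2) i(3)])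
qed

text \<open>Only arithmetic, bounded quantifiers and bounded sums occur, so that the closure rules
  apply; cardinalities become sums of \<open>of_bool\<close> for this reason.\<close>

definition m_cycle_code :: "nat \<Rightarrow> nat \<Rightarrow> nat \<Rightarrow> nat \<Rightarrow> nat \<Rightarrow> nat \<Rightarrow> nat \<Rightarrow> bool" where
  "m_cycle_code a b c d s m x \<longleftrightarrow>
     0 < length (list_decode x) \<and>
     (\<forall>i < length (list_decode x). \<forall>j < length (list_decode x).
        code_nth x i = code_nth x j \<longrightarrow> i = j) \<and>
     (\<forall>i < length (list_decode x).
        gen_code a b c d s (code_nth x i) = code_nth x ((i + 1) mod length (list_decode x))) \<and>
     (\<Sum>i < length (list_decode x). of_bool
        (code_nth x i < code_nth x ((i + length (list_decode x) - 1) mod length (list_decode x)) \<and>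
         code_nth x i < code_nth x ((i + 1) mod length (list_decode x)))) = m \<and>
     (\<Sum>i < length (list_decode x). of_bool
        (code_nth x ((i + length (list_decode x) - 1) mod length (list_decode x)) < code_nth x i \<and>
         code_nth x ((i + 1) mod length (list_decode x)) < code_nth x i)) = m"

lemma m_cycle_code_iff:
  assumes adm: "admissible a b c d \<sigma>"
  shows "m_cycle_code a b c d (perm_code (a * (b - 1)) \<sigma>) m x \<longleftrightarrow>
    m_cycle (simple_gen a b c d \<sigma>) m (list_decode x)"
proof (cases "list_decode x = []")
  case True
  then show ?thesis by (simp add: m_cycle_code_def m_cycle_def is_cycle_def)
next
  case False
  define xs where "xs = list_decode x"
  define L where "L = length xs"
  have L: "L > 0" using False by (simp add: L_def xs_def)
  have nth: "code_nth x i = xs ! i" if "i < L" for i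
    using that by (simp add: code_nth_def xs_def L_def)
  have nth_mod: "code_nth x (i mod L) = xs ! (i mod L)" for i using L by (intro nth) simp
  have sum: "(\<Sum>i<L. of_bool (Q i)) = card {i. i < L \<and> Q i}" for Q
  proof -
    have "{..<L} \<inter> {i. Q i} = {i. i < L \<and> Q i}" by auto
    then show ?thesis by simp
  qed
  have "m_cycle_code a b c d (perm_code (a * (b - 1)) \<sigma>) m x \<longleftrightarrow>
    (\<forall>i<L. \<forall>j<L. xs ! i = xs ! j \<longrightarrow> i = j) \<and>
    (\<forall>i<L. simple_gen a b c d \<sigma> (xs ! i) = xs ! ((i + 1) mod L)) \<and>
    card {i. i < L \<and> (xs ! i < xs ! ((i + L - 1) mod L) \<and> xs ! i < xs ! ((i + 1) mod L))} = m \<and>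
    card {i. i < L \<and> (xs ! ((i + L - 1) mod L) < xs ! i \<and> xs ! ((i + 1) mod L) < xs ! i)} = m"
    unfolding m_cycle_code_def xs_def[symmetric] L_def[symmetric] gen_code_perm_code[OF adm] nth_mod sum
    using L by (simp add: nth cong: conj_cong)
  also have "\<dots> \<longleftrightarrow> m_cycle (simple_gen a b c d \<sigma>) m xs"
    using L by (auto simp: m_cycle_def is_cycle_def local_minima_def local_maxima_def cyc_pred_def
        cyc_succ_def L_def distinct_conv_nth)
  finally show ?thesis by (simp add: xs_def)
qed

lemma computable_cycle_bound [comp_intros]:
  assumes "computable n a" "computable n b" "computable n c" "computable n d" "computable n m"
  shows "computable n (\<lambda>\<rho>. cycle_bound (a \<rho>) (b \<rho>) (c \<rho>) (d \<rho>) (m \<rho>))"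
  unfolding cycle_bound_def length_root_def length_factor_def small_size_def log_scale_def
  by (intro comp_intros assms)

lemma computable_code_bound [comp_intros]:
  assumes "computable n B" "computable n k"
  shows "computable n (\<lambda>\<rho>. code_bound (B \<rho>) (k \<rho>))"
  unfolding code_bound_def
  by (intro comp_intros assms computable_shift[OF computable_shift[OF assms(1)]]) simp_all

text \<open>Argument 0 of \<open>lists_m_cycles\<close> is the candidate for the output, arguments 1 to 6 are the
  input.\<close>

definition lists_m_cycles :: "(nat \<Rightarrow> nat) \<Rightarrow> bool" where
  "lists_m_cycles \<rho> \<longleftrightarrow>
     (\<forall>x < \<rho> 0 + (m_cycle_code_bound (\<rho> 1) (\<rho> 2) (\<rho> 3) (\<rho> 4) (\<rho> 6) + 1).
        (\<exists>i < length (list_decode (\<rho> 0)). code_nth (\<rho> 0) i = x) \<longleftrightarrow>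
        m_cycle_code (\<rho> 1) (\<rho> 2) (\<rho> 3) (\<rho> 4) (\<rho> 5) (\<rho> 6) x)"

lemma decidable_lists_m_cycles: "decidable 7 lists_m_cycles"
  unfolding lists_m_cycles_def[abs_def] m_cycle_code_def gen_code_def m_cycle_code_bound_def
  by (intro comp_intros) simp_all

lemma code_nth_image: "(\<exists>i < length (list_decode y). code_nth y i = x) \<longleftrightarrow> x \<in> set (list_decode y)"
  by (auto simp: code_nth_def in_set_conv_nth)

theorem mainTheorem2:
  shows "(\<forall>a b c d \<sigma> m. admissible a b c d \<sigma> \<longrightarrow> b \<noteq> d \<longrightarrow> m > 0 \<longrightarrow>
            finite {xs. m_cycle (simple_gen a b c d \<sigma>) m xs}) \<and>
         (\<exists>e. \<forall>a b c d \<sigma> m. admissible a b c d \<sigma> \<longrightarrow> b \<noteq> d \<longrightarrow> m > 0 \<longrightarrow>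
            (\<exists>y. rec_eval e [a, b, c, d, perm_code (a * (b - 1)) \<sigma>, m] y \<and>
                 codes_set y {xs. m_cycle (simple_gen a b c d \<sigma>) m xs}))"
proof (rule conjI)
  have finite_cycles: "finite {xs. m_cycle (simple_gen a b c d \<sigma>) m xs}"
    if "admissible a b c d \<sigma>" "b \<noteq> d" "m > 0" for a b c d \<sigma> m
  proof (rule finite_subset)
    show "{xs. m_cycle (simple_gen a b c d \<sigma>) m xs} \<subseteq> list_decode ` {..m_cycle_code_bound a b c d m}"
      using m_cycle_list_encode_le[OF that] by (auto intro!: image_eqI[of _ list_decode "list_encode _"])
  qed simp
  then show "\<forall>a b c d \<sigma> m. admissible a b c d \<sigma> \<longrightarrow> b \<noteq> d \<longrightarrow> m > 0 \<longrightarrow>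
    finite {xs. m_cycle (simple_gen a b c d \<sigma>) m xs}" by blast
  have "decidable (Suc 6) lists_m_cycles" using decidable_lists_m_cycles by simp
  then obtain e where e: "\<And>\<rho> y. lists_m_cycles (case_nat y \<rho>) \<Longrightarrow>
      \<exists>z. rec_eval e (map \<rho> [0..<6]) z \<and> lists_m_cycles (case_nat z \<rho>)"
    using rec_eval_search by blast
  have "\<exists>y. rec_eval e [a, b, c, d, perm_code (a * (b - 1)) \<sigma>, m] y \<and>
      codes_set y {xs. m_cycle (simple_gen a b c d \<sigma>) m xs}"
    if adm: "admissible a b c d \<sigma>" "b \<noteq> d" "m > 0" for a b c d \<sigma> m
  proof -
    define A where "A = {xs. m_cycle (simple_gen a b c d \<sigma>) m xs}"
    define W where "W = m_cycle_code_bound a b c d m"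
    define \<rho> where "\<rho> i = [a, b, c, d, perm_code (a * (b - 1)) \<sigma>, m] ! i" for i
    have args: "map \<rho> [0..<6] = [a, b, c, d, perm_code (a * (b - 1)) \<sigma>, m]"
      by (simp add: \<rho>_def upt_rec numeral_eq_Suc)
    \<comment> \<open>The range y + (W + 1) contains all members of the list coded by y, which are
      below y, and all codes of m-cycles, which are at most W.\<close>
    have lists: "lists_m_cycles (case_nat y \<rho>) \<longleftrightarrow>
        (\<forall>x < y + (W + 1). x \<in> set (list_decode y) \<longleftrightarrow> list_decode x \<in> A)" for y
      unfolding lists_m_cycles_def code_nth_image
      by (simp add: \<rho>_def W_def A_def m_cycle_code_iff[OF adm(1), unfolded One_nat_def] numeral_eq_Suc)
    have "finite (list_encode ` A)" using finite_cycles[OF adm] by (simp add: A_def)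
    from finite_list[OF this] obtain ys where ys: "set ys = list_encode ` A" ..
    have "x \<in> list_encode ` A \<longleftrightarrow> list_decode x \<in> A" for x
      by (metis image_iff list_decode_inverse list_encode_inverse)
    \<comment> \<open>Finiteness provides this solution, so the search terminates.\<close>
    then have "lists_m_cycles (case_nat (list_encode ys) \<rho>)" by (simp add: lists ys)
    then obtain z where z: "rec_eval e (map \<rho> [0..<6]) z" "lists_m_cycles (case_nat z \<rho>)"
      using e by blast
    have "list_decode ` set (list_decode z) = A"
    proof (intro equalityI subsetI)
      fix xs assume "xs \<in> list_decode ` set (list_decode z)"
      then obtain x where x: "x \<in> set (list_decode z)" "xs = list_decode x" by auto
      then have "x < z" using member_le_list_encode[of x "list_decode z"] by simp
      then show "xs \<in> A" using z(2) x by (simp add: lists)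
    next
      fix xs assume xs: "xs \<in> A"
      then have "list_encode xs \<le> W"
        unfolding W_def A_def using m_cycle_list_encode_le[OF adm] by simp
      then have "list_encode xs \<in> set (list_decode z)" using z(2) xs by (simp add: lists)
      then show "xs \<in> list_decode ` set (list_decode z)"
        by (intro image_eqI[of _ _ "list_encode xs"]) simp
    qed
    then show ?thesis using z(1) by (auto simp: args codes_set_def A_def)
  qed
  then show "\<exists>e. \<forall>a b c d \<sigma> m. admissible a b c d \<sigma> \<longrightarrow> b \<noteq> d \<longrightarrow> m > 0 \<longrightarrow>
      (\<exists>y. rec_eval e [a, b, c, d, perm_code (a * (b - 1)) \<sigma>, m] y \<and>
           codes_set y {xs. m_cycle (simple_gen a b c d \<sigma>) m xs})" by blast
qed

end
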